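(* Let $X$ be a simplicial complete toric surface, $\mathcal D\in Cl(X)$, let $\alpha=\sum_{i=1}^m A_i(z)\,dz_i\in\widehat\Omega^1_S(\mathcal D)$ define a foliation on $X$, and let $F:\mathbb P^n\dashrightarrow X$ ($n>m$) be a dominant rational map with a complete polynomial lifting $F=(F_1,\dots,F_m)$. Let $\omega=F^*\alpha$. Suppose that $(F,\alpha)$ is affinely generic and that the ring homomorphism $F^*:S_X\to S_{\mathbb P^n}$, $z_i\mapsto F_i$, is flat. Let $\omega_\varepsilon$ be a first order deformation of $\omega$. Then $\omega_\varepsilon$ is induced by a first order unfolding if and only if there exist homogeneous polynomials $G_1,\dots,G_m\in\mathbb C[x_0,\dots,x_n]$ with $\deg(G_j)=\deg(F_j)$ such that $$\omega_\varepsilon=(F+\varepsilon G)^*(\alpha).$$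
   Context: Toric notation. $X$ is the complete simplicial toric surface over $\mathbb C$ of a fan $\Sigma$ in $N\simeq\mathbb Z^2$; $v_1,\dots,v_m$ are the primitive generators of its rays and $D_1,\dots,D_m$ the corresponding torus-invariant prime divisors. $S=S_X=\mathbb C[z_1,\dots,z_m]$ is the homogeneous coordinate (Cox) ring, $Cl(X)$-graded by $\deg z_i=[D_i]$; $I_Z=\langle\prod_{v_i\notin\sigma(1)}z_i:\sigma\in\Sigma\rangle$ is the irrelevant ideal, $Z\subset\mathbb C^m$ its zero set, $G_X=Hom_{\mathbb Z}(Cl(X),\mathbb C^* )$, and $\pi_X:\mathbb C^m\setminus Z\to X$ the geometric quotient by $G_X$. $S_{\mathbb P^n}=\mathbb C[x_0,\dots,x_n]$ and $\pi:\mathbb C^{n+1}\setminus\{0\}\to\mathbb P^n$ is the quotient. A complete polynomial lifting of $F:\mathbb P^n\dashrightarrow X$ is a tuple of homogeneous polynomials $(F_1,\dots,F_m)$ (also denoted $F$) inducing the rational map through $\pi$ and $\pi_X$, such that the maximal open set on which the rational map is regular is $\mathbb P^n\setminus\pi(F^{-1}(Z))$. Forms. $\widehat\Omega^1_S(\mathcal D)=H^0(X,(\Omega^1_X\otimes\mathcal O_X(\mathcal D))^{\vee\vee})$, identified with polynomial forms $\alpha=\sum A_i\,dz_i$, $A_i$ homogeneous of degree $\mathcal D-[D_i]$, with $\imath_{R_j}\alpha=0$ for the radial fields $R_j=\sum_i a_i^j z_i\partial/\partial z_i$, $1\le j\le m-2$, where $(a_i^1,\dots,a_i^{m-2})$ is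 the free part of $\deg z_i$ under a fixed isomorphism $Cl(X)\simeq\mathbb Z^{m-2}\times H$, $H$ finite. $\alpha$ defines a foliation if $\alpha\wedge d\alpha=0$ and its zero locus in $X$ has codimension $\ge2$. $\omega=F^*\alpha=\sum A_i(F)\,dF_i$ is a homogeneous form on $\mathbb C^{n+1}$, i.e. an element of $H^0(\mathbb P^n,\Omega^1_{\mathbb P^n}(\ell))$, defining a foliation on $\mathbb P^n$. Ideals. For a polynomial form $\eta$ let $\mathscr C(\eta)$ be the ideal generated by its coefficients. $J(\alpha)=\mathscr C(\alpha)$ and $K(\alpha)=(J(\alpha):\mathscr C(d\alpha))$; likewise $J(\omega),K(\omega)\subseteq S_{\mathbb P^n}$. $Sing(\omega)$ is the scheme defined by $J(\omega)$. For an ideal $I\subseteq S_X$, $F^*I$ is the ideal of $S_{\mathbb P^n}$ generated by its image. Genericity. $\alpha$ is generic if $(J(\alpha):I_Z^\infty)=(K(\alpha):I_Z^\infty)$ and this ideal is radical. $\alpha$ is affinely generic if $J(\alpha)=K(\alpha)$ and this ideal is radical. $(F,\alpha)$ is generic if $\alpha$ is generic and (I) the set $C(F)$ of critical points of $F:\mathbb C^{n+1}\to\mathbb C^m$ has codimension at least three; (II) $Sing(\omega)$ is reduced along $C(F,\alpha)=\overline{\{p\in C(F):\alpha(F(p))\ne0,\ Im(d_pF)\subseteq\ker(\alpha(F(p)))\}}$ and has no embedded components supported at $Sing(\omega)\cap C(F)$. $(F,\alpha)$ is affinely generic if it is generic, $\alpha$ is affinely generic, and the scheme of $F^*K(\alpha)=\langle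 A_1(F),\dots,A_m(F)\rangle$ has no embedded components supported at $0\in\mathbb C^{n+1}$. Perturbations. A first order deformation of $\omega$ is $\omega_\varepsilon=\omega+\varepsilon\eta$ with $\varepsilon^2=0$, $\eta\in H^0(\mathbb P^n,\Omega^1_{\mathbb P^n}(\ell))$ and $\omega\wedge d\eta+\eta\wedge d\omega=0$, considered up to multiplication by units of $\mathbb C[\varepsilon]/(\varepsilon^2)$. It is induced by a first order unfolding if there is $h\in H^0(\mathbb P^n,\mathcal O_{\mathbb P^n}(\ell))$ with $h\,d\omega=\omega\wedge(\eta-dh)$ (equivalently, $\omega+\varepsilon\eta+h\,d\varepsilon$ is integrable). $(F+\varepsilon G)^*(\alpha)=\sum_i A_i(F+\varepsilon G)\,d(F_i+\varepsilon G_i)$ with $\varepsilon^2=0$ and $d$ relative to $\mathbb C[\varepsilon]/(\varepsilon^2)$. *)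

theory Defs
  imports
    "HOL-Analysis.Analysis"
    "HOL-Library.Poly_Mapping"
    "HOL-Library.Extended_Nat"
    "HOL-Algebra.Free_Abelian_Groups"
    "HOL-Algebra.Generated_Groups"
    "HOL-Algebra.Elementary_Groups"
    "HOL-Algebra.Ideal_Product"
    "HOL-Algebra.Module"
begin

section \<open>Polynomials over the complex numbers\<close>

text \<open>The variables are indexed by a finite type; \<open>'v \<Rightarrow>\<^sub>0 nat\<close> is the type of exponent
  vectors, and the ring structure is the convolution product of \<^theory>\<open>HOL-Library.Poly_Mapping\<close>.\<close>

type_synonym 'v mpoly = "('v \<Rightarrow>\<^sub>0 nat) \<Rightarrow>\<^sub>0 complex"

definition mvar :: "'v \<Rightarrow> 'v mpoly" where
  "mvar i = Poly_Mapping.single (Poly_Mapping.single i 1) 1"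

definition mconst :: "complex \<Rightarrow> 'v mpoly" where
  "mconst c = Poly_Mapping.single 0 c"

text \<open>Substitution of the elements \<open>f i\<close> of a commutative ring for the variables, the
  coefficients being mapped by \<open>c\<close>.\<close>

definition msubst ::
  "(complex \<Rightarrow> 'r::comm_ring_1) \<Rightarrow> ('v::finite \<Rightarrow> 'r) \<Rightarrow> 'v mpoly \<Rightarrow> 'r" where
  "msubst c f p =
     (\<Sum>a\<in>Poly_Mapping.keys p. c (Poly_Mapping.lookup p a) * (\<Prod>i\<in>UNIV. f i ^ Poly_Mapping.lookup a i))"

definition meval :: "'v::finite mpoly \<Rightarrow> ('v \<Rightarrow> complex) \<Rightarrow> complex" where
  "meval p z = msubst (\<lambda>c. c) z p"

definition mderiv :: "'v \<Rightarrow> 'v mpoly \<Rightarrow> 'v mpoly" where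
  "mderiv i p =
     (\<Sum>a\<in>Poly_Mapping.keys p. Poly_Mapping.single (a - Poly_Mapping.single i 1)
        (of_nat (Poly_Mapping.lookup a i) * Poly_Mapping.lookup p a))"

definition mon_degree :: "('v::finite \<Rightarrow>\<^sub>0 nat) \<Rightarrow> nat" where
  "mon_degree a = (\<Sum>i\<in>UNIV. Poly_Mapping.lookup a i)"

text \<open>The zero polynomial is homogeneous of every degree.\<close>

definition homogeneous :: "nat \<Rightarrow> 'v::finite mpoly \<Rightarrow> bool" where
  "homogeneous d p \<longleftrightarrow> (\<forall>a\<in>Poly_Mapping.keys p. mon_degree a = d)"

definition mdegree :: "'v::finite mpoly \<Rightarrow> nat" where
  "mdegree p = (if p = 0 then 0 else Max (mon_degree ` Poly_Mapping.keys p))"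

definition mpoly_ring :: "'v mpoly ring" where
  "mpoly_ring = \<lparr>carrier = UNIV, monoid.mult = (*), one = 1, zero = 0, add = (+)\<rparr>"

lemma cring_mpoly_ring: "cring (mpoly_ring :: 'v mpoly ring)"
proof (rule cringI)
  show "abelian_group (mpoly_ring :: 'v mpoly ring)"
  proof (rule abelian_groupI)
    fix x :: "'v mpoly"
    show "\<exists>y\<in>carrier mpoly_ring. y \<oplus>\<^bsub>mpoly_ring\<^esub> x = \<zero>\<^bsub>mpoly_ring\<^esub>"
      by (rule bexI[of _ "- x"]) (simp_all add: mpoly_ring_def)
  qed (simp_all add: mpoly_ring_def add_ac)
  show "comm_monoid (mpoly_ring :: 'v mpoly ring)"
    by (rule comm_monoidI) (simp_all add: mpoly_ring_def mult_ac)
qed (simp add: mpoly_ring_def algebra_simps)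

section \<open>Ideals\<close>

abbreviation ideal_gen :: "'v mpoly set \<Rightarrow> 'v mpoly set" where
  "ideal_gen T \<equiv> genideal mpoly_ring T"

definition ideal_colon :: "'v mpoly set \<Rightarrow> 'v mpoly set \<Rightarrow> 'v mpoly set" where
  "ideal_colon I J = {f. \<forall>g\<in>J. f * g \<in> I}"

definition ideal_power :: "'v mpoly set \<Rightarrow> nat \<Rightarrow> 'v mpoly set" where
  "ideal_power I k = I [^]\<^bsub>ideals_set mpoly_ring\<^esub> k"

definition ideal_saturation :: "'v mpoly set \<Rightarrow> 'v mpoly set \<Rightarrow> 'v mpoly set" where
  "ideal_saturation I J = (\<Union>k. ideal_colon I (ideal_power J k))"

definition radical_ideal :: "'v mpoly set \<Rightarrow> bool" where
  "radical_ideal I \<longleftrightarrow> (\<forall>f k. f ^ k \<in> I \<longrightarrow> f \<in> I)"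

definition zero_set :: "'v::finite mpoly set \<Rightarrow> ('v \<Rightarrow> complex) set" where
  "zero_set T = {z. \<forall>f\<in>T. meval f z = 0}"

definition associated_prime :: "'v mpoly set \<Rightarrow> 'v mpoly set \<Rightarrow> bool" where
  "associated_prime I P \<longleftrightarrow> primeideal P mpoly_ring \<and> (\<exists>f. P = ideal_colon I {f})"

definition embedded_prime :: "'v mpoly set \<Rightarrow> 'v mpoly set \<Rightarrow> bool" where
  "embedded_prime I P \<longleftrightarrow> associated_prime I P \<and> (\<exists>Q. associated_prime I Q \<and> Q \<subset> P)"

section \<open>Zariski topology, codimension, regular functions\<close>

definition zariski :: "('v::finite \<Rightarrow> complex) topology" where
  "zariski = topology (\<lambda>U. \<exists>T. U = - zero_set T)"

lemma meval_0 [simp]: "meval 0 z = 0"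
  by (simp add: meval_def msubst_def)

lemma meval_1 [simp]: "meval 1 z = 1"
  by (simp add: meval_def msubst_def one_poly_mapping.rep_eq)

lemma meval_sum_superset:
  assumes "finite B" "Poly_Mapping.keys p \<subseteq> B"
  shows "meval p z =
    (\<Sum>a\<in>B. Poly_Mapping.lookup p a * (\<Prod>i\<in>UNIV. z i ^ Poly_Mapping.lookup a i))"
  unfolding meval_def msubst_def using assms
  by (intro sum.mono_neutral_left) (auto simp: in_keys_iff)

lemma meval_add: "meval (p + q) z = meval p z + meval q z"
proof -
  let ?B = "Poly_Mapping.keys p \<union> Poly_Mapping.keys q"
  have "Poly_Mapping.keys (p + q) \<subseteq> ?B" by (rule Poly_Mapping.keys_add)
  then show ?thesis
    by (subst (1 2 3) meval_sum_superset[where B = ?B])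
      (auto simp: lookup_add sum.distrib algebra_simps)
qed

lemma meval_single:
  "meval (Poly_Mapping.single a c) z = c * (\<Prod>i\<in>UNIV. z i ^ Poly_Mapping.lookup a i)"
  by (subst meval_sum_superset[where B = "{a}"]) auto

lemma mpoly_induct [case_names zero add]:
  fixes p :: "'v mpoly"
  assumes "P 0" and add: "\<And>a c q. P q \<Longrightarrow> P (Poly_Mapping.single a c + q)"
  shows "P p"
proof (induction p rule: Poly_Mapping.update_induct)
  case (update f a b)
  have "Poly_Mapping.update a b f = Poly_Mapping.single a b + f"
    using update.hyps
    by (intro poly_mapping_eqI) (auto simp: lookup_update lookup_add lookup_single when_def in_keys_iff)
  with add[OF update.IH] show ?case by simp
qed (fact assms)

lemma meval_single_mult:
  "meval (Poly_Mapping.single a c * q) z = meval (Poly_Mapping.single a c) z * meval q z"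
  by (induction q rule: mpoly_induct)
    (simp_all add: mult_single meval_single lookup_add power_add prod.distrib distrib_left meval_add)

lemma meval_mult: "meval (p * q) z = meval p z * meval q z"
  by (induction p rule: mpoly_induct) (simp_all add: distrib_right meval_add meval_single_mult)

lemma zero_set_mult:
  "zero_set {f * g | f g. f \<in> T \<and> g \<in> T'} = zero_set T \<union> zero_set T'"
proof (rule Set.set_eqI)
  fix z
  have "z \<in> zero_set {f * g | f g. f \<in> T \<and> g \<in> T'} \<longleftrightarrow> (\<forall>f\<in>T. \<forall>g\<in>T'. meval (f * g) z = 0)"
    unfolding zero_set_def by blast
  also have "\<dots> \<longleftrightarrow> (\<forall>f\<in>T. \<forall>g\<in>T'. meval f z = 0 \<or> meval g z = 0)"
    by (simp only: meval_mult mult_eq_0_iff)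
  also have "\<dots> \<longleftrightarrow> z \<in> zero_set T \<union> zero_set T'"
    unfolding zero_set_def by blast
  finally show "z \<in> zero_set {f * g | f g. f \<in> T \<and> g \<in> T'} \<longleftrightarrow> z \<in> zero_set T \<union> zero_set T'" .
qed

lemma zero_set_Union: "zero_set (\<Union>i\<in>I. T i) = (\<Inter>i\<in>I. zero_set (T i))"
  unfolding zero_set_def by blast

lemma istopology_zariski: "istopology (\<lambda>U::('v::finite \<Rightarrow> complex) set. \<exists>T. U = - zero_set T)"
  unfolding istopology_def
proof (intro conjI allI impI)
  fix U V :: "('v \<Rightarrow> complex) set"
  assume "\<exists>T. U = - zero_set T" "\<exists>T. V = - zero_set T"
  then obtain T T' where "U = - zero_set T" "V = - zero_set T'" by blast
  then have "U \<inter> V = - zero_set {f * g | f g. f \<in> T \<and> g \<in> T'}"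
    unfolding zero_set_mult by blast
  then show "\<exists>T. U \<inter> V = - zero_set T" by (rule exI)
next
  fix \<K> :: "('v \<Rightarrow> complex) set set"
  assume "\<forall>U\<in>\<K>. \<exists>T. U = - zero_set T"
  then obtain T where "\<forall>U\<in>\<K>. U = - zero_set (T U)" by (rule bchoice[THEN exE])
  then have "\<Union>\<K> = - zero_set (\<Union>U\<in>\<K>. T U)"
    unfolding zero_set_Union by blast
  then show "\<exists>T. \<Union>\<K> = - zero_set T" by (rule exI)
qed

lemma openin_zariski: "openin zariski U \<longleftrightarrow> (\<exists>T. U = - zero_set T)"
  unfolding zariski_def topology_inverse'[OF istopology_zariski] ..

lemma topspace_zariski [simp]: "topspace zariski = UNIV"
proof -
  have "openin zariski (- zero_set {1})" unfolding openin_zariski by blast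
  then show ?thesis by (auto simp: zero_set_def dest: openin_subset)
qed

definition quotient_topology :: "'a topology \<Rightarrow> ('a \<Rightarrow> 'b) \<Rightarrow> 'b topology" where
  "quotient_topology T q =
     topology (\<lambda>U. U \<subseteq> q ` topspace T \<and> openin T {x \<in> topspace T. q x \<in> U})"

lemma istopology_quotient:
  "istopology (\<lambda>U. U \<subseteq> q ` topspace T \<and> openin T {x \<in> topspace T. q x \<in> U})"
  (is "istopology ?P")
  unfolding istopology_def
proof (intro conjI allI impI)
  fix U V assume UV: "?P U" "?P V"
  show "U \<inter> V \<subseteq> q ` topspace T" using UV by blast
  have "{x \<in> topspace T. q x \<in> U \<inter> V} =
      {x \<in> topspace T. q x \<in> U} \<inter> {x \<in> topspace T. q x \<in> V}" by blast
  then show "openin T {x \<in> topspace T. q x \<in> U \<inter> V}"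
    using openin_Int[OF conjunct2[OF UV(1)] conjunct2[OF UV(2)]] by (simp only:)
next
  fix \<K> assume \<K>: "\<forall>U\<in>\<K>. ?P U"
  then show "\<Union>\<K> \<subseteq> q ` topspace T" by blast
  have "{x \<in> topspace T. q x \<in> \<Union>\<K>} = (\<Union>U\<in>\<K>. {x \<in> topspace T. q x \<in> U})" by blast
  moreover have "openin T (\<Union>U\<in>\<K>. {x \<in> topspace T. q x \<in> U})"
    using \<K> by (intro openin_Union) blast
  ultimately show "openin T {x \<in> topspace T. q x \<in> \<Union>\<K>}" by (simp only:)
qed

lemma openin_quotient_topology:
  "openin (quotient_topology T q) U \<longleftrightarrow>
     U \<subseteq> q ` topspace T \<and> openin T {x \<in> topspace T. q x \<in> U}"
  unfolding quotient_topology_def topology_inverse'[OF istopology_quotient] ..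

lemma topspace_quotient_topology: "topspace (quotient_topology T q) = q ` topspace T"
proof (rule Set.equalityI)
  show "topspace (quotient_topology T q) \<subseteq> q ` topspace T"
    using openin_topspace[of "quotient_topology T q"] unfolding openin_quotient_topology by blast
  have "{x \<in> topspace T. q x \<in> q ` topspace T} = topspace T" by blast
  then have "openin (quotient_topology T q) (q ` topspace T)"
    unfolding openin_quotient_topology by simp
  then show "q ` topspace T \<subseteq> topspace (quotient_topology T q)" by (rule openin_subset)
qed

definition irreducible_closed :: "'a topology \<Rightarrow> 'a set \<Rightarrow> bool" where
  "irreducible_closed T Y \<longleftrightarrow> closedin T Y \<and> Y \<noteq> {} \<and>
     (\<forall>A B. closedin T A \<and> closedin T B \<and> Y \<subseteq> A \<union> B \<longrightarrow> Y \<subseteq> A \<or> Y \<subseteq> B)"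

text \<open>Codimension in the sense of chains of irreducible closed sets; the empty set has
  codimension \<open>\<infinity>\<close>.\<close>

definition codim :: "'a topology \<Rightarrow> 'a set \<Rightarrow> enat" where
  "codim T A =
     (INF Y\<in>{Y. irreducible_closed T Y \<and> Y \<subseteq> A}.
      SUP k\<in>{k. \<exists>C. C 0 = Y \<and> (\<forall>j\<le>k. irreducible_closed T (C j)) \<and> (\<forall>j<k. C j \<subset> C (Suc j))}.
        enat k)"

definition regular_function :: "('v::finite \<Rightarrow> complex) set \<Rightarrow> (('v \<Rightarrow> complex) \<Rightarrow> complex) \<Rightarrow> bool" where
  "regular_function W f \<longleftrightarrow>
     (\<forall>p\<in>W. \<exists>V g h. openin zariski V \<and> p \<in> V \<and>
        (\<forall>x\<in>V \<inter> W. meval h x \<noteq> 0 \<and> f x = meval g x / meval h x))"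

text \<open>A geometric quotient \<open>q\<close> of an open set \<open>\<Omega>\<close> of affine space carries the quotient topology
  and the sheaf of functions whose composition with \<open>q\<close> is regular.\<close>

definition quotient_variety ::
  "('v::finite \<Rightarrow> complex) set \<Rightarrow> (('v \<Rightarrow> complex) \<Rightarrow> 'b) \<Rightarrow> 'b topology" where
  "quotient_variety \<Omega> q = quotient_topology (subtopology zariski \<Omega>) q"

definition quotient_regular ::
  "('v::finite \<Rightarrow> complex) set \<Rightarrow> (('v \<Rightarrow> complex) \<Rightarrow> 'b) \<Rightarrow> 'b set \<Rightarrow> ('b \<Rightarrow> complex) \<Rightarrow> bool" where
  "quotient_regular \<Omega> q W f \<longleftrightarrow> regular_function {x \<in> \<Omega>. q x \<in> W} (\<lambda>x. f (q x))"

section \<open>Fans and simplicial toric surfaces\<close>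

definition real_vec :: "int \<times> int \<Rightarrow> real \<times> real" where
  "real_vec w = (real_of_int (fst w), real_of_int (snd w))"

definition strongly_convex_rational_cone :: "(real \<times> real) set \<Rightarrow> bool" where
  "strongly_convex_rational_cone \<sigma> \<longleftrightarrow>
     (\<exists>S. finite S \<and> \<sigma> = convex_cone hull (real_vec ` S)) \<and> \<sigma> \<inter> uminus ` \<sigma> = {0}"

text \<open>The faces of a convex cone in the sense of toric geometry are the nonempty ones among the
  faces in the sense of \<^const>\<open>face_of\<close>.\<close>

definition fan :: "(real \<times> real) set set \<Rightarrow> bool" where
  "fan \<Sigma> \<longleftrightarrow> finite \<Sigma> \<and> (\<forall>\<sigma>\<in>\<Sigma>. strongly_convex_rational_cone \<sigma>) \<and>
     (\<forall>\<sigma>\<in>\<Sigma>. \<forall>\<tau>. \<tau> face_of \<sigma> \<and> \<tau> \<noteq> {} \<longrightarrow> \<tau> \<in> \<Sigma>) \<and>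
     (\<forall>\<sigma>\<in>\<Sigma>. \<forall>\<tau>\<in>\<Sigma>. (\<sigma> \<inter> \<tau>) face_of \<sigma> \<and> (\<sigma> \<inter> \<tau>) face_of \<tau>)"

definition complete_fan :: "(real \<times> real) set set \<Rightarrow> bool" where
  "complete_fan \<Sigma> \<longleftrightarrow> fan \<Sigma> \<and> \<Union>\<Sigma> = UNIV"

definition simplicial_fan :: "(real \<times> real) set set \<Rightarrow> bool" where
  "simplicial_fan \<Sigma> \<longleftrightarrow> (\<forall>\<sigma>\<in>\<Sigma>. \<exists>S. independent S \<and> \<sigma> = convex_cone hull S)"

definition ray :: "int \<times> int \<Rightarrow> (real \<times> real) set" where
  "ray w = convex_cone hull {real_vec w}"

definition primitive_ray_generators :: "(real \<times> real) set set \<Rightarrow> ('m \<Rightarrow> int \<times> int) \<Rightarrow> bool" where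
  "primitive_ray_generators \<Sigma> v \<longleftrightarrow>
     inj v \<and> range v = {w. coprime (fst w) (snd w) \<and> ray w \<in> \<Sigma>}"

definition rays_of_cone :: "('m \<Rightarrow> int \<times> int) \<Rightarrow> (real \<times> real) set \<Rightarrow> 'm set" where
  "rays_of_cone v \<sigma> = {i. ray (v i) face_of \<sigma>}"

definition irrelevant_ideal :: "(real \<times> real) set set \<Rightarrow> ('m::finite \<Rightarrow> int \<times> int) \<Rightarrow> 'm mpoly set" where
  "irrelevant_ideal \<Sigma> v = ideal_gen ((\<lambda>\<sigma>. \<Prod>i\<in>- rays_of_cone v \<sigma>. mvar i) ` \<Sigma>)"

definition irrelevant_locus :: "(real \<times> real) set set \<Rightarrow> ('m::finite \<Rightarrow> int \<times> int) \<Rightarrow> ('m \<Rightarrow> complex) set" where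
  "irrelevant_locus \<Sigma> v = zero_set (irrelevant_ideal \<Sigma> v)"

text \<open>A torus-invariant divisor is a formal integer combination of the \<open>D\<^sub>i\<close>, with \<open>D\<^sub>i\<close>
  represented by \<open>frag_of i\<close>. The divisor of the character \<open>\<chi>\<^sup>u\<close> is \<open>\<Sum> \<langle>u, v\<^sub>i\<rangle> D\<^sub>i\<close>.\<close>

definition character_divisor :: "('m::finite \<Rightarrow> int \<times> int) \<Rightarrow> int \<times> int \<Rightarrow> ('m \<Rightarrow>\<^sub>0 int)" where
  "character_divisor v u =
     (\<Sum>i\<in>UNIV. frag_cmul (fst u * fst (v i) + snd u * snd (v i)) (frag_of i))"

definition class_group :: "('m::finite \<Rightarrow> int \<times> int) \<Rightarrow> ('m \<Rightarrow>\<^sub>0 int) set monoid" where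
  "class_group v = free_Abelian_group UNIV Mod range (character_divisor v)"

definition divisor_class :: "('m::finite \<Rightarrow> int \<times> int) \<Rightarrow> ('m \<Rightarrow>\<^sub>0 int) \<Rightarrow> ('m \<Rightarrow>\<^sub>0 int) set" where
  "divisor_class v E = range (character_divisor v) #>\<^bsub>free_Abelian_group UNIV\<^esub> E"

abbreviation prime_divisor_class :: "('m::finite \<Rightarrow> int \<times> int) \<Rightarrow> 'm \<Rightarrow> ('m \<Rightarrow>\<^sub>0 int) set" where
  "prime_divisor_class v i \<equiv> divisor_class v (frag_of i)"

definition class_homogeneous ::
  "('m::finite \<Rightarrow> int \<times> int) \<Rightarrow> ('m \<Rightarrow>\<^sub>0 int) set \<Rightarrow> 'm mpoly \<Rightarrow> bool" where
  "class_homogeneous v \<beta> p \<longleftrightarrow>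
     (\<forall>a\<in>Poly_Mapping.keys p.
        divisor_class v (\<Sum>i\<in>UNIV. frag_cmul (int (Poly_Mapping.lookup a i)) (frag_of i)) = \<beta>)"

definition complex_units :: "complex monoid" where
  "complex_units = \<lparr>carrier = UNIV - {0}, monoid.mult = (*), one = 1\<rparr>"

definition toric_group :: "('m::finite \<Rightarrow> int \<times> int) \<Rightarrow> (('m \<Rightarrow>\<^sub>0 int) set \<Rightarrow> complex) set" where
  "toric_group v = hom (class_group v) complex_units"

text \<open>Points of \<open>X\<close> are the orbits of the group on the complement of the irrelevant locus.\<close>

definition toric_proj :: "('m::finite \<Rightarrow> int \<times> int) \<Rightarrow> ('m \<Rightarrow> complex) \<Rightarrow> ('m \<Rightarrow> complex) set" where
  "toric_proj v z = {\<lambda>i. g (prime_divisor_class v i) * z i | g. g \<in> toric_group v}"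

abbreviation toric_variety ::
  "(real \<times> real) set set \<Rightarrow> ('m::finite \<Rightarrow> int \<times> int) \<Rightarrow> ('m \<Rightarrow> complex) set topology" where
  "toric_variety \<Sigma> v \<equiv> quotient_variety (- irrelevant_locus \<Sigma> v) (toric_proj v)"

definition proj_point :: "('n::finite \<Rightarrow> complex) \<Rightarrow> ('n \<Rightarrow> complex) set" where
  "proj_point x = {\<lambda>j. c * x j | c. c \<noteq> 0}"

abbreviation proj_space :: "('n::finite \<Rightarrow> complex) set topology" where
  "proj_space \<equiv> quotient_variety (- {\<lambda>_. 0}) proj_point"

section \<open>Rational maps to a toric surface\<close>

definition toric_morphism ::
  "(real \<times> real) set set \<Rightarrow> ('m::finite \<Rightarrow> int \<times> int) \<Rightarrow> ('n::finite \<Rightarrow> complex) set set \<Rightarrow>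
   (('n \<Rightarrow> complex) set \<Rightarrow> ('m \<Rightarrow> complex) set) \<Rightarrow> bool" where
  "toric_morphism \<Sigma> v U \<phi> \<longleftrightarrow>
     openin proj_space U \<and>
     continuous_map (subtopology proj_space U) (toric_variety \<Sigma> v) \<phi> \<and>
     (\<forall>W f. openin (toric_variety \<Sigma> v) W \<and>
        quotient_regular (- irrelevant_locus \<Sigma> v) (toric_proj v) W f \<longrightarrow>
        quotient_regular (- {\<lambda>_. 0}) proj_point {p \<in> U. \<phi> p \<in> W} (f \<circ> \<phi>))"

text \<open>A rational map is given by any representative \<open>(U, \<phi>)\<close>.\<close>

definition rational_map ::
  "(real \<times> real) set set \<Rightarrow> ('m::finite \<Rightarrow> int \<times> int) \<Rightarrow> ('n::finite \<Rightarrow> complex) set set \<Rightarrow>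
   (('n \<Rightarrow> complex) set \<Rightarrow> ('m \<Rightarrow> complex) set) \<Rightarrow> bool" where
  "rational_map \<Sigma> v U \<phi> \<longleftrightarrow> U \<noteq> {} \<and> toric_morphism \<Sigma> v U \<phi>"

definition dominant_map ::
  "(real \<times> real) set set \<Rightarrow> ('m::finite \<Rightarrow> int \<times> int) \<Rightarrow> ('n::finite \<Rightarrow> complex) set set \<Rightarrow>
   (('n \<Rightarrow> complex) set \<Rightarrow> ('m \<Rightarrow> complex) set) \<Rightarrow> bool" where
  "dominant_map \<Sigma> v U \<phi> \<longleftrightarrow>
     toric_variety \<Sigma> v closure_of (\<phi> ` U) = topspace (toric_variety \<Sigma> v)"

definition regular_locus ::
  "(real \<times> real) set set \<Rightarrow> ('m::finite \<Rightarrow> int \<times> int) \<Rightarrow> ('n::finite \<Rightarrow> complex) set set \<Rightarrow>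
   (('n \<Rightarrow> complex) set \<Rightarrow> ('m \<Rightarrow> complex) set) \<Rightarrow> ('n \<Rightarrow> complex) set set" where
  "regular_locus \<Sigma> v U \<phi> =
     \<Union>{W. \<exists>\<psi>. toric_morphism \<Sigma> v W \<psi> \<and> (\<forall>p\<in>W \<inter> U. \<psi> p = \<phi> p)}"

definition poly_map :: "('m \<Rightarrow> 'n::finite mpoly) \<Rightarrow> ('n \<Rightarrow> complex) \<Rightarrow> ('m \<Rightarrow> complex)" where
  "poly_map F x = (\<lambda>i. meval (F i) x)"

definition complete_lifting ::
  "(real \<times> real) set set \<Rightarrow> ('m::finite \<Rightarrow> int \<times> int) \<Rightarrow> ('n::finite \<Rightarrow> complex) set set \<Rightarrow>
   (('n \<Rightarrow> complex) set \<Rightarrow> ('m \<Rightarrow> complex) set) \<Rightarrow> ('m \<Rightarrow> 'n mpoly) \<Rightarrow> bool" where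
  "complete_lifting \<Sigma> v U \<phi> F \<longleftrightarrow>
     (\<forall>i. \<exists>d. homogeneous d (F i)) \<and>
     (\<forall>x. x \<noteq> (\<lambda>_. 0) \<and> proj_point x \<in> U \<and> poly_map F x \<notin> irrelevant_locus \<Sigma> v \<longrightarrow>
        \<phi> (proj_point x) = toric_proj v (poly_map F x)) \<and>
     regular_locus \<Sigma> v U \<phi> = topspace proj_space -
       proj_point ` {x. x \<noteq> (\<lambda>_. 0) \<and> poly_map F x \<in> irrelevant_locus \<Sigma> v}"

section \<open>Differential forms\<close>

text \<open>A 1-form \<open>\<Sum> A\<^sub>i dz\<^sub>i\<close> is the family of its coefficients. A 2-form
  \<open>\<Sum>\<^bsub>i<j\<^esub> B\<^sub>i\<^sub>j dz\<^sub>i \<and> dz\<^sub>j\<close> is the alternating family \<open>B\<close>, and likewise for 3-forms.\<close>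

definition ext_deriv0 :: "'v mpoly \<Rightarrow> 'v \<Rightarrow> 'v mpoly" where
  "ext_deriv0 h i = mderiv i h"

definition ext_deriv1 :: "('v \<Rightarrow> 'v mpoly) \<Rightarrow> 'v \<Rightarrow> 'v \<Rightarrow> 'v mpoly" where
  "ext_deriv1 A i j = mderiv i (A j) - mderiv j (A i)"

definition wedge11 :: "('v \<Rightarrow> 'v mpoly) \<Rightarrow> ('v \<Rightarrow> 'v mpoly) \<Rightarrow> 'v \<Rightarrow> 'v \<Rightarrow> 'v mpoly" where
  "wedge11 A B i j = A i * B j - A j * B i"

definition wedge12 :: "('v \<Rightarrow> 'v mpoly) \<Rightarrow> ('v \<Rightarrow> 'v \<Rightarrow> 'v mpoly) \<Rightarrow> 'v \<Rightarrow> 'v \<Rightarrow> 'v \<Rightarrow> 'v mpoly" where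
  "wedge12 A B i j k = A i * B j k - A j * B i k + A k * B i j"

definition form_ideal_J :: "('v \<Rightarrow> 'v mpoly) \<Rightarrow> 'v mpoly set" where
  "form_ideal_J A = ideal_gen (range A)"

definition form_ideal_K :: "('v \<Rightarrow> 'v mpoly) \<Rightarrow> 'v mpoly set" where
  "form_ideal_K A =
     ideal_colon (form_ideal_J A) (ideal_gen {ext_deriv1 A i j | i j. True})"

definition class_group_splitting ::
  "('m::finite \<Rightarrow> int \<times> int) \<Rightarrow> 'h monoid \<Rightarrow> (('m \<Rightarrow>\<^sub>0 int) set \<Rightarrow> (nat \<Rightarrow> int) \<times> 'h) \<Rightarrow> bool" where
  "class_group_splitting v H \<psi> \<longleftrightarrow>
     comm_group H \<and> finite (carrier H) \<and>
     \<psi> \<in> iso (class_group v) (product_group {..<CARD('m) - 2} (\<lambda>_. integer_group) \<times>\<times> H)"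

definition reflexive_one_forms ::
  "('m::finite \<Rightarrow> int \<times> int) \<Rightarrow> (('m \<Rightarrow>\<^sub>0 int) set \<Rightarrow> (nat \<Rightarrow> int) \<times> 'h) \<Rightarrow>
   ('m \<Rightarrow>\<^sub>0 int) set \<Rightarrow> ('m \<Rightarrow> 'm mpoly) set" where
  "reflexive_one_forms v \<psi> \<D> =
     {A. (\<forall>i. class_homogeneous v
             (\<D> \<otimes>\<^bsub>class_group v\<^esub> inv\<^bsub>class_group v\<^esub> prime_divisor_class v i) (A i)) \<and>
         (\<forall>j<CARD('m) - 2.
             (\<Sum>i\<in>UNIV. of_int (fst (\<psi> (prime_divisor_class v i)) j) * mvar i * A i) = 0)}"

definition toric_foliation ::
  "(real \<times> real) set set \<Rightarrow> ('m::finite \<Rightarrow> int \<times> int) \<Rightarrow> ('m \<Rightarrow> 'm mpoly) \<Rightarrow> bool" where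
  "toric_foliation \<Sigma> v A \<longleftrightarrow>
     (\<forall>i j k. wedge12 A (ext_deriv1 A) i j k = 0) \<and>
     codim (toric_variety \<Sigma> v)
       (toric_proj v ` {z. z \<notin> irrelevant_locus \<Sigma> v \<and> (\<forall>i. meval (A i) z = 0)}) \<ge> 2"

definition pullback :: "('m::finite \<Rightarrow> 'n mpoly) \<Rightarrow> 'm mpoly \<Rightarrow> 'n mpoly" where
  "pullback F p = msubst mconst F p"

definition pullback_form ::
  "('m::finite \<Rightarrow> 'n mpoly) \<Rightarrow> ('m \<Rightarrow> 'm mpoly) \<Rightarrow> 'n \<Rightarrow> 'n mpoly" where
  "pullback_form F A j = (\<Sum>i\<in>UNIV. pullback F (A i) * mderiv j (F i))"

definition pullback_ideal :: "('m::finite \<Rightarrow> 'n mpoly) \<Rightarrow> 'm mpoly set \<Rightarrow> 'n mpoly set" where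
  "pullback_ideal F I = ideal_gen (pullback F ` I)"

text \<open>\<open>H\<^sup>0(\<P>\<^sup>n, \<Omega>\<^sup>1(l))\<close>: coefficients of degree \<open>l - 1\<close>, annihilated by the radial field.\<close>

definition projective_one_forms :: "nat \<Rightarrow> ('n::finite \<Rightarrow> 'n mpoly) set" where
  "projective_one_forms l =
     {\<eta>. (\<forall>j. \<forall>a\<in>Poly_Mapping.keys (\<eta> j). Suc (mon_degree a) = l) \<and>
         (\<Sum>j\<in>UNIV. mvar j * \<eta> j) = 0}"

section \<open>Genericity\<close>

definition differential ::
  "('m \<Rightarrow> 'n::finite mpoly) \<Rightarrow> ('n \<Rightarrow> complex) \<Rightarrow> ('n \<Rightarrow> complex) \<Rightarrow> ('m \<Rightarrow> complex)" where
  "differential F p w = (\<lambda>i. \<Sum>j\<in>UNIV. meval (mderiv j (F i)) p * w j)"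

definition critical_points :: "('m \<Rightarrow> 'n::finite mpoly) \<Rightarrow> ('n \<Rightarrow> complex) set" where
  "critical_points F = {p. \<not> surj (differential F p)}"

definition form_at ::
  "('m::finite \<Rightarrow> 'm mpoly) \<Rightarrow> ('m \<Rightarrow> complex) \<Rightarrow> ('m \<Rightarrow> complex) \<Rightarrow> complex" where
  "form_at A z w = (\<Sum>i\<in>UNIV. meval (A i) z * w i)"

definition critical_points_form ::
  "('m::finite \<Rightarrow> 'n::finite mpoly) \<Rightarrow> ('m \<Rightarrow> 'm mpoly) \<Rightarrow> ('n \<Rightarrow> complex) set" where
  "critical_points_form F A =
     zariski closure_of {p \<in> critical_points F.
       form_at A (poly_map F p) \<noteq> (\<lambda>_. 0) \<and>
       range (differential F p) \<subseteq> {w. form_at A (poly_map F p) w = 0}}"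

text \<open>Reducedness of the local ring, at the point of projective space below \<open>p \<noteq> 0\<close>, of the
  subscheme defined by the homogeneous ideal \<open>J\<close>: a fraction with numerator \<open>f\<close> is nilpotent there
  iff \<open>s f\<^sup>k \<in> J\<close> for some \<open>k\<close> and some homogeneous \<open>s\<close> with \<open>s(p) \<noteq> 0\<close>, and it is zero
  iff this holds with \<open>k = 1\<close>.\<close>

definition proj_reduced_at :: "'n::finite mpoly set \<Rightarrow> ('n \<Rightarrow> complex) \<Rightarrow> bool" where
  "proj_reduced_at J p \<longleftrightarrow>
     (\<forall>f k s. (\<exists>d. homogeneous d f) \<and> (\<exists>e. homogeneous e s) \<and> meval s p \<noteq> 0 \<and> s * f ^ k \<in> J
        \<longrightarrow> (\<exists>t e. homogeneous e t \<and> meval t p \<noteq> 0 \<and> t * f \<in> J))"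

text \<open>Embedded components, contained in the cone \<open>C\<close>, of the projective scheme of the
  homogeneous ideal \<open>J\<close>; the embedded prime of the vertex of the cone, if any, is not counted.\<close>

definition proj_embedded_component_in :: "'n::finite mpoly set \<Rightarrow> ('n \<Rightarrow> complex) set \<Rightarrow> bool" where
  "proj_embedded_component_in J C \<longleftrightarrow>
     (\<exists>P. embedded_prime J P \<and> zero_set P - {\<lambda>_. 0} \<noteq> {} \<and> zero_set P - {\<lambda>_. 0} \<subseteq> C)"

definition generic_form ::
  "(real \<times> real) set set \<Rightarrow> ('m::finite \<Rightarrow> int \<times> int) \<Rightarrow> ('m \<Rightarrow> 'm mpoly) \<Rightarrow> bool" where
  "generic_form \<Sigma> v A \<longleftrightarrow>
     ideal_saturation (form_ideal_J A) (irrelevant_ideal \<Sigma> v) =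
       ideal_saturation (form_ideal_K A) (irrelevant_ideal \<Sigma> v) \<and>
     radical_ideal (ideal_saturation (form_ideal_J A) (irrelevant_ideal \<Sigma> v))"

definition affinely_generic_form :: "('m \<Rightarrow> 'm mpoly) \<Rightarrow> bool" where
  "affinely_generic_form A \<longleftrightarrow> form_ideal_J A = form_ideal_K A \<and> radical_ideal (form_ideal_J A)"

definition generic_pair ::
  "(real \<times> real) set set \<Rightarrow> ('m::finite \<Rightarrow> int \<times> int) \<Rightarrow> ('m \<Rightarrow> 'n::finite mpoly) \<Rightarrow>
   ('m \<Rightarrow> 'm mpoly) \<Rightarrow> bool" where
  "generic_pair \<Sigma> v F A \<longleftrightarrow>
     generic_form \<Sigma> v A \<and>
     codim zariski (critical_points F) \<ge> 3 \<and>
     (\<forall>p\<in>critical_points_form F A - {\<lambda>_. 0}.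
        proj_reduced_at (form_ideal_J (pullback_form F A)) p) \<and>
     \<not> proj_embedded_component_in (form_ideal_J (pullback_form F A))
         (zero_set (form_ideal_J (pullback_form F A)) \<inter> critical_points F)"

definition affinely_generic_pair ::
  "(real \<times> real) set set \<Rightarrow> ('m::finite \<Rightarrow> int \<times> int) \<Rightarrow> ('m \<Rightarrow> 'n::finite mpoly) \<Rightarrow>
   ('m \<Rightarrow> 'm mpoly) \<Rightarrow> bool" where
  "affinely_generic_pair \<Sigma> v F A \<longleftrightarrow>
     generic_pair \<Sigma> v F A \<and> affinely_generic_form A \<and>
     \<not> (\<exists>P. embedded_prime (pullback_ideal F (form_ideal_K A)) P \<and> zero_set P = {\<lambda>_. 0})"

section \<open>Tensor products and flatness\<close>

definition tensor_relations ::
  "('a, 'r) ring_scheme \<Rightarrow> ('a, 'b, 's) module_scheme \<Rightarrow> ('a, 'c, 't) module_scheme \<Rightarrow>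
   ('b \<times> 'c \<Rightarrow>\<^sub>0 int) set" where
  "tensor_relations R M N =
     generate (free_Abelian_group (carrier M \<times> carrier N))
       ({frag_of (x \<oplus>\<^bsub>M\<^esub> x', y) - frag_of (x, y) - frag_of (x', y) | x x' y.
           x \<in> carrier M \<and> x' \<in> carrier M \<and> y \<in> carrier N} \<union>
        {frag_of (x, y \<oplus>\<^bsub>N\<^esub> y') - frag_of (x, y) - frag_of (x, y') | x y y'.
           x \<in> carrier M \<and> y \<in> carrier N \<and> y' \<in> carrier N} \<union>
        {frag_of (r \<odot>\<^bsub>M\<^esub> x, y) - frag_of (x, r \<odot>\<^bsub>N\<^esub> y) | r x y.
           r \<in> carrier R \<and> x \<in> carrier M \<and> y \<in> carrier N})"

definition tensor_product ::
  "('a, 'r) ring_scheme \<Rightarrow> ('a, 'b, 's) module_scheme \<Rightarrow> ('a, 'c, 't) module_scheme \<Rightarrow>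
   ('b \<times> 'c \<Rightarrow>\<^sub>0 int) set monoid" where
  "tensor_product R M N =
     free_Abelian_group (carrier M \<times> carrier N) Mod tensor_relations R M N"

text \<open>The map \<open>M \<otimes> N \<rightarrow> M' \<otimes> N\<close> induced by \<open>h : M \<rightarrow> M'\<close>; it sends the coset of
  \<open>\<Sum> k\<^sub>i (x\<^sub>i, y\<^sub>i)\<close> to the coset of \<open>\<Sum> k\<^sub>i (h x\<^sub>i, y\<^sub>i)\<close>.\<close>

definition tensor_map ::
  "('a, 'r) ring_scheme \<Rightarrow> ('a, 'b, 's) module_scheme \<Rightarrow> ('a, 'c, 't) module_scheme \<Rightarrow>
   ('d \<Rightarrow> 'b) \<Rightarrow> ('d \<times> 'c \<Rightarrow>\<^sub>0 int) set \<Rightarrow> ('b \<times> 'c \<Rightarrow>\<^sub>0 int) set" where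
  "tensor_map R M' N h C =
     (\<Union>t\<in>C. tensor_relations R M' N #>\<^bsub>free_Abelian_group (carrier M' \<times> carrier N)\<^esub>
        frag_extend (\<lambda>(x, y). frag_of (h x, y)) t)"

definition linear_maps ::
  "('a, 'r) ring_scheme \<Rightarrow> ('a, 'b, 's) module_scheme \<Rightarrow> ('a, 'c, 't) module_scheme \<Rightarrow>
   ('b \<Rightarrow> 'c) set" where
  "linear_maps R M N =
     {h. h \<in> carrier M \<rightarrow> carrier N \<and>
         (\<forall>x\<in>carrier M. \<forall>y\<in>carrier M. h (x \<oplus>\<^bsub>M\<^esub> y) = h x \<oplus>\<^bsub>N\<^esub> h y) \<and>
         (\<forall>r\<in>carrier R. \<forall>x\<in>carrier M. h (r \<odot>\<^bsub>M\<^esub> x) = r \<odot>\<^bsub>N\<^esub> h x)}"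

definition scalar_restriction :: "('b, 's) ring_scheme \<Rightarrow> ('a \<Rightarrow> 'b) \<Rightarrow> ('a, 'b) module" where
  "scalar_restriction S f =
     \<lparr>carrier = carrier S, monoid.mult = (\<otimes>\<^bsub>S\<^esub>), one = \<one>\<^bsub>S\<^esub>, zero = \<zero>\<^bsub>S\<^esub>, add = (\<oplus>\<^bsub>S\<^esub>),
      smult = (\<lambda>r b. f r \<otimes>\<^bsub>S\<^esub> b)\<rparr>"

text \<open>The modules \<open>M\<close> and \<open>M'\<close> range over the type of sets of elements of \<open>R\<close>. This is no
  restriction: up to isomorphism it contains the ideals of \<open>R\<close> (through singletons), and for
  those the condition already implies it for all modules; it also contains the quotients of \<open>R\<close>.\<close>

definition flat_ring_hom :: "('a, 'r) ring_scheme \<Rightarrow> ('b, 's) ring_scheme \<Rightarrow> ('a \<Rightarrow> 'b) \<Rightarrow> bool" where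
  "flat_ring_hom R S f \<longleftrightarrow>
     f \<in> ring_hom R S \<and>
     (\<forall>(M :: ('a, 'a set) module) (M' :: ('a, 'a set) module) h.
        Module.module R M \<and> Module.module R M' \<and> h \<in> linear_maps R M M' \<and> inj_on h (carrier M)
        \<longrightarrow> inj_on (tensor_map R M' (scalar_restriction S f) h)
              (carrier (tensor_product R M (scalar_restriction S f))))"

section \<open>Dual numbers\<close>

text \<open>\<open>Dual a b\<close> is \<open>a + \<epsilon> b\<close> with \<open>\<epsilon>\<^sup>2 = 0\<close>.\<close>

datatype 'a dual_number = Dual (dual_fst: 'a) (dual_snd: 'a)

instantiation dual_number :: (comm_ring_1) comm_ring_1
begin

definition "0 = Dual 0 0"
definition "1 = Dual 1 0"
definition "x + y = Dual (dual_fst x + dual_fst y) (dual_snd x + dual_snd y)"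
definition "x - y = Dual (dual_fst x - dual_fst y) (dual_snd x - dual_snd y)"
definition "- x = Dual (- dual_fst x) (- dual_snd x)"
definition "x * y =
  Dual (dual_fst x * dual_fst y) (dual_fst x * dual_snd y + dual_snd x * dual_fst y)"

instance
proof
  show "(0 :: 'a dual_number) \<noteq> 1"
    by (simp add: zero_dual_number_def one_dual_number_def)
qed (rule dual_number.expand, simp add: zero_dual_number_def one_dual_number_def
      plus_dual_number_def minus_dual_number_def uminus_dual_number_def
      times_dual_number_def algebra_simps)+

end

section \<open>First order deformations and unfoldings\<close>

text \<open>A first order deformation \<open>\<omega> + \<epsilon> \<eta>\<close> of \<open>\<omega> \<in> H\<^sup>0(\<P>\<^sup>n, \<Omega>\<^sup>1(l))\<close> is given by \<open>\<eta>\<close>.\<close>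

definition first_order_deformation ::
  "nat \<Rightarrow> ('n::finite \<Rightarrow> 'n mpoly) \<Rightarrow> ('n \<Rightarrow> 'n mpoly) \<Rightarrow> bool" where
  "first_order_deformation l \<omega> \<eta> \<longleftrightarrow>
     \<omega> \<in> projective_one_forms l \<and> \<eta> \<in> projective_one_forms l \<and>
     (\<forall>i j k. wedge12 \<omega> (ext_deriv1 \<eta>) i j k + wedge12 \<eta> (ext_deriv1 \<omega>) i j k = 0)"

definition induced_by_unfolding ::
  "nat \<Rightarrow> ('n::finite \<Rightarrow> 'n mpoly) \<Rightarrow> ('n \<Rightarrow> 'n mpoly) \<Rightarrow> bool" where
  "induced_by_unfolding l \<omega> \<eta> \<longleftrightarrow>
     (\<exists>h. homogeneous l h \<and>
        (\<forall>i j. h * ext_deriv1 \<omega> i j = wedge11 \<omega> (\<lambda>k. \<eta> k - ext_deriv0 h k) i j))"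

text \<open>The coefficients of a form over the dual numbers are polynomials over \<open>\<complex>[\<epsilon>]/(\<epsilon>\<^sup>2)\<close>,
  identified with dual numbers over the polynomial ring.\<close>

definition deformation_form ::
  "('n \<Rightarrow> 'n mpoly) \<Rightarrow> ('n \<Rightarrow> 'n mpoly) \<Rightarrow> 'n \<Rightarrow> 'n mpoly dual_number" where
  "deformation_form \<omega> \<eta> j = Dual (\<omega> j) (\<eta> j)"

definition perturbed_pullback ::
  "('m::finite \<Rightarrow> 'n mpoly) \<Rightarrow> ('m \<Rightarrow> 'n mpoly) \<Rightarrow> ('m \<Rightarrow> 'm mpoly) \<Rightarrow> 'n \<Rightarrow> 'n mpoly dual_number" where
  "perturbed_pullback F G A j =
     (\<Sum>i\<in>UNIV. msubst (\<lambda>c. Dual (mconst c) 0) (\<lambda>i. Dual (F i) (G i)) (A i) *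
        map_dual_number (mderiv j) (Dual (F i) (G i)))"

definition same_deformation ::
  "('n \<Rightarrow> 'n mpoly dual_number) \<Rightarrow> ('n \<Rightarrow> 'n mpoly dual_number) \<Rightarrow> bool" where
  "same_deformation \<theta> \<theta>' \<longleftrightarrow>
     (\<exists>u :: complex dual_number. u dvd 1 \<and> (\<forall>j. \<theta>' j = map_dual_number mconst u * \<theta> j))"

end

theory Submission
  imports Defs "HOL-Computational_Algebra.Fundamental_Theorem_Algebra"
begin

text \<open>
  Let \<open>a\<^sub>i = A\<^sub>i(F)\<close>, \<open>I = \<langle>a\<^sub>i\<rangle>\<close>, let \<open>b\<^sub>i\<^sub>j\<close> be the pulled back coefficients of \<open>d\<alpha>\<close>, and let \<open>\<Delta>\<close> range over
  the maximal minors of the Jacobian matrix of \<open>F\<close>. If \<open>h d\<omega> = \<omega> \<and> (\<eta> - dh)\<close>, Cramer's rule gives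
  \<open>\<Delta>\<^sup>2 h b\<^sub>i\<^sub>j \<in> I\<close>, and \<open>(J(\<alpha>) : d\<alpha>) = J(\<alpha>)\<close> together with flatness gives \<open>\<Delta>\<^sup>2 h \<in> I\<close>. The minors vanish in
  codimension three, so that \<open>(I : h)\<close> contains, up to a localisation, a regular sequence of length
  three; hence \<open>r\<^sub>i h = \<alpha>(x\<^sub>i)\<close>, and a Koszul argument for the vector fields \<open>x\<^sub>i\<close>, in which
  \<open>\<alpha> \<and> d\<alpha> = 0\<close> replaces the syzygies of the \<open>a\<^sub>i\<close>, yields \<open>h b\<^sub>i\<^sub>j \<in> I\<close> and so \<open>h \<in> I\<close>. Writing
  \<open>h = \<Sum> a\<^sub>i G\<^sub>i\<close>, the perturbation \<open>F + \<epsilon> G\<close> has the same \<open>h\<close>, and the difference of the two deformations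
  is a form proportional to \<open>\<omega>\<close>; as the \<open>a\<^sub>i\<close> and the \<open>\<Delta>\<close> vanish in codimension two, it is a constant multiple
  of \<open>\<omega>\<close>. Conversely \<open>h = \<Sum> a\<^sub>i G\<^sub>i\<close> is an unfolding of \<open>(F + \<epsilon> G)\<^sup>*\<alpha>\<close>.
\<close>

section \<open>Ring homomorphisms and substitution\<close>

text \<open>Codimension is used in the form of \<open>meets_subring\<close>: an ideal of codimension
  at least k in N variables contains a nonzero polynomial in any prescribed N + 1 - k of them. Let T
  be a maximal set of variables independent modulo a proper ideal of this kind. At least k variables
  lie outside T, and the ideal contains an algebraic equation over T for each of them. These
  equations are triangular, one new variable at a time, so they form a regular sequence once their
  leading coefficients, which are polynomials in T, are inverted. If a product of powers of these
  coefficients falls into the ideal, the independence of T is violated. Grade arguments thus reduce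
  to pseudo-division. Flatness is used as an equational criterion: a solution over the target of a
  linear system with coefficients from S is a combination of solutions over S. Both the colon
  condition on \<alpha> and the fact that forms parallel to \<alpha> are multiples of it are systems
  of this kind. The class group grading becomes a grading by integers by comparing F at z and at 2z,
  which represent the same point.\<close>

abbreviation lookup :: "('a \<Rightarrow>\<^sub>0 'b::zero) \<Rightarrow> 'a \<Rightarrow> 'b" where "lookup \<equiv> Poly_Mapping.lookup"
abbreviation keys :: "('a \<Rightarrow>\<^sub>0 'b::zero) \<Rightarrow> 'a set" where "keys \<equiv> Poly_Mapping.keys"
abbreviation single :: "'a \<Rightarrow> 'b \<Rightarrow> 'a \<Rightarrow>\<^sub>0 'b::zero" where "single \<equiv> Poly_Mapping.single"

text \<open>Evaluation, pullback, Kronecker substitution and the constants are all maps of this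
  kind, between types with commutative ring structure; sums, products, powers and determinants are
  then transported uniformly.\<close>

definition rhom :: "('a::comm_ring_1 \<Rightarrow> 'b::comm_ring_1) \<Rightarrow> bool" where
  "rhom \<phi> \<longleftrightarrow> \<phi> 0 = 0 \<and> \<phi> 1 = 1 \<and> (\<forall>x y. \<phi> (x + y) = \<phi> x + \<phi> y) \<and> (\<forall>x y. \<phi> (x * y) = \<phi> x * \<phi> y)"

lemma rhom_simps:
  assumes "rhom \<phi>"
  shows "\<phi> 0 = 0" "\<phi> 1 = 1" "\<phi> (x + y) = \<phi> x + \<phi> y" "\<phi> (x * y) = \<phi> x * \<phi> y"
  using assms by (auto simp: rhom_def)

lemma rhom_uminus: "rhom \<phi> \<Longrightarrow> \<phi> (- x) = - \<phi> x"
  using rhom_simps(3)[of \<phi> x "- x"] by (simp add: rhom_simps eq_neg_iff_add_eq_0 add.commute)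

lemma rhom_diff: "rhom \<phi> \<Longrightarrow> \<phi> (x - y) = \<phi> x - \<phi> y"
  using rhom_simps(3)[of \<phi> x "- y"] by (simp add: rhom_uminus)

lemma rhom_sum: "rhom \<phi> \<Longrightarrow> \<phi> (sum f K) = (\<Sum>k\<in>K. \<phi> (f k))"
  by (induction K rule: infinite_finite_induct) (auto simp: rhom_simps)

lemma rhom_prod: "rhom \<phi> \<Longrightarrow> \<phi> (prod f K) = (\<Prod>k\<in>K. \<phi> (f k))"
  by (induction K rule: infinite_finite_induct) (auto simp: rhom_simps)

lemma rhom_power: "rhom \<phi> \<Longrightarrow> \<phi> (x ^ k) = \<phi> x ^ k"
  by (induction k) (auto simp: rhom_simps)

lemma rhom_of_int:
  assumes "rhom \<phi>"
  shows "\<phi> (of_int k) = of_int k"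
proof -
  have nat: "\<phi> (of_nat n) = of_nat n" for n by (induction n) (auto simp: rhom_simps[OF assms])
  show ?thesis
  proof (cases k rule: int_cases)
    case (neg n)
    then show ?thesis using nat[of "Suc n"] by (simp only: of_int_minus of_int_of_nat_eq rhom_uminus[OF assms])
  qed (use nat in simp)
qed

lemma rhom_comp: "rhom \<phi> \<Longrightarrow> rhom \<psi> \<Longrightarrow> rhom (\<lambda>x. \<phi> (\<psi> x))"
  by (simp add: rhom_def)

lemma rhom_det:
  assumes "rhom \<phi>"
  shows "\<phi> (det M) = det (\<chi> i j. \<phi> (M $ i $ j))"
  unfolding det_def by (simp add: rhom_sum rhom_simps(4) rhom_of_int rhom_prod assms)

lemma msubst_sum_superset:
  assumes "c 0 = 0" "finite B" "keys p \<subseteq> B"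
  shows "msubst c f p =
    (\<Sum>a\<in>B. c (lookup p a) * (\<Prod>i\<in>UNIV. f i ^ lookup a i))"
  unfolding msubst_def using assms
  by (intro sum.mono_neutral_left) (auto simp: in_keys_iff)

lemma msubst_single:
  assumes "c 0 = 0"
  shows "msubst c f (single a x) = c x * (\<Prod>i\<in>UNIV. f i ^ lookup a i)"
  using assms by (subst msubst_sum_superset[where B = "{a}"]) auto

lemma msubst_add:
  assumes "rhom c"
  shows "msubst c f (p + q) = msubst c f p + msubst c f q"
proof -
  let ?B = "keys p \<union> keys q"
  have "keys (p + q) \<subseteq> ?B" by (rule Poly_Mapping.keys_add)
  then show ?thesis
    by (subst (1 2 3) msubst_sum_superset[where B = ?B])
      (auto simp: lookup_add sum.distrib algebra_simps rhom_simps[OF assms])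
qed

lemma msubst_single_mult:
  assumes "rhom c"
  shows "msubst c f (single a x * q) = msubst c f (single a x) * msubst c f q"
  by (induction q rule: mpoly_induct)
    (simp_all add: mult_single msubst_single rhom_simps[OF assms] lookup_add power_add prod.distrib
      distrib_left msubst_add[OF assms] msubst_def[of _ _ 0] mult_ac)

lemma msubst_mult:
  assumes "rhom c"
  shows "msubst c f (p * q) = msubst c f p * msubst c f q"
  by (induction p rule: mpoly_induct)
    (simp_all add: distrib_right msubst_add[OF assms] msubst_single_mult[OF assms] msubst_def[of _ _ 0])

lemma msubst_mconst: "rhom c \<Longrightarrow> msubst c f (mconst x) = c x"
  by (simp add: mconst_def msubst_single rhom_simps)

lemma msubst_mvar:
  assumes "rhom c"
  shows "msubst c f (mvar i) = f i"
proof -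
  have "(\<Prod>j\<in>UNIV. f j ^ lookup (single i (1::nat)) j) = (\<Prod>j\<in>UNIV. if j = i then f j else 1)"
    by (intro prod.cong) (auto simp: lookup_single when_def)
  then show ?thesis by (simp add: mvar_def msubst_single rhom_simps[OF assms])
qed

lemma rhom_msubst:
  assumes "rhom c"
  shows "rhom (msubst c f)"
  unfolding rhom_def using msubst_single[of c f 0 1] assms
  by (auto simp: msubst_add msubst_mult rhom_simps msubst_def[of _ _ 0])

lemma single_eq_mconst_prod:
  "single a c = mconst c * (\<Prod>i\<in>UNIV. mvar i ^ lookup a (i::'v::finite))"
proof -
  have pow: "mvar i ^ k = single (single i k) (1::complex)" for i :: 'v and k
    by (induction k) (simp_all add: mvar_def mult_single single_add[symmetric])
  have "(\<Prod>i\<in>K. single (single i (lookup a i)) 1) =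
        single (\<Sum>i\<in>K. single i (lookup a i)) (1::complex)" for K
    by (induction K rule: infinite_finite_induct) (simp_all add: mult_single)
  moreover have "(\<Sum>i\<in>UNIV. single i (lookup a i)) = a"
    by (rule poly_mapping_eqI) (simp add: lookup_sum lookup_single when_def)
  ultimately show ?thesis by (simp add: pow mconst_def mult_single)
qed

text \<open>Induction along the ring operations suits homomorphisms and derivations better than
  induction along monomials.\<close>

lemma mpoly_ring_induct [case_names const var add mult]:
  fixes p :: "'v::finite mpoly"
  assumes "\<And>c. P (mconst c)" "\<And>i. P (mvar i)"
    "\<And>p q. P p \<Longrightarrow> P q \<Longrightarrow> P (p + q)" "\<And>p q. P p \<Longrightarrow> P q \<Longrightarrow> P (p * q)"
  shows "P p"
proof (induction p rule: mpoly_induct)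
  case zero
  show ?case using assms(1)[of 0] by (simp add: mconst_def)
next
  case (add a c q)
  have one: "P 1" using assms(1)[of 1] by (simp add: mconst_def)
  have pow: "P (mvar i ^ k)" for i k by (induction k) (auto simp: one assms)
  have "P (\<Prod>i\<in>K. mvar i ^ lookup a i)" for K
    by (induction K rule: infinite_finite_induct) (auto simp: one pow assms)
  then show ?case unfolding single_eq_mconst_prod by (intro assms add)
qed

lemma rhom_mpoly_eqI:
  assumes "rhom \<phi>" "rhom \<psi>" "\<And>c. \<phi> (mconst c) = \<psi> (mconst c)" "\<And>i. \<phi> (mvar i) = \<psi> (mvar i)"
  shows "\<phi> p = \<psi> (p :: 'v::finite mpoly)"
  by (induction p rule: mpoly_ring_induct) (simp_all add: assms rhom_simps[OF assms(1)] rhom_simps[OF assms(2)])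

lemma rhom_mconst [simp]: "rhom mconst"
  by (simp add: rhom_def mconst_def single_add mult_single)

lemma mconst_simps [simp]: "mconst 0 = 0" "mconst 1 = 1"
  by (simp_all add: mconst_def)

lemma rhom_id [simp]: "rhom (\<lambda>c. c)"
  by (simp add: rhom_def)

lemma rhom_pullback [simp]: "rhom (pullback F)"
proof -
  have "pullback F = msubst mconst F" by (rule ext) (simp add: pullback_def)
  then show ?thesis by (simp add: rhom_msubst)
qed

lemmas pullback_simps [simp] =
  rhom_simps[OF rhom_pullback] rhom_uminus[OF rhom_pullback] rhom_diff[OF rhom_pullback]

lemmas pullback_sum = rhom_sum[OF rhom_pullback]

lemma pullback_mconst [simp]: "pullback F (mconst c) = mconst c"
  by (simp add: pullback_def msubst_mconst)

lemma pullback_mvar [simp]: "pullback F (mvar i) = F i"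
  by (simp add: pullback_def msubst_mvar)

lemma rhom_meval [simp]: "rhom (\<lambda>p. meval p z)"
proof -
  have "(\<lambda>p. meval p z) = msubst (\<lambda>c. c) z" by (rule ext) (simp add: meval_def)
  then show ?thesis by (simp add: rhom_msubst)
qed

lemmas meval_simps = meval_0 meval_1 meval_add meval_mult rhom_uminus[OF rhom_meval] rhom_diff[OF rhom_meval]
  rhom_sum[OF rhom_meval] rhom_prod[OF rhom_meval] rhom_power[OF rhom_meval]

lemma meval_mconst [simp]: "meval (mconst c) z = c"
  by (simp add: meval_def msubst_mconst)

lemma meval_mvar [simp]: "meval (mvar i) z = z i"
  by (simp add: meval_def msubst_mvar)

lemma meval_pullback: "meval (pullback F p) x = meval p (poly_map F x)"
  by (rule rhom_mpoly_eqI[where p = p]) (simp_all add: rhom_comp[OF rhom_meval] poly_map_def)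

text \<open>Substituting \<open>X ^ (B ^ e i)\<close> for the variable \<open>i\<close> (Kronecker substitution) is injective on the
  polynomials whose exponents are smaller than \<open>B\<close>, and reduces statements to univariate polynomials.\<close>

lemma digit_expansion_inject:
  fixes a b :: "'v \<Rightarrow> nat" and e :: "'v \<Rightarrow> nat"
  assumes "finite K" "inj_on e K" "\<And>i. i \<in> K \<Longrightarrow> a i < B" "\<And>i. i \<in> K \<Longrightarrow> b i < B"
    and "(\<Sum>i\<in>K. a i * B ^ e i) = (\<Sum>i\<in>K. b i * B ^ e i)"
  shows "\<forall>i\<in>K. a i = b i"
  using assms
proof (induction "card K" arbitrary: K)
  case 0
  then show ?case by simp
next
  case (Suc n)
  then have "K \<noteq> {}" by auto
  define m where "m = Min (e ` K)"
  have "m \<in> e ` K" unfolding m_def using Suc.prems \<open>K \<noteq> {}\<close> by (intro Min_in) auto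
  then obtain i where i: "i \<in> K" "e i = m" by auto
  have gt: "m < e j" if "j \<in> K - {i}" for j
  proof -
    have "m \<le> e j" unfolding m_def using Suc.prems that by (intro Min_le) auto
    moreover have "m \<noteq> e j" using i that Suc.prems(2) by (auto dest: inj_onD)
    ultimately show ?thesis by simp
  qed
  have "\<exists>r. (\<Sum>j\<in>K - {i}. c j * B ^ e j) = B ^ Suc m * r" for c :: "'v \<Rightarrow> nat"
  proof -
    have "B ^ Suc m dvd (\<Sum>j\<in>K - {i}. c j * B ^ e j)"
      using gt by (intro dvd_sum dvd_mult le_imp_power_dvd) (auto simp: Suc_le_eq)
    then show ?thesis by (auto simp: dvd_def)
  qed
  then obtain r s where rs: "(\<Sum>j\<in>K - {i}. a j * B ^ e j) = B ^ Suc m * r" "(\<Sum>j\<in>K - {i}. b j * B ^ e j) = B ^ Suc m * s"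
    by metis
  have split: "(\<Sum>j\<in>K. c j * B ^ e j) = c i * B ^ m + (\<Sum>j\<in>K - {i}. c j * B ^ e j)" for c :: "'v \<Rightarrow> nat"
    using Suc.prems(1) i by (subst sum.remove[where x = i]) auto
  have "B > 0" using Suc.prems(3)[OF i(1)] by simp
  \<comment> \<open>After division by the smallest power of B, all other digits are multiples of B,
    so reduction modulo B isolates the digit at i.\<close>
  have "B ^ m * (a i + B * r) = B ^ m * (b i + B * s)"
    using Suc.prems(5) unfolding split rs by (simp add: algebra_simps)
  then have *: "a i + B * r = b i + B * s" using \<open>B > 0\<close> by simp
  then have "(a i + B * r) mod B = (b i + B * s) mod B" by simp
  then have ai: "a i = b i" using Suc.prems(3,4)[OF i(1)] by simp
  have "\<forall>j\<in>K - {i}. a j = b j"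
  proof (rule Suc.hyps(1))
    show "n = card (K - {i})" using Suc.hyps(2) i Suc.prems(1) by simp
    show "(\<Sum>j\<in>K - {i}. a j * B ^ e j) = (\<Sum>j\<in>K - {i}. b j * B ^ e j)"
      using Suc.prems(5) unfolding split by (simp add: ai)
  qed (use Suc.prems in \<open>auto intro: inj_on_subset\<close>)
  then show ?case using ai by auto
qed

definition kronecker :: "('v \<Rightarrow> nat) \<Rightarrow> nat \<Rightarrow> 'v::finite mpoly \<Rightarrow> complex poly" where
  "kronecker e B = msubst (\<lambda>c. [:c:]) (\<lambda>i. Polynomial.monom 1 (B ^ e i))"

lemma rhom_kronecker [simp]: "rhom (kronecker e B)"
  unfolding kronecker_def by (rule rhom_msubst) (simp add: rhom_def)

lemma prod_monom_power:
  "(\<Prod>i\<in>K. Polynomial.monom (1::complex) (g i) ^ a i) = Polynomial.monom 1 (\<Sum>i\<in>K. a i * g i)"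
  by (induction K rule: infinite_finite_induct) (simp_all add: Polynomial.monom_power mult_monom mult.commute)

lemma kronecker_eq:
  "kronecker e B p = (\<Sum>a\<in>keys p.
     Polynomial.monom (lookup p a) (\<Sum>i\<in>UNIV. lookup a i * B ^ e i))"
  unfolding kronecker_def msubst_def prod_monom_power
  by (rule sum.cong) (simp_all add: smult_monom)

text \<open>By uniqueness of expansions in base B, distinct exponent vectors of p go to distinct
  univariate exponents. No two terms can cancel, and each coefficient of p reappears.\<close>

lemma kronecker_nonzero:
  assumes "p \<noteq> 0" "inj e" "\<And>a i. a \<in> keys p \<Longrightarrow> lookup a i < B"
  shows "kronecker e B p \<noteq> 0"
proof -
  let ?w = "\<lambda>a. \<Sum>i\<in>UNIV. lookup a i * B ^ e i"
  obtain a where a: "a \<in> keys p" using assms(1) by (metis keys_eq_empty ex_in_conv poly_mapping_eqI lookup_zero not_in_keys_iff_lookup_eq_zero)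
  have inj: "?w b = ?w a \<longleftrightarrow> b = a" if "b \<in> keys p" for b
    using digit_expansion_inject[of UNIV e "lookup b" B "lookup a"] assms(2,3) a that
    by (auto intro: poly_mapping_eqI)
  have "Polynomial.coeff (kronecker e B p) (?w a) =
      (\<Sum>b\<in>keys p. if b = a then lookup p b else 0)"
    unfolding kronecker_eq by (subst Polynomial.coeff_sum) (intro sum.cong, auto simp: inj)
  also have "\<dots> = lookup p a" using a by simp
  finally show ?thesis using a by (metis Polynomial.coeff_0 in_keys_iff)
qed

lemma mpoly_exponent_bound:
  "\<exists>B. \<forall>a\<in>keys (p :: 'v::finite mpoly). \<forall>i. lookup a i < B"
proof -
  let ?S = "(\<lambda>(a, i). lookup a i) ` (keys p \<times> UNIV)"
  have "finite ?S" by simp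
  then obtain B where "\<forall>x\<in>?S. x < B" using finite_nat_set_iff_bounded by blast
  then show ?thesis by (intro exI[of _ B]) auto
qed

lemma ex_inj_nat: "\<exists>e :: 'v::finite \<Rightarrow> nat. inj e"
  using finite_imp_inj_to_nat_seg[of "UNIV :: 'v set"] by auto

text \<open>One base exceeding the exponents of both factors sends them to nonzero elements of the
  domain of univariate polynomials.\<close>

lemma mpoly_no_zero_divisors:
  fixes p q :: "'v::finite mpoly"
  assumes "p * q = 0"
  shows "p = 0 \<or> q = 0"
proof (rule ccontr)
  assume nz: "\<not> (p = 0 \<or> q = 0)"
  obtain e :: "'v \<Rightarrow> nat" where e: "inj e" using ex_inj_nat by blast
  obtain B C where "\<forall>a\<in>keys p. \<forall>i. lookup a i < B"
    "\<forall>a\<in>keys q. \<forall>i. lookup a i < C"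
    using mpoly_exponent_bound by metis
  then have "kronecker e (max B C) p \<noteq> 0" "kronecker e (max B C) q \<noteq> 0"
    using nz e by (metis kronecker_nonzero less_max_iff_disj)+
  moreover have "kronecker e (max B C) (p * q) = 0" unfolding assms by (simp add: rhom_simps)
  ultimately show False by (simp add: rhom_simps(4)[OF rhom_kronecker])
qed


lemma mpoly_mult_eq_0_iff [simp]: "(p :: 'v::finite mpoly) * q = 0 \<longleftrightarrow> p = 0 \<or> q = 0"
  using mpoly_no_zero_divisors by auto

lemma mpoly_mult_left_cancel [simp]: "(p :: 'v::finite mpoly) * q = p * r \<longleftrightarrow> p = 0 \<or> q = r"
  using mpoly_mult_eq_0_iff[of p "q - r"] by (simp add: algebra_simps)

lemma mpoly_mult_right_cancel [simp]: "(q :: 'v::finite mpoly) * p = r * p \<longleftrightarrow> p = 0 \<or> q = r"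
  by (metis mpoly_mult_left_cancel mult.commute)

lemma mpoly_power_eq_0_iff [simp]: "(p :: 'v::finite mpoly) ^ k = 0 \<longleftrightarrow> p = 0 \<and> k \<noteq> 0"
  by (induction k) auto

lemma mpoly_prod_eq_0_iff: "finite K \<Longrightarrow> (\<Prod>k\<in>K. f k :: 'v::finite mpoly) = 0 \<longleftrightarrow> (\<exists>k\<in>K. f k = 0)"
  by (induction K rule: finite_induct) auto

text \<open>A value t that is not a root of the Kronecker image gives the point with coordinates t ^
  (B ^ e i).\<close>

lemma ex_meval_nonzero:
  fixes p :: "'v::finite mpoly"
  assumes "p \<noteq> 0"
  shows "\<exists>z. meval p z \<noteq> 0"
proof -
  obtain e :: "'v \<Rightarrow> nat" where e: "inj e" using ex_inj_nat by blast
  obtain B where "\<forall>a\<in>keys p. \<forall>i. lookup a i < B"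
    using mpoly_exponent_bound by metis
  then have ne: "kronecker e B p \<noteq> 0" using assms e by (intro kronecker_nonzero) auto
  then obtain t where t: "Polynomial.poly (kronecker e B p) t \<noteq> 0"
    using poly_all_0_iff_0 by blast
  have hom: "rhom (\<lambda>q :: 'v mpoly. Polynomial.poly (kronecker e B q) t)"
    by (rule rhom_comp[of "\<lambda>q. Polynomial.poly q t"]) (simp_all add: rhom_def[of "\<lambda>q. Polynomial.poly q t"])
  have "Polynomial.poly (kronecker e B p) t = meval p (\<lambda>i. t ^ (B ^ e i))"
    by (rule rhom_mpoly_eqI[where p = p])
      (simp_all add: hom, simp_all add: kronecker_def msubst_mconst msubst_mvar rhom_def[of "\<lambda>c. [:c:]"] poly_monom)
  then show ?thesis using t by auto
qed

lemma mvar_nonzero [simp]: "mvar i \<noteq> 0"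
proof
  assume "mvar i = 0"
  then have "lookup (mvar i) (single i 1) = 0" by simp
  then show False by (simp add: mvar_def)
qed

lemma mconst_eq_0_iff [simp]: "mconst c = 0 \<longleftrightarrow> c = 0"
  by (metis mconst_def lookup_single_eq lookup_zero single_zero)

section \<open>Derivatives\<close>

lemma mderiv_sum_superset:
  assumes "finite B" "keys p \<subseteq> B"
  shows "mderiv i p = (\<Sum>a\<in>B. single (a - single i 1)
        (of_nat (lookup a i) * lookup p a))"
  unfolding mderiv_def using assms
  by (intro sum.mono_neutral_left) (auto simp: in_keys_iff)

lemma mderiv_single: "mderiv i (single a c) =
    single (a - single i 1) (of_nat (lookup a i) * c)"
  by (subst mderiv_sum_superset[where B = "{a}"]) auto

lemma mderiv_0 [simp]: "mderiv i 0 = 0"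
  by (simp add: mderiv_def)

lemma mderiv_add: "mderiv i (p + q) = mderiv i p + mderiv i q"
proof -
  let ?B = "keys p \<union> keys q"
  have "keys (p + q) \<subseteq> ?B" by (rule Poly_Mapping.keys_add)
  then show ?thesis
    by (subst (1 2 3) mderiv_sum_superset[where B = ?B])
      (auto simp: lookup_add distrib_left single_add sum.distrib)
qed

lemma mderiv_sum: "mderiv i (sum f K) = (\<Sum>k\<in>K. mderiv i (f k))"
  by (induction K rule: infinite_finite_induct) (auto simp: mderiv_add)

lemma mderiv_single_mult_single:
  "mderiv i (single a c * single b d) =
    single a c * mderiv i (single b d) +
    mderiv i (single a c) * single b d"
proof -
  let ?s = "single i (1::nat)"
  \<comment> \<open>Subtraction of exponents is truncated, so this needs a positive exponent at i.
    When the exponent is zero the coefficient produced by the derivative vanishes, which rescues the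
    two identities below.\<close>
  have shift: "a + (b - ?s) = a + b - ?s" if "lookup b i \<noteq> 0" for a b :: "'a \<Rightarrow>\<^sub>0 nat"
    using that by (intro poly_mapping_eqI) (auto simp: lookup_add lookup_minus lookup_single when_def)
  have 1: "single (a + (b - ?s)) (c * (of_nat (lookup b i) * d)) =
    single (a + b - ?s) (c * (of_nat (lookup b i) * d))"
    using shift[of b a] by (cases "lookup b i = 0") (simp_all only: of_nat_0 mult_zero_left mult_zero_right single_zero not_False_eq_True)
  have 2: "single (a - ?s + b) (of_nat (lookup a i) * c * d) =
    single (a + b - ?s) (of_nat (lookup a i) * c * d)"
    using shift[of a b] by (cases "lookup a i = 0") (simp_all only: of_nat_0 mult_zero_left mult_zero_right single_zero not_False_eq_True add.commute)
  show ?thesis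
    unfolding mult_single mderiv_single 1 2 single_add[symmetric] lookup_add of_nat_add
    by (simp only: algebra_simps)
qed

lemma mderiv_single_mult:
  "mderiv i (single a c * q) =
    single a c * mderiv i q + mderiv i (single a c) * q"
  by (induction q rule: mpoly_induct)
    (simp_all add: distrib_left mderiv_add mderiv_single_mult_single algebra_simps)

lemma mderiv_mult: "mderiv i (p * q) = p * mderiv i q + mderiv i p * q"
proof (induction p rule: mpoly_induct)
  case (add a c p)
  then show ?case unfolding distrib_right mderiv_add mderiv_single_mult by (simp add: algebra_simps)
qed simp

lemma mderiv_mconst [simp]: "mderiv i (mconst c) = 0"
  by (simp add: mconst_def mderiv_single)

lemma mderiv_mvar: "mderiv i (mvar j) = (if i = j then 1 else 0)"
  by (simp add: mvar_def mderiv_single lookup_single when_def)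

lemma mderiv_commute: "mderiv i (mderiv j p) = mderiv j (mderiv i p)"
  by (induction p rule: mpoly_induct) (simp_all add: mderiv_add mderiv_single lookup_minus lookup_single when_def diff_diff_eq add.commute mult_ac)

lemma mderiv_pullback:
  "mderiv j (pullback F p) = (\<Sum>i\<in>UNIV. pullback F (mderiv i p) * mderiv j (F i))"
proof (induction p rule: mpoly_ring_induct)
  case (var i)
  have "pullback F (mderiv k (mvar i)) * mderiv j (F k) = (if k = i then mderiv j (F i) else 0)" for k
    by (auto simp: mderiv_mvar)
  then show ?case by simp
next
  case (mult p q)
  then show ?case
    by (simp add: mderiv_mult distrib_right sum.distrib sum_distrib_left sum_distrib_right algebra_simps)
qed (simp_all add: mderiv_add distrib_right sum.distrib)

text \<open>The exterior derivative commutes with pullback: the second derivatives of F are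
  symmetric and cancel, and the chain rule gives the rest.\<close>

lemma ext_deriv1_pullback_form:
  "ext_deriv1 (pullback_form F A) j k =
    (\<Sum>i\<in>UNIV. \<Sum>i'\<in>UNIV. pullback F (ext_deriv1 A i i') * mderiv j (F i) * mderiv k (F i'))"
proof -
  have "ext_deriv1 (pullback_form F A) j k =
    (\<Sum>i\<in>UNIV. (\<Sum>i'\<in>UNIV. pullback F (mderiv i' (A i)) * mderiv j (F i')) * mderiv k (F i)) -
    (\<Sum>i\<in>UNIV. (\<Sum>i'\<in>UNIV. pullback F (mderiv i' (A i)) * mderiv k (F i')) * mderiv j (F i))"
    unfolding ext_deriv1_def pullback_form_def
    by (simp add: mderiv_sum mderiv_mult mderiv_pullback sum.distrib mderiv_commute[of j k])
  also have "(\<Sum>i\<in>UNIV. (\<Sum>i'\<in>UNIV. pullback F (mderiv i' (A i)) * mderiv j (F i')) * mderiv k (F i)) =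
    (\<Sum>i\<in>UNIV. \<Sum>i'\<in>UNIV. pullback F (mderiv i (A i')) * mderiv j (F i) * mderiv k (F i'))"
    unfolding sum_distrib_right by (rule sum.swap)
  finally show ?thesis
    by (simp add: ext_deriv1_def sum_distrib_right sum_subtractf left_diff_distrib)
      (simp add: mult_ac)
qed

section \<open>Ideals\<close>

definition idl :: "'a::comm_ring_1 set \<Rightarrow> bool" where
  "idl I \<longleftrightarrow> 0 \<in> I \<and> (\<forall>x\<in>I. \<forall>y\<in>I. x + y \<in> I) \<and> (\<forall>r. \<forall>x\<in>I. r * x \<in> I)"

lemma idlD:
  assumes "idl I"
  shows "0 \<in> I" "x \<in> I \<Longrightarrow> y \<in> I \<Longrightarrow> x + y \<in> I" "x \<in> I \<Longrightarrow> r * x \<in> I" "x \<in> I \<Longrightarrow> x * r \<in> I"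
    "x \<in> I \<Longrightarrow> - x \<in> I" "x \<in> I \<Longrightarrow> y \<in> I \<Longrightarrow> x - y \<in> I"
proof -
  show "0 \<in> I" and add: "x \<in> I \<Longrightarrow> y \<in> I \<Longrightarrow> x + y \<in> I" and m: "x \<in> I \<Longrightarrow> r * x \<in> I" for x y r
    using assms by (auto simp: idl_def)
  show "x \<in> I \<Longrightarrow> x * r \<in> I" using m[of x r] by (simp add: mult.commute)
  show neg: "x \<in> I \<Longrightarrow> - x \<in> I" for x using m[of x "- 1"] by simp
  show "x \<in> I \<Longrightarrow> y \<in> I \<Longrightarrow> x - y \<in> I" using add[of x "- y"] neg[of y] by simp
qed

lemma idl_sum: "idl I \<Longrightarrow> (\<And>k. k \<in> K \<Longrightarrow> f k \<in> I) \<Longrightarrow> sum f K \<in> I"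
  by (induction K rule: infinite_finite_induct) (auto intro: idlD)

lemma idl_iff_ideal: "idl I \<longleftrightarrow> ideal I (mpoly_ring :: 'v mpoly ring)"
proof
  assume I: "idl I"
  have "a_inv mpoly_ring x = - x" for x :: "'v mpoly"
  proof -
    interpret cring "mpoly_ring :: 'v mpoly ring" by (rule cring_mpoly_ring)
    show ?thesis by (rule minus_equality) (simp_all add: mpoly_ring_def)
  qed
  then have "subgroup I (add_monoid (mpoly_ring :: 'v mpoly ring))"
    using idlD[OF I] by (intro subgroup.intro) (simp_all add: mpoly_ring_def a_inv_def)
  then show "ideal I (mpoly_ring :: 'v mpoly ring)"
    using idlD[OF I] cring_mpoly_ring
    by (intro idealI) (auto simp: mpoly_ring_def cring_def)
next
  assume "ideal I (mpoly_ring :: 'v mpoly ring)"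
  then interpret ideal I "mpoly_ring :: 'v mpoly ring" .
  show "idl I" unfolding idl_def
    using additive_subgroup.zero_closed[OF is_additive_subgroup] additive_subgroup.a_closed[OF is_additive_subgroup] I_l_closed
    by (auto simp: mpoly_ring_def)
qed

lemma idl_ideal_gen [simp]: "idl (ideal_gen T)"
proof -
  interpret cring "mpoly_ring :: 'a mpoly ring" by (rule cring_mpoly_ring)
  show ?thesis unfolding idl_iff_ideal by (rule genideal_ideal) (simp add: mpoly_ring_def)
qed

lemma ideal_gen_incl: "T \<subseteq> ideal_gen T"
proof -
  interpret cring "mpoly_ring :: 'a mpoly ring" by (rule cring_mpoly_ring)
  show ?thesis by (rule genideal_self) (simp add: mpoly_ring_def)
qed

lemma ideal_gen_minimal: "idl I \<Longrightarrow> T \<subseteq> I \<Longrightarrow> ideal_gen T \<subseteq> I"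
proof -
  interpret cring "mpoly_ring :: 'a mpoly ring" by (rule cring_mpoly_ring)
  assume "idl I" "T \<subseteq> I"
  then show ?thesis unfolding idl_iff_ideal by (intro genideal_minimal)
qed

lemma idl_combinations: "idl {\<Sum>i\<in>K. c i * f i | c. True}"
proof -
  have "\<exists>e. (\<Sum>i\<in>K. c i * f i) + (\<Sum>i\<in>K. d i * f i) = (\<Sum>i\<in>K. e i * f i)" for c d
    by (rule exI[of _ "\<lambda>i. c i + d i"]) (simp add: distrib_right sum.distrib)
  moreover have "\<exists>e. r * (\<Sum>i\<in>K. c i * f i) = (\<Sum>i\<in>K. e i * f i)" for c r
    by (rule exI[of _ "\<lambda>i. r * c i"]) (simp add: sum_distrib_left mult_ac)
  moreover have "\<exists>e. 0 = (\<Sum>i\<in>K. e i * f i)"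
    by (rule exI[of _ "\<lambda>i. 0"]) simp
  ultimately show ?thesis unfolding idl_def by auto
qed

lemma ideal_gen_range: "ideal_gen (range f) = {\<Sum>i\<in>UNIV. c i * f (i :: 'i::finite) | c. True}"
proof (rule Set.equalityI)
  have "f j = (\<Sum>i\<in>UNIV. (if i = j then 1 else 0) * f i)" for j
  proof -
    have "(\<Sum>i\<in>UNIV. (if i = j then 1 else 0) * f i) = (\<Sum>i\<in>UNIV. if i = j then f i else 0)"
      by (intro sum.cong) auto
    then show ?thesis by simp
  qed
  then have "f j \<in> {\<Sum>i\<in>UNIV. c i * f i | c. True}" for j
    by (intro CollectI exI[of _ "\<lambda>i. if i = j then 1 else 0"] conjI TrueI)
  then have "range f \<subseteq> {\<Sum>i\<in>UNIV. c i * f i | c. True}" by blast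
  then show "ideal_gen (range f) \<subseteq> {\<Sum>i\<in>UNIV. c i * f i | c. True}"
    by (rule ideal_gen_minimal[OF idl_combinations])
  show "{\<Sum>i\<in>UNIV. c i * f i | c. True} \<subseteq> ideal_gen (range f)"
    using ideal_gen_incl[of "range f"] by (auto intro!: idl_sum idlD(3))
qed

text \<open>Testing on generators suffices because the g with f * g in I form an ideal.\<close>

lemma ideal_colon_ideal_gen:
  assumes "idl I"
  shows "f \<in> ideal_colon I (ideal_gen T) \<longleftrightarrow> (\<forall>g\<in>T. f * g \<in> I)"
proof
  assume "f \<in> ideal_colon I (ideal_gen T)"
  then show "\<forall>g\<in>T. f * g \<in> I" using ideal_gen_incl unfolding ideal_colon_def by blast
next
  assume "\<forall>g\<in>T. f * g \<in> I"
  moreover have "idl {g. f * g \<in> I}" using assms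
    by (auto simp: idl_def[of "{g. f * g \<in> I}"] distrib_left mult.left_commute intro: idlD)
  ultimately have "ideal_gen T \<subseteq> {g. f * g \<in> I}" by (intro ideal_gen_minimal) auto
  then show "f \<in> ideal_colon I (ideal_gen T)" by (auto simp: ideal_colon_def)
qed

definition prime_idl :: "'a::comm_ring_1 set \<Rightarrow> bool" where
  "prime_idl P \<longleftrightarrow> idl P \<and> 1 \<notin> P \<and> (\<forall>x y. x * y \<in> P \<longrightarrow> x \<in> P \<or> y \<in> P)"

lemma prime_idl_power: "prime_idl P \<Longrightarrow> x ^ k \<in> P \<Longrightarrow> x \<in> P"
  by (induction k) (auto simp: prime_idl_def)

lemma prime_idl_prod: "prime_idl P \<Longrightarrow> prod f K \<in> P \<Longrightarrow> \<exists>k\<in>K. f k \<in> P"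
  by (induction K rule: infinite_finite_induct) (auto simp: prime_idl_def)

text \<open>An ideal that is maximal among those containing I and missing the multiplicative set M
  is prime. The last clause records the maximality itself: anything outside P becomes invertible
  modulo P once M is inverted.\<close>

lemma ex_prime_idl_avoiding:
  assumes "idl I" "I \<inter> M = {}" "1 \<in> M" "\<And>x y. x \<in> M \<Longrightarrow> y \<in> M \<Longrightarrow> x * y \<in> M"
  shows "\<exists>P. prime_idl P \<and> I \<subseteq> P \<and> P \<inter> M = {} \<and> (\<forall>x. x \<notin> P \<longrightarrow> (\<exists>y\<in>P. \<exists>r. y + r * x \<in> M))"
proof -
  define \<A> where "\<A> = {P. idl P \<and> I \<subseteq> P \<and> P \<inter> M = {}}"
  have "\<exists>P\<in>\<A>. \<forall>X\<in>\<A>. P \<subseteq> X \<longrightarrow> X = P"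
  proof (rule subset_Zorn_nonempty)
    show "\<A> \<noteq> {}" using assms unfolding \<A>_def by blast
    fix \<C> assume C: "\<C> \<noteq> {}" "subset.chain \<A> \<C>"
    have idl: "idl X" if "X \<in> \<C>" for X using C(2) that unfolding \<A>_def subset_chain_def by blast
    have "idl (\<Union>\<C>)" unfolding idl_def
    proof (intro conjI ballI allI)
      show "0 \<in> \<Union>\<C>" using C(1) idl by (auto intro: idlD)
      fix x assume x: "x \<in> \<Union>\<C>"
      show "r * x \<in> \<Union>\<C>" for r using x idl by (auto intro: idlD)
      fix y assume y: "y \<in> \<Union>\<C>"
      obtain X Y where XY: "X \<in> \<C>" "Y \<in> \<C>" "x \<in> X" "y \<in> Y" using x y by blast
      then consider "X \<subseteq> Y" | "Y \<subseteq> X" using C(2) unfolding subset_chain_def by blast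
      then show "x + y \<in> \<Union>\<C>" using XY idl by cases (blast intro: idlD)+
    qed
    moreover have "I \<subseteq> X \<and> X \<inter> M = {}" if "X \<in> \<C>" for X
      using C(2) that unfolding \<A>_def subset_chain_def by blast
    ultimately show "\<Union>\<C> \<in> \<A>" using C(1) unfolding \<A>_def by blast
  qed
  then obtain P where PA: "P \<in> \<A>" and max: "\<And>X. X \<in> \<A> \<Longrightarrow> P \<subseteq> X \<Longrightarrow> X = P"
    by metis
  then have P: "idl P" "I \<subseteq> P" "P \<inter> M = {}" by (simp_all add: \<A>_def)
  have ext: "\<exists>y\<in>P. \<exists>r. y + r * x \<in> M" if "x \<notin> P" for x
  proof (rule ccontr)
    assume no: "\<not> ?thesis"
    let ?X = "{y + r * x | y r. y \<in> P}"
    have "idl ?X" unfolding idl_def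
    proof (intro conjI ballI allI)
      show "0 \<in> ?X" using idlD(1)[OF P(1)] by (auto intro!: exI[of _ 0])
      fix u assume "u \<in> ?X"
      then obtain y r where u: "u = y + r * x" "y \<in> P" by blast
      show "s * u \<in> ?X" for s
        using u idlD(3)[OF P(1), of y s] by (auto simp: distrib_left mult.assoc[symmetric])
      fix v assume "v \<in> ?X"
      then obtain y' r' where v: "v = y' + r' * x" "y' \<in> P" by blast
      have "u + v = (y + y') + (r + r') * x" using u v by (simp add: algebra_simps)
      then show "u + v \<in> ?X" using idlD(2)[OF P(1) u(2) v(2)] by blast
    qed
    moreover have sub: "P \<subseteq> ?X"
    proof
      fix y assume "y \<in> P"
      moreover have "y = y + 0 * x" by simp
      ultimately show "y \<in> ?X" by blast
    qed
    moreover have "?X \<inter> M = {}" using no by blast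
    ultimately have "?X \<in> \<A>" using P(2) unfolding \<A>_def by blast
    then have "?X = P" using max sub by blast
    moreover have "x = 0 + 1 * x" by simp
    ultimately show False using that idlD(1)[OF P(1)] by blast
  qed
  have "prime_idl P" unfolding prime_idl_def
  proof (intro conjI allI impI)
    show "idl P" by fact
    show "1 \<notin> P" using P assms by blast
    fix x y assume xy: "x * y \<in> P"
    show "x \<in> P \<or> y \<in> P"
    proof (rule ccontr)
      assume "\<not> ?thesis"
      then obtain a r b s where *: "a \<in> P" "a + r * x \<in> M" "b \<in> P" "b + s * y \<in> M" using ext by blast
      have "(a + r * x) * (b + s * y) = a * (b + s * y) + (b * (r * x) + r * s * (x * y))"
        by (simp add: algebra_simps)
      then have "(a + r * x) * (b + s * y) \<in> P" using * xy P(1) by (simp add: idlD)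
      then show False using assms(4)[OF *(2,4)] P(3) by blast
    qed
  qed
  then show ?thesis using P ext by blast
qed

section \<open>Linear dependence and Hilbert's Nullstellensatz\<close>

text \<open>Gaussian elimination, one coordinate at a time: a pivot b0 clears coordinate m from the
  other vectors, and the coefficient of b0 is recovered from a relation among them.\<close>

lemma ex_nontrivial_relation:
  fixes f :: "'b \<Rightarrow> 'k \<Rightarrow> complex"
  assumes "finite M" "finite B" "card M < card B"
  shows "\<exists>c. (\<exists>b\<in>B. c b \<noteq> 0) \<and> (\<forall>m\<in>M. (\<Sum>b\<in>B. c b * f b m) = 0)"
  using assms
proof (induction M arbitrary: B f rule: finite_induct)
  case empty
  then show ?case by (intro exI[of _ "\<lambda>_. 1"]) (auto simp: card_gt_0_iff)
next
  case (insert m M)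
  show ?case
  proof (cases "\<exists>b0\<in>B. f b0 m \<noteq> 0")
    case False
    then show ?thesis using insert.IH[of B f] insert.prems insert.hyps by auto
  next
    case True
    then obtain b0 where b0: "b0 \<in> B" "f b0 m \<noteq> 0" by blast
    define g where "g b k = f b k - f b m / f b0 m * f b0 k" for b k
    obtain c where c: "\<exists>b\<in>B - {b0}. c b \<noteq> 0" "\<forall>k\<in>M. (\<Sum>b\<in>B - {b0}. c b * g b k) = 0"
    proof -
      have "card M < card (B - {b0})" using insert.prems insert.hyps b0 by simp
      then show ?thesis using insert.IH[of "B - {b0}" g] insert.prems that by blast
    qed
    define s where "s = (\<Sum>b\<in>B - {b0}. c b * f b m) / f b0 m"
    have "(\<Sum>b\<in>B. (c(b0 := - s)) b * f b k) = (\<Sum>b\<in>B - {b0}. c b * f b k) - s * f b0 k" for k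
      using b0 insert.prems by (subst sum.remove[where x = b0]) (auto intro!: sum.cong)
    moreover have "(\<Sum>b\<in>B - {b0}. c b * f b k) - s * f b0 k = (\<Sum>b\<in>B - {b0}. c b * g b k)" for k
      unfolding s_def g_def
      by (simp add: right_diff_distrib sum_subtractf sum_distrib_right sum_divide_distrib mult.assoc)
    ultimately have eq: "(\<Sum>b\<in>B. (c(b0 := - s)) b * f b k) = (\<Sum>b\<in>B - {b0}. c b * g b k)" for k
      by simp
    have "g b m = 0" for b using b0 by (simp add: g_def)
    then have "\<forall>k\<in>insert m M. (\<Sum>b\<in>B. (c(b0 := - s)) b * f b k) = 0"
      unfolding eq using c(2) by simp
    moreover obtain b where "b \<in> B - {b0}" "c b \<noteq> 0" using c(1) by blast
    then have "\<exists>b\<in>B. (c(b0 := - s)) b \<noteq> 0" by (intro bexI[of _ b]) auto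
    ultimately show ?thesis by blast
  qed
qed

lemma lookup_mconst_mult: "lookup (mconst c * p) a = c * lookup p a"
  by (induction p rule: mpoly_induct)
    (auto simp: mconst_def distrib_left lookup_add mult_single lookup_single when_def)

lemma finite_exponent_box: "finite {a :: 'v::finite \<Rightarrow>\<^sub>0 nat. \<forall>i. lookup a i < B}"
  and card_exponent_box_le: "card {a :: 'v::finite \<Rightarrow>\<^sub>0 nat. \<forall>i. lookup a i < B} \<le> B ^ CARD('v)"
proof -
  let ?S = "{a :: 'v \<Rightarrow>\<^sub>0 nat. \<forall>i. lookup a i < B}" and ?T = "Pi\<^sub>E (UNIV :: 'v set) (\<lambda>_. {..<B})"
  have inj: "inj_on lookup ?S" by (auto intro: inj_onI poly_mapping_eqI)
  have sub: "lookup ` ?S \<subseteq> ?T" by auto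
  have fin: "finite ?T" by (intro finite_PiE) auto
  show "finite ?S" using finite_imageD[OF finite_subset[OF sub fin] inj] .
  have "card ?S \<le> card ?T" using card_inj_on_le[OF inj sub fin] .
  then show "card ?S \<le> B ^ CARD('v)" by (simp add: card_PiE)
qed

text \<open>The polynomials lie in the space spanned by the monomials with all exponents below B,
  whose dimension is at most B ^ CARD('v).\<close>

lemma mpolys_dependent:
  fixes f :: "'b \<Rightarrow> 'v::finite mpoly"
  assumes "finite K" "B ^ CARD('v) < card K"
    "\<And>k a i. k \<in> K \<Longrightarrow> a \<in> keys (f k) \<Longrightarrow> lookup a i < B"
  shows "\<exists>c. (\<exists>k\<in>K. c k \<noteq> 0) \<and> (\<Sum>k\<in>K. mconst (c k) * f k) = 0"
proof -
  let ?S = "{a :: 'v \<Rightarrow>\<^sub>0 nat. \<forall>i. lookup a i < B}"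
  obtain c where c: "\<exists>k\<in>K. c k \<noteq> 0" "\<forall>a\<in>?S. (\<Sum>k\<in>K. c k * lookup (f k) a) = 0"
    using ex_nontrivial_relation[OF finite_exponent_box assms(1), of B "\<lambda>k. lookup (f k)"]
      card_exponent_box_le[where 'v = 'v] assms(2) by (meson le_less_trans)
  have "(\<Sum>k\<in>K. c k * lookup (f k) a) = 0" for a
  proof (cases "a \<in> ?S")
    case False
    then have "\<forall>k\<in>K. a \<notin> keys (f k)" using assms(3) by blast
    then show ?thesis by (intro sum.neutral) (auto simp: in_keys_iff)
  qed (use c in auto)
  then have "(\<Sum>k\<in>K. mconst (c k) * f k) = 0"
    by (intro poly_mapping_eqI) (simp add: lookup_sum lookup_mconst_mult)
  then show ?thesis using c(1) by blast
qed

section \<open>Univariate polynomials in an element, and their roots modulo a prime\<close>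

definition poly_at :: "'v mpoly \<Rightarrow> complex poly \<Rightarrow> 'v mpoly" where
  "poly_at x q = Polynomial.poly (map_poly mconst q) x"

lemma poly_at_pCons [simp]: "poly_at x (pCons a q) = mconst a + x * poly_at x q"
  by (simp add: poly_at_def map_poly_pCons)

lemma poly_at_0 [simp]: "poly_at x 0 = 0"
  by (simp add: poly_at_def)

lemma poly_at_add: "poly_at x (p + q) = poly_at x p + poly_at x q"
  by (induction p q rule: poly_induct2) (auto simp: algebra_simps rhom_simps(3)[OF rhom_mconst])

lemma poly_at_smult: "poly_at x (Polynomial.smult a q) = mconst a * poly_at x q"
  by (induction q) (auto simp: algebra_simps rhom_simps(4)[OF rhom_mconst])

lemma poly_at_mult: "poly_at x (p * q) = poly_at x p * poly_at x q"
  by (induction p) (auto simp: algebra_simps poly_at_add poly_at_smult)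

lemma rhom_poly_at: "rhom (poly_at x)"
proof -
  have "poly_at x 1 = 1" by (simp add: one_pCons)
  then show ?thesis by (simp add: rhom_def poly_at_add poly_at_mult)
qed

text \<open>Over the complex numbers q splits into linear factors, and a prime containing the
  product contains one of them; the constant left over is a unit.\<close>

lemma prime_idl_linear_factor:
  assumes "prime_idl P" "q \<noteq> 0" "poly_at x q \<in> P"
  shows "\<exists>a. x - mconst a \<in> P"
  using assms(2,3)
proof (induction "Polynomial.degree q" arbitrary: q)
  case 0
  then obtain c where c: "q = [:c:]" "c \<noteq> 0" by (metis degree_eq_zeroE pCons_0_0)
  then have "mconst (1 / c) * mconst c \<in> P" using 0 assms(1) by (auto simp: prime_idl_def idlD)
  then have "1 \<in> P" using c by (simp add: rhom_simps(4)[OF rhom_mconst, symmetric])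
  then show ?case using assms(1) by (simp add: prime_idl_def)
next
  case (Suc n)
  have "\<not> constant (Polynomial.poly q)" using Suc.hyps(2) by (simp add: constant_degree)
  then obtain r where "Polynomial.poly q r = 0" using fundamental_theorem_of_algebra by blast
  then obtain q' where q': "q = [:- r, 1:] * q'" by (metis poly_eq_0_iff_dvd dvd_def)
  have "q' \<noteq> 0" using Suc.prems(1) q' by auto
  moreover have "Polynomial.degree q = Polynomial.degree [:- r, 1:] + Polynomial.degree q'"
    unfolding q' using \<open>q' \<noteq> 0\<close> by (intro Polynomial.degree_mult_eq) auto
  then have "n = Polynomial.degree q'" using Suc.hyps(2) by simp
  moreover have "poly_at x q = (x - mconst r) * poly_at x q'"
    unfolding q' poly_at_mult by (simp add: rhom_uminus[OF rhom_mconst])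
  ultimately show ?case using Suc assms(1) unfolding prime_idl_def by metis
qed

text \<open>Since the field is uncountable while the polynomial ring has countable dimension, infinitely many of
  the inverses of \<open>x - a\<close> would live in a finite-dimensional space; a linear relation among them gives
  a polynomial relation for \<open>x\<close>.\<close>

lemma ex_point_avoiding:
  fixes I :: "'v::finite mpoly set"
  assumes "idl I" "\<And>k. f ^ k \<notin> I"
  shows "\<exists>z. (\<forall>p\<in>I. meval p z = 0) \<and> meval f z \<noteq> 0"
proof -
  define M where "M = range (\<lambda>k. f ^ k)"
  have "I \<inter> M = {}" using assms by (auto simp: M_def)
  moreover have "1 \<in> M" unfolding M_def by (rule range_eqI[of _ _ 0]) simp
  moreover have "x * y \<in> M" if "x \<in> M" "y \<in> M" for x y
    using that unfolding M_def by (auto simp: power_add[symmetric])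
  ultimately obtain P where P: "prime_idl P" "I \<subseteq> P" "P \<inter> M = {}"
    and ext: "\<And>x. x \<notin> P \<Longrightarrow> \<exists>y\<in>P. \<exists>r. y + r * x \<in> M"
    using ex_prime_idl_avoiding[OF assms(1), of M] by blast
  have idl: "idl P" using P by (simp add: prime_idl_def)
  have notP: "f ^ k \<notin> P" for k using P by (auto simp: M_def)
  have "\<exists>a. mvar i - mconst a \<in> P" for i
  proof (rule ccontr)
    assume nolin: "\<not> (\<exists>a. mvar i - mconst a \<in> P)"
    \<comment> \<open>By maximality of P, every mvar i - a is invertible modulo P after inverting f;
      r plays the role of f ^ k / (mvar i - a).\<close>
    have "\<forall>a. \<exists>r k. r * (mvar i - mconst a) - f ^ k \<in> P"
    proof (intro allI)
      fix a
      from nolin obtain y r k where "y \<in> P" "y + r * (mvar i - mconst a) = f ^ k"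
        using ext[of "mvar i - mconst a"] unfolding M_def by blast
      then have "r * (mvar i - mconst a) - f ^ k = - y" by (simp add: algebra_simps)
      then show "\<exists>r k. r * (mvar i - mconst a) - f ^ k \<in> P" using idlD(5)[OF idl \<open>y \<in> P\<close>] by metis
    qed
    then obtain r k where rk: "\<And>a. r a * (mvar i - mconst a) - f ^ k a \<in> P" by metis
    have "\<exists>B. \<forall>b\<in>keys (r a). \<forall>j. lookup b j < B" for a
      by (rule mpoly_exponent_bound)
    then obtain B where B: "\<And>a b j. b \<in> keys (r a) \<Longrightarrow> lookup b j < B a" by metis
    \<comment> \<open>There are only countably many pairs of an exponent k and a bound B, so
      infinitely many a share one pair. Their r a then lie in one finite-dimensional space.\<close>
    define g where "g a = (k a, B a)" for a
    have "\<exists>y. infinite {a. g a = y}"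
    proof (rule ccontr)
      assume "\<not> ?thesis"
      then have "countable (\<Union>y. {a. g a = y})" by (intro countable_UN) (auto intro: countable_finite)
      moreover have "(\<Union>y. {a. g a = y}) = UNIV" by auto
      ultimately show False using uncountable_UNIV_complex by simp
    qed
    then obtain k0 B0 where inf: "infinite {a. g a = (k0, B0)}" by (metis surj_pair)
    obtain K where K: "K \<subseteq> {a. g a = (k0, B0)}" "finite K" "card K = Suc (B0 ^ CARD('v))"
      using infinite_arbitrarily_large[OF inf] by blast
    have "B0 ^ CARD('v) < card K" using K by simp
    then obtain c where c: "\<exists>a\<in>K. c a \<noteq> 0" "(\<Sum>a\<in>K. mconst (c a) * r a) = 0"
      using mpolys_dependent[OF K(2), of B0 r] B K(1) unfolding g_def by fastforce
    \<comment> \<open>The numerator obtained by clearing denominators in the sum of c a / (x -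
      a).\<close>
    define q where "q = (\<Sum>a\<in>K. Polynomial.smult (c a) (\<Prod>b\<in>K - {a}. [:- b, 1:]))"
    define X where "X a = (\<Prod>b\<in>K - {a}. mvar i - mconst b)" for a
    have qX: "poly_at (mvar i) q = (\<Sum>a\<in>K. mconst (c a) * X a)"
      unfolding q_def X_def
      by (simp add: rhom_sum[OF rhom_poly_at] poly_at_smult rhom_prod[OF rhom_poly_at] rhom_uminus[OF rhom_mconst])
    have "f ^ k0 * poly_at (mvar i) q \<in> P"
    proof -
      have "(\<Sum>a\<in>K. mconst (c a) * X a * (r a * (mvar i - mconst a) - f ^ k0)) \<in> P"
        using rk K(1) by (intro idl_sum[OF idl] idlD(3)[OF idl]) (auto simp: g_def)
      moreover have "(\<Sum>a\<in>K. mconst (c a) * X a * (r a * (mvar i - mconst a))) = 0"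
      proof -
        have X: "X a * (mvar i - mconst a) = (\<Prod>b\<in>K. mvar i - mconst b)" if "a \<in> K" for a
          unfolding X_def using K(2) that by (simp add: prod.remove[of K a] mult.commute)
        have "mconst (c a) * X a * (r a * (mvar i - mconst a)) =
          mconst (c a) * r a * (\<Prod>b\<in>K. mvar i - mconst b)" if "a \<in> K" for a
        proof -
          have "mconst (c a) * X a * (r a * (mvar i - mconst a)) =
            mconst (c a) * r a * (X a * (mvar i - mconst a))" by (simp only: mult_ac)
          then show ?thesis unfolding X[OF that] .
        qed
        then have "(\<Sum>a\<in>K. mconst (c a) * X a * (r a * (mvar i - mconst a))) =
          (\<Sum>a\<in>K. mconst (c a) * r a) * (\<Prod>b\<in>K. mvar i - mconst b)"
          unfolding sum_distrib_right by (intro sum.cong refl)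
        then show ?thesis unfolding c(2) by simp
      qed
      ultimately have "- (f ^ k0 * poly_at (mvar i) q) \<in> P"
        unfolding qX right_diff_distrib[of "mconst _ * X _"] sum_subtractf by (simp add: sum_distrib_left mult.commute)
      then show ?thesis using idlD(5)[OF idl] by (metis minus_minus)
    qed
    then have "poly_at (mvar i) q \<in> P" using P(1) notP unfolding prime_idl_def by blast
    moreover obtain a where a: "a \<in> K" "c a \<noteq> 0" using c by blast
    \<comment> \<open>Evaluation at a node a with c a nonzero leaves a single summand, which is
      nonzero.\<close>
    have "q \<noteq> 0"
    proof
      assume "q = 0"
      then have "0 = Polynomial.poly q a" by simp
      also have "\<dots> = (\<Sum>b\<in>K. c b * (\<Prod>b\<in>K - {b}. a - b))" by (simp add: q_def poly_sum poly_prod)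
      also have "\<dots> = (\<Sum>b\<in>K. if b = a then c a * (\<Prod>b\<in>K - {a}. a - b) else 0)"
        using K(2) a(1) by (intro sum.cong) (auto simp: prod_zero_iff)
      also have "\<dots> = c a * (\<Prod>b\<in>K - {a}. a - b)" using K(2) a by simp
      finally show False using a K(2) by (auto simp: prod_zero_iff)
    qed
    ultimately show False using prime_idl_linear_factor[OF P(1)] nolin by blast
  qed
  then obtain z where z: "\<And>i. mvar i - mconst (z i) \<in> P" by metis
  \<comment> \<open>Modulo P every polynomial is congruent to its value at z, because this holds for
    constants and variables.\<close>
  have ev: "p - mconst (meval p z) \<in> P" for p
  proof (induction p rule: mpoly_ring_induct)
    case (const c)
    show ?case using idlD(1)[OF idl] by simp
  next
    case (var i)
    show ?case using z by simp
  next
    case (add p q)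
    have "p + q - mconst (meval (p + q) z) = (p - mconst (meval p z)) + (q - mconst (meval q z))"
      by (simp add: meval_add rhom_simps(3)[OF rhom_mconst])
    then show ?case using idlD(2)[OF idl add] by metis
  next
    case (mult p q)
    have "p * q - mconst (meval (p * q) z) = q * (p - mconst (meval p z)) + mconst (meval p z) * (q - mconst (meval q z))"
      by (simp add: meval_mult rhom_simps(4)[OF rhom_mconst] algebra_simps)
    then show ?case using mult idl by (metis idlD(2,3))
  qed
  have const: "c = 0" if "mconst c \<in> P" for c
  proof (rule ccontr)
    assume "c \<noteq> 0"
    then have "mconst (1 / c) * mconst c = 1" by (simp add: rhom_simps(4)[OF rhom_mconst, symmetric])
    then show False using idlD(3)[OF idl that, of "mconst (1 / c)"] P(1) unfolding prime_idl_def by metis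
  qed
  have "meval p z = 0" if "p \<in> I" for p
    using idlD(6)[OF idl _ ev[of p], of p] P(2) that by (intro const) auto
  moreover have "meval f z \<noteq> 0" using ev[of f] notP[of 1] by auto
  ultimately show ?thesis by blast
qed

lemma prime_idl_nullstellensatz:
  fixes P :: "'v::finite mpoly set"
  assumes "prime_idl P" "\<And>z. (\<forall>p\<in>P. meval p z = 0) \<Longrightarrow> meval f z = 0"
  shows "f \<in> P"
  using ex_point_avoiding[of P f] assms prime_idl_power[OF assms(1)] by (auto simp: prime_idl_def)

section \<open>Polynomials in a subset of the variables and pseudo-division\<close>

definition vars_in :: "'v set \<Rightarrow> 'v mpoly \<Rightarrow> bool" where
  "vars_in T p \<longleftrightarrow> (\<forall>a\<in>keys p. \<forall>i. i \<notin> T \<longrightarrow> lookup a i = 0)"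

text \<open>\<open>deg_lt x 1 p\<close> says that \<open>p\<close> is free of \<open>x\<close>, and only \<open>0\<close> satisfies \<open>deg_lt x 0\<close>.\<close>

definition deg_lt :: "'v \<Rightarrow> nat \<Rightarrow> 'v mpoly \<Rightarrow> bool" where
  "deg_lt x d p \<longleftrightarrow> (\<forall>a\<in>keys p. lookup a x < d)"

lemma keys_mult_cases:
  assumes "a \<in> keys (p * q)"
  obtains b c where "b \<in> keys p" "c \<in> keys q" "a = b + c"
  using assms keys_mult[of p q] by blast

lemma keys_add_cases:
  assumes "a \<in> keys (p + q)"
  obtains "a \<in> keys p" | "a \<in> keys q"
  using assms keys_add[of p q] by blast

lemma vars_in_add: "vars_in T p \<Longrightarrow> vars_in T q \<Longrightarrow> vars_in T (p + q)"
  unfolding vars_in_def by (metis keys_add_cases)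

lemma vars_in_mult: "vars_in T p \<Longrightarrow> vars_in T q \<Longrightarrow> vars_in T (p * q)"
  unfolding vars_in_def by (metis keys_mult_cases lookup_add add.right_neutral)

lemma vars_in_mconst [simp]: "vars_in T (mconst c)"
  unfolding vars_in_def mconst_def by auto

lemma vars_in_0 [simp]: "vars_in T 0" and vars_in_1 [simp]: "vars_in T 1"
  using vars_in_mconst[of T 0] vars_in_mconst[of T 1] by simp_all

lemma vars_in_mvar: "i \<in> T \<Longrightarrow> vars_in T (mvar i)"
  unfolding vars_in_def mvar_def by (auto simp: lookup_single when_def)

lemma vars_in_power: "vars_in T p \<Longrightarrow> vars_in T (p ^ k)"
  by (induction k) (auto intro: vars_in_mult)

lemma vars_in_sum: "(\<And>k. k \<in> K \<Longrightarrow> vars_in T (f k)) \<Longrightarrow> vars_in T (sum f K)"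
  by (induction K rule: infinite_finite_induct) (auto intro: vars_in_add)

lemma vars_in_prod: "(\<And>k. k \<in> K \<Longrightarrow> vars_in T (f k)) \<Longrightarrow> vars_in T (prod f K)"
  by (induction K rule: infinite_finite_induct) (auto intro: vars_in_mult)

lemma vars_in_mono: "vars_in T p \<Longrightarrow> T \<subseteq> T' \<Longrightarrow> vars_in T' p"
  unfolding vars_in_def by blast

lemma vars_in_UNIV [simp]: "vars_in UNIV p"
  by (simp add: vars_in_def)

lemma vars_in_imp_free: "vars_in T p \<Longrightarrow> x \<notin> T \<Longrightarrow> deg_lt x 1 p"
  by (auto simp: vars_in_def deg_lt_def)

lemma vars_in_remove: "vars_in T p \<Longrightarrow> deg_lt x 1 p \<Longrightarrow> vars_in (T - {x}) p"
  by (auto simp: vars_in_def deg_lt_def)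

lemma vars_in_empty: "vars_in {} p \<Longrightarrow> \<exists>c. p = mconst c"
proof -
  assume p: "vars_in {} p"
  have "a = 0" if "a \<in> keys p" for a
    using p that unfolding vars_in_def by (intro poly_mapping_eqI) auto
  then have "p = mconst (lookup p 0)"
    by (intro poly_mapping_eqI) (auto simp: mconst_def lookup_single when_def in_keys_iff)
  then show ?thesis by blast
qed

lemma deg_lt_add: "deg_lt x d p \<Longrightarrow> deg_lt x d q \<Longrightarrow> deg_lt x d (p + q)"
  unfolding deg_lt_def by (metis keys_add_cases)

lemma deg_lt_uminus: "deg_lt x d p \<Longrightarrow> deg_lt x d (- p)"
  unfolding deg_lt_def by simp

lemma deg_lt_diff: "deg_lt x d p \<Longrightarrow> deg_lt x d q \<Longrightarrow> deg_lt x d (p - q)"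
  using deg_lt_add[of x d p "- q"] deg_lt_uminus[of x d q] by simp

lemma deg_lt_mult: "deg_lt x (Suc d) p \<Longrightarrow> deg_lt x e q \<Longrightarrow> deg_lt x (d + e) (p * q)"
  unfolding deg_lt_def
proof
  fix a assume *: "\<forall>a\<in>keys p. lookup a x < Suc d"
    "\<forall>a\<in>keys q. lookup a x < e" "a \<in> keys (p * q)"
  obtain b c where "b \<in> keys p" "c \<in> keys q" "a = b + c"
    using keys_mult_cases[OF *(3)] .
  then show "lookup a x < d + e" using *(1,2) by (fastforce simp: lookup_add)
qed

lemma deg_lt_free_mult: "deg_lt x 1 p \<Longrightarrow> deg_lt x e q \<Longrightarrow> deg_lt x e (p * q)"
  using deg_lt_mult[of x 0 p e q] by simp

lemma deg_lt_mono: "deg_lt x d p \<Longrightarrow> d \<le> e \<Longrightarrow> deg_lt x e p"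
  unfolding deg_lt_def by auto

lemma deg_lt_0 [simp]: "deg_lt x d 0"
  by (simp add: deg_lt_def)

lemma deg_lt_zero_iff: "deg_lt x 0 p \<longleftrightarrow> p = 0"
  by (auto simp: deg_lt_def)

lemma free_power: "deg_lt x 1 p \<Longrightarrow> deg_lt x 1 (p ^ k)"
proof (induction k)
  case 0
  show ?case by (simp add: deg_lt_def)
next
  case (Suc k)
  then show ?case unfolding power_Suc by (intro deg_lt_free_mult)
qed

lemma ex_deg_lt: "\<exists>d. deg_lt x d (p :: 'v::finite mpoly)"
  using mpoly_exponent_bound[of p] unfolding deg_lt_def by blast

lemma mvar_power: "mvar x ^ k = single (single x k) 1"
  by (induction k) (simp_all add: mvar_def mult_single single_add[symmetric])

lemma deg_lt_mvar_power: "deg_lt x (Suc k) (mvar x ^ k)"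
  by (simp add: mvar_power deg_lt_def)

lemma lookup_mult_single:
  "lookup (q * single b 1) (a + b) = lookup (q :: 'v mpoly) a"
  by (induction q rule: mpoly_induct)
    (auto simp: distrib_right lookup_add mult_single lookup_single when_def)

section \<open>Leading coefficients and pseudo-division in one variable\<close>

lemma leading_coefficient:
  assumes "deg_lt x (Suc d) p"
  obtains q r where "p = q * mvar x ^ d + r" "deg_lt x 1 q" "deg_lt x d r"
    "\<And>T. vars_in T p \<Longrightarrow> vars_in T q"
proof -
  let ?K = "{a \<in> keys p. lookup a x = d}"
  define q where "q = (\<Sum>a\<in>?K. single (a - single x d) (lookup p a))"
  define r where "r = (\<Sum>a\<in>keys p - ?K. single a (lookup p a))"
  have decomp: "p = (\<Sum>a\<in>keys p. single a (lookup p a))"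
    by (rule poly_mapping_eqI)
      (simp add: lookup_sum lookup_single when_def in_keys_iff)
  have shift: "a - single x d + single x d = a" if "lookup a x = d" for a
    using that by (intro poly_mapping_eqI) (auto simp: lookup_add lookup_minus lookup_single when_def)
  have "q * mvar x ^ d = (\<Sum>a\<in>?K. single a (lookup p a))"
    unfolding q_def mvar_power sum_distrib_right by (intro sum.cong) (auto simp: mult_single shift)
  then have "p = q * mvar x ^ d + r"
    using decomp sum.subset_diff[of ?K "keys p" "\<lambda>a. single a (lookup p a)"]
    unfolding r_def by (auto simp: add.commute)
  moreover have kq: "\<exists>b\<in>?K. a = b - single x d" if "a \<in> keys q" for a
  proof -
    have "a \<in> (\<Union>b\<in>?K. keys (single (b - single x d) (lookup p b)))"
      using that Poly_Mapping.keys_sum[of "\<lambda>b. single (b - single x d) (lookup p b)" ?K] unfolding q_def by blast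
    then show ?thesis by (auto split: if_splits)
  qed
  moreover have "deg_lt x 1 q" unfolding deg_lt_def
    using kq by (fastforce simp: lookup_minus)
  moreover have "deg_lt x d r" unfolding deg_lt_def
  proof
    fix a assume "a \<in> keys r"
    then have "a \<in> (\<Union>b\<in>keys p - ?K. keys (single b (lookup p b)))"
      using Poly_Mapping.keys_sum[of "\<lambda>b. single b (lookup p b)" "keys p - ?K"] unfolding r_def by blast
    then show "lookup a x < d" using assms by (auto simp: deg_lt_def less_Suc_eq split: if_splits)
  qed
  moreover have "vars_in T q" if "vars_in T p" for T
    using kq that unfolding vars_in_def by (fastforce simp: lookup_minus)
  ultimately show ?thesis using that by blast
qed

lemma not_deg_lt:
  assumes "q \<noteq> 0" "deg_lt x d r"
  shows "\<not> deg_lt x d (q * mvar x ^ d + r)"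
proof
  assume "deg_lt x d (q * mvar x ^ d + r)"
  from deg_lt_diff[OF this assms(2)] have *: "deg_lt x d (q * mvar x ^ d)" by simp
  obtain a where "a \<in> keys q" using assms(1) by (metis keys_eq_empty ex_in_conv)
  then have "a + single x d \<in> keys (q * mvar x ^ d)"
    by (simp add: mvar_power in_keys_iff lookup_mult_single)
  then show False using * by (auto simp: deg_lt_def lookup_add)
qed

lemma leading_coefficient_nonzero:
  assumes "p \<noteq> (0 :: 'v::finite mpoly)"
  obtains d q r where "p = q * mvar x ^ d + r" "q \<noteq> 0" "deg_lt x 1 q" "deg_lt x d r"
    "\<And>T. vars_in T p \<Longrightarrow> vars_in T q"
proof -
  define D where "D = (LEAST d. deg_lt x d p)"
  have D: "deg_lt x D p" unfolding D_def using ex_deg_lt by (rule LeastI_ex)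
  then have "D \<noteq> 0" using assms by (metis deg_lt_zero_iff)
  then obtain d where d: "D = Suc d" by (cases D) auto
  obtain q r where qr: "p = q * mvar x ^ d + r" "deg_lt x 1 q" "deg_lt x d r"
    "\<And>T. vars_in T p \<Longrightarrow> vars_in T q" using leading_coefficient D unfolding d by metis
  have "\<not> deg_lt x d p" using not_less_Least[of d "\<lambda>d. deg_lt x d p"] d unfolding D_def by simp
  then have "q \<noteq> 0" using qr by auto
  then show ?thesis using that qr by blast
qed

text \<open>Multiplying a by the leading coefficient c allows its top term to be cancelled by a
  multiple of w; each such step lowers the degree in x and costs one power of c.\<close>

lemma pseudo_division:
  fixes a w c :: "'v::finite mpoly"
  assumes w: "w = c * mvar x ^ d + w'" "deg_lt x 1 c" "deg_lt x d w'"
  shows "\<exists>k e \<rho>. c ^ k * a = w * e + \<rho> \<and> deg_lt x d \<rho>"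
proof -
  have "\<exists>k e \<rho>. c ^ k * a = w * e + \<rho> \<and> deg_lt x d \<rho>" if "deg_lt x (d + m) a" for m
    using that
  proof (induction m arbitrary: a)
    case 0
    then show ?case by (intro exI[of _ 0] exI[of _ a]) auto
  next
    case (Suc m)
    then obtain q r where qr: "a = q * mvar x ^ (d + m) + r" "deg_lt x 1 q" "deg_lt x (d + m) r"
      using leading_coefficient[of x "d + m" a] by (metis add_Suc_right)
    have "c * a - w * (q * mvar x ^ m) = c * r - q * mvar x ^ m * w'"
      unfolding w(1) qr(1) by (simp add: algebra_simps power_add)
    moreover have "deg_lt x (m + d) (q * mvar x ^ m * w')"
      using deg_lt_mult[OF deg_lt_free_mult[OF qr(2) deg_lt_mvar_power] w(3)] .
    then have "deg_lt x (d + m) (c * r - q * mvar x ^ m * w')"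
      using deg_lt_free_mult[OF w(2) qr(3)] by (intro deg_lt_diff) (simp_all add: add.commute)
    ultimately obtain k e \<rho> where "c ^ k * (c * a - w * (q * mvar x ^ m)) = w * e + \<rho>" "deg_lt x d \<rho>"
      using Suc.IH by metis
    then have "c ^ Suc k * a = w * (e + c ^ k * (q * mvar x ^ m)) + \<rho>"
      by (simp add: algebra_simps)
    then show ?case using \<open>deg_lt x d \<rho>\<close> by blast
  qed
  moreover obtain m where "deg_lt x m a" using ex_deg_lt by blast
  then have "deg_lt x (d + m) a" by (rule deg_lt_mono) simp
  ultimately show ?thesis by blast
qed

text \<open>Degrees in x add, since the product of two nonzero leading coefficients is
  nonzero.\<close>

lemma deg_lt_cofactor:
  fixes w c e :: "'v::finite mpoly"
  assumes w: "w = c * mvar x ^ d + w'" "deg_lt x 1 c" "deg_lt x d w'" "c \<noteq> 0" and we: "deg_lt x (d + n) (w * e)"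
  shows "deg_lt x n e"
proof (rule ccontr)
  assume nd: "\<not> deg_lt x n e"
  then have "e \<noteq> 0" by auto
  then obtain D q r where e: "e = q * mvar x ^ D + r" "q \<noteq> 0" "deg_lt x 1 q" "deg_lt x D r"
    by (rule leading_coefficient_nonzero[where x = x])
  have sD: "deg_lt x (Suc D) e" unfolding e(1)
    using deg_lt_free_mult[OF e(3) deg_lt_mvar_power] deg_lt_mono[OF e(4)] by (intro deg_lt_add) auto
  have "w * e = c * q * mvar x ^ (d + D) + (c * mvar x ^ d * r + e * w')"
    unfolding w(1) e(1) by (simp add: algebra_simps power_add)
  moreover have "deg_lt x (d + D) (c * mvar x ^ d * r)"
    using deg_lt_mult[OF deg_lt_free_mult[OF w(2) deg_lt_mvar_power] e(4)] .
  moreover have "deg_lt x (d + D) (e * w')" using deg_lt_mult[OF sD w(3)] by (metis add.commute)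
  ultimately have "\<not> deg_lt x (d + D) (w * e)"
    using not_deg_lt[of "c * q" x "d + D", OF _ deg_lt_add] w(4) e(2) by simp
  moreover have "n \<le> D" using nd sD deg_lt_mono[of x "Suc D" e n] by (metis not_less_eq_eq)
  ultimately show False using deg_lt_mono[OF we, of "d + D"] by simp
qed

lemma multiple_small_degree:
  fixes w c e :: "'v::finite mpoly"
  assumes "w = c * mvar x ^ d + w'" "deg_lt x 1 c" "deg_lt x d w'" "c \<noteq> 0" "deg_lt x d (w * e)"
  shows "e = 0"
  using deg_lt_cofactor[OF assms(1-4), of 0 e] assms(5) by (simp add: deg_lt_zero_iff)

text \<open>The regular sequences used below: \<open>w\<close> is monic in \<open>x\<close> up to its leading coefficient \<open>c\<close>.\<close>

lemma regular_pair:
  fixes a b s w c :: "'v::finite mpoly"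
  assumes w: "w = c * mvar x ^ d + w'" "deg_lt x 1 c" "deg_lt x d w'" "c \<noteq> 0"
    and s: "deg_lt x 1 s" "s \<noteq> 0" and eq: "s * b = w * a"
  shows "\<exists>k e. c ^ k * b = w * e"
proof -
  obtain k e \<rho> where *: "c ^ k * b = w * e + \<rho>" "deg_lt x d \<rho>" using pseudo_division[OF w(1-3)] by blast
  \<comment> \<open>Replacing b by its remainder gives a multiple of w whose degree in x is below d,
    because s is free of x. Such a multiple is zero.\<close>
  have "w * (c ^ k * a - s * e) = s * \<rho>"
  proof -
    have "c ^ k * (w * a) = s * (w * e + \<rho>)" unfolding eq[symmetric] *(1)[symmetric] by (simp add: mult_ac)
    then show ?thesis by (simp add: algebra_simps)
  qed
  moreover have "deg_lt x d (s * \<rho>)" using deg_lt_free_mult[OF s(1) *(2)] .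
  ultimately have "c ^ k * a - s * e = 0" using multiple_small_degree[OF w] by metis
  then have "s * \<rho> = 0" using \<open>w * (c ^ k * a - s * e) = s * \<rho>\<close> by simp
  then have "\<rho> = 0" using s(2) by simp
  then show ?thesis using *(1) by auto
qed

text \<open>After b and a' are reduced modulo w, some multiple of w has degree in x below d and
  hence vanishes; this is why u and s must be free of x. What remains relates the remainder of b to
  u alone, and the pair case in the variable y applies, for which s must be free of y.\<close>

lemma regular_triple:
  fixes b s u w c c' :: "'v::finite mpoly"
  assumes w: "w = c * mvar x ^ d + w'" "deg_lt x 1 c" "deg_lt x d w'" "c \<noteq> 0"
    and u: "u = c' * mvar y ^ d' + u'" "deg_lt y 1 c'" "deg_lt y d' u'" "c' \<noteq> 0" "deg_lt x 1 u"
    and s: "deg_lt x 1 s" "deg_lt y 1 s" "s \<noteq> 0" and eq: "s * b = w * a + u * a'"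
  shows "\<exists>k k' e e'. c ^ k * c' ^ k' * b = w * e + u * e'"
proof -
  obtain k e \<rho> where b: "c ^ k * b = w * e + \<rho>" "deg_lt x d \<rho>" using pseudo_division[OF w(1-3)] by blast
  obtain l f \<sigma> where a': "c ^ l * a' = w * f + \<sigma>" "deg_lt x d \<sigma>" using pseudo_division[OF w(1-3)] by blast
  have "w * (c ^ (k + l) * a + c ^ k * u * f - c ^ l * s * e) = c ^ l * s * \<rho> - c ^ k * u * \<sigma>"
  proof -
    have "c ^ l * s * (w * e + \<rho>) = c ^ (k + l) * (s * b)" unfolding b(1)[symmetric] by (simp add: power_add mult_ac)
    also have "\<dots> = w * (c ^ (k + l) * a) + c ^ k * u * (c ^ l * a')" unfolding eq by (simp add: power_add algebra_simps)
    also have "\<dots> = w * (c ^ (k + l) * a) + c ^ k * u * (w * f + \<sigma>)" unfolding a'(1) ..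
    finally show ?thesis by (simp add: algebra_simps)
  qed
  moreover have "deg_lt x d (c ^ l * s * \<rho> - c ^ k * u * \<sigma>)"
    using deg_lt_free_mult[OF deg_lt_free_mult[OF free_power[OF w(2)] s(1)] b(2)]
      deg_lt_free_mult[OF deg_lt_free_mult[OF free_power[OF w(2)] u(5)] a'(2)] by (rule deg_lt_diff)
  ultimately have "c ^ (k + l) * a + c ^ k * u * f - c ^ l * s * e = 0"
    using multiple_small_degree[OF w] by metis
  then have "s * (c ^ l * \<rho>) = u * (c ^ k * \<sigma>)"
    using \<open>w * _ = _\<close> by (simp add: mult_ac)
  then obtain k' e' where e': "c' ^ k' * (c ^ l * \<rho>) = u * e'"
    using regular_pair[OF u(1-4) s(2,3)] by blast
  have "c ^ (k + l) * c' ^ k' * b = c ^ l * c' ^ k' * (c ^ k * b)" by (simp add: power_add mult_ac)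
  also have "\<dots> = w * (c ^ l * c' ^ k' * e) + c' ^ k' * (c ^ l * \<rho>)" unfolding b(1) by (simp add: algebra_simps)
  also have "\<dots> = w * (c ^ l * c' ^ k' * e) + u * e'" unfolding e' ..
  finally show ?thesis by blast
qed

text \<open>The negation says that the variables in T are algebraically independent modulo I. The
  largest size of such a T is the dimension of I, so this is codimension in algebraic terms.\<close>

definition meets_subring :: "'v mpoly set \<Rightarrow> 'v set \<Rightarrow> bool" where
  "meets_subring I T \<longleftrightarrow> (\<exists>p\<in>I. p \<noteq> 0 \<and> vars_in T p)"

lemma meets_subring_mono: "meets_subring I T \<Longrightarrow> I \<subseteq> I' \<Longrightarrow> T \<subseteq> T' \<Longrightarrow> meets_subring I' T'"
  unfolding meets_subring_def using vars_in_mono by blast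

text \<open>\<open>T\<close> is a maximal set of variables that are independent modulo \<open>I\<close>, and \<open>w\<close> is an algebraic equation
  for a further variable \<open>x\<close>.\<close>

lemma ex_maximal_independent:
  fixes I :: "'v::finite mpoly set"
  assumes "idl I" "1 \<notin> I"
  obtains T where "\<not> meets_subring I T"
    "\<And>x. x \<notin> T \<Longrightarrow> \<exists>w c d w'. w \<in> I \<and> vars_in (insert x T) w \<and> w \<noteq> 0 \<and> w = c * mvar x ^ d + w' \<and>
       deg_lt x d w' \<and> c \<noteq> 0 \<and> vars_in T c"
proof -
  have "\<not> meets_subring I {}"
  proof
    assume "meets_subring I {}"
    then obtain p where p: "p \<in> I" "p \<noteq> 0" "vars_in {} p" by (auto simp: meets_subring_def)
    then obtain c where c: "p = mconst c" using vars_in_empty by blast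
    then have "mconst (1 / c) * p = 1" using p by (simp add: rhom_simps(4)[OF rhom_mconst, symmetric])
    then show False using idlD(3)[OF assms(1) p(1), of "mconst (1 / c)"] assms(2) by simp
  qed
  then have "\<exists>T. T \<in> {T. \<not> meets_subring I T} \<and> (\<forall>T'\<in>{T. \<not> meets_subring I T}. T \<subseteq> T' \<longrightarrow> T' = T)"
    using finite_has_maximal[of "{T. \<not> meets_subring I T}"] by (metis (no_types, lifting) emptyE finite mem_Collect_eq)
  then obtain T where T: "\<not> meets_subring I T" and max: "\<And>T'. \<not> meets_subring I T' \<Longrightarrow> T \<subseteq> T' \<Longrightarrow> T' = T"
    by blast
  have "\<exists>w c d w'. w \<in> I \<and> vars_in (insert x T) w \<and> w \<noteq> 0 \<and> w = c * mvar x ^ d + w' \<and>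
       deg_lt x d w' \<and> c \<noteq> 0 \<and> vars_in T c" if "x \<notin> T" for x
  proof -
    have "meets_subring I (insert x T)" using max[of "insert x T"] that by blast
    then obtain w where w: "w \<in> I" "w \<noteq> 0" "vars_in (insert x T) w" by (auto simp: meets_subring_def)
    obtain d q r where qr: "w = q * mvar x ^ d + r" "q \<noteq> 0" "deg_lt x 1 q" "deg_lt x d r"
      "\<And>T. vars_in T w \<Longrightarrow> vars_in T q" using leading_coefficient_nonzero[OF w(2), of x] by metis
    have "vars_in T q" using vars_in_remove[OF qr(5)[OF w(3)] qr(3)] that by simp
    then show ?thesis using w qr by blast
  qed
  with T show ?thesis using that by blast
qed

text \<open>Grade at least two: the first Koszul cohomology of \<open>a\<close> vanishes.\<close>

lemma proportional_family:
  fixes a x :: "'i \<Rightarrow> 'v::finite mpoly"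
  assumes meets: "\<And>T. CARD('v) \<le> card T + 1 \<Longrightarrow> meets_subring (ideal_gen (range a)) T"
    and eq: "\<And>i j. a i * x j = a j * x i"
  shows "\<exists>c. \<forall>i. x i = a i * c"
proof -
  \<comment> \<open>The admissible denominators: t belongs to the ideal when t x is a multiple of a.
    By \<open>eq\<close> every a j is one, and the claim is that 1 is.\<close>
  let ?I = "{t. \<exists>y. \<forall>i. t * x i = a i * y}"
  have idl: "idl ?I" unfolding idl_def
  proof (intro conjI ballI allI)
    show "0 \<in> ?I" by (auto intro!: exI[of _ 0])
    fix t assume "t \<in> ?I"
    then obtain y where y: "\<And>i. t * x i = a i * y" by blast
    have "r * t * x i = a i * (r * y)" for r i using y[of i] by (metis mult.assoc mult.left_commute)
    then show "r * t \<in> ?I" for r by blast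
    fix t' assume "t' \<in> ?I"
    then obtain y' where y': "\<And>i. t' * x i = a i * y'" by blast
    have "(t + t') * x i = a i * (y + y')" for i using y[of i] y'[of i] by (simp add: distrib_left distrib_right)
    then show "t + t' \<in> ?I" by blast
  qed
  have "a j \<in> ?I" for j using eq by blast
  then have "range a \<subseteq> ?I" by blast
  then have sub: "ideal_gen (range a) \<subseteq> ?I" by (rule ideal_gen_minimal[OF idl])
  have "1 \<in> ?I"
  proof (rule ccontr)
    assume "1 \<notin> ?I"
    from ex_maximal_independent[OF idl this] obtain T where T: "\<not> meets_subring ?I T"
      "\<And>x. x \<notin> T \<Longrightarrow> \<exists>w c d w'. w \<in> ?I \<and> vars_in (insert x T) w \<and> w \<noteq> 0 \<and> w = c * mvar x ^ d + w' \<and>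
         deg_lt x d w' \<and> c \<noteq> 0 \<and> vars_in T c" by blast
    have "\<not> CARD('v) \<le> card T + 1" using T(1) meets_subring_mono[OF meets sub] by blast
    then have "2 \<le> card (- T)" by (simp add: Compl_eq_Diff_UNIV card_Diff_subset)
    then obtain S where "S \<subseteq> - T" "card S = 2" using obtain_subset_with_card_n by metis
    then obtain p q where pq: "p \<notin> T" "q \<notin> T" "p \<noteq> q" by (auto simp: card_2_iff)
    obtain w c d w' where w: "w \<in> ?I" "vars_in (insert p T) w" "w \<noteq> 0" "w = c * mvar p ^ d + w'"
      "deg_lt p d w'" "c \<noteq> 0" "vars_in T c" using T(2)[OF pq(1)] by blast
    obtain u where u: "u \<in> ?I" "vars_in (insert q T) u" "u \<noteq> 0" using T(2)[OF pq(2)] by blast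
    have c: "deg_lt p 1 c" using vars_in_imp_free[OF w(7) pq(1)] .
    have u1: "deg_lt p 1 u" using vars_in_imp_free[OF u(2)] pq by simp
    obtain y where y: "\<And>i. w * x i = a i * y" using w(1) by blast
    obtain z where z: "\<And>i. u * x i = a i * z" using u(1) by blast
    have "a i * (u * y) = a i * (w * z)" for i using y[of i] z[of i] by (metis mult.left_commute)
    then have "a i = 0 \<or> u * y = w * z" for i by simp
    then consider (zero) "\<And>i. a i = 0" | (rel) "u * y = w * z" by blast
    then show False
    proof cases
      case zero
      then have "x i = 0" for i using y[of i] w(3) by simp
      then show False using \<open>1 \<notin> ?I\<close> zero by auto
    next
      case rel
      \<comment> \<open>Since w and u form a regular pair after inverting c, w divides y up to a
        power of c. Cancelling w makes that power an admissible denominator in the variables T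
        alone.\<close>
      obtain k e where "c ^ k * y = w * e"
        using regular_pair[OF w(4) c w(5,6) u1 u(3) rel] by blast
      then have "w * (c ^ k * x i) = w * (a i * e)" for i using y[of i] by (metis mult.left_commute)
      then have "c ^ k * x i = a i * e" for i using w(3) by simp
      then have "c ^ k \<in> ?I" by blast
      moreover have "c ^ k \<noteq> 0" using w(6) by simp
      ultimately show False using T(1) vars_in_power[OF w(7)] unfolding meets_subring_def by blast
    qed
  qed
  then show ?thesis by auto
qed

section \<open>The equational criterion of flatness\<close>

text \<open>For a module Z of solutions over the source ring, this is the image of its extension of
  scalars along \<phi>. The inductive form lets properties be checked on one summand at a
  time.\<close>

inductive extended_span ::
  "('r \<Rightarrow> 's::comm_ring_1) \<Rightarrow> ('k \<Rightarrow> 'r) set \<Rightarrow> ('k \<Rightarrow> 's) \<Rightarrow> bool" for \<phi> Z where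
  zero: "extended_span \<phi> Z (\<lambda>k. 0)"
| step: "extended_span \<phi> Z u \<Longrightarrow> r \<in> Z \<Longrightarrow> extended_span \<phi> Z (\<lambda>k. u k + \<phi> (r k) * w)"

lemma extended_span_base: "r \<in> Z \<Longrightarrow> extended_span \<phi> Z (\<lambda>k. \<phi> (r k) * w)"
  using extended_span.step[OF extended_span.zero, of r Z \<phi> w] by simp

lemma extended_span_add:
  "extended_span \<phi> Z v \<Longrightarrow> extended_span \<phi> Z u \<Longrightarrow> extended_span \<phi> Z (\<lambda>k. u k + v k)"
proof (induction v rule: extended_span.induct)
  case (step v r w)
  then show ?case using extended_span.step[of \<phi> Z "\<lambda>k. u k + v k" r w] by (simp add: add.assoc)
qed simp

lemma extended_span_scale: "extended_span \<phi> Z u \<Longrightarrow> extended_span \<phi> Z (\<lambda>k. c * u k)"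
proof (induction u rule: extended_span.induct)
  case zero
  show ?case using extended_span.zero by simp
next
  case (step u r w)
  then show ?case
    using extended_span.step[of \<phi> Z "\<lambda>k. c * u k" r "c * w"] by (simp add: algebra_simps)
qed

lemma extended_span_sum:
  "(\<And>j. j \<in> L \<Longrightarrow> extended_span \<phi> Z (u j)) \<Longrightarrow> extended_span \<phi> Z (\<lambda>k. \<Sum>j\<in>L. u j k)"
proof (induction L rule: infinite_finite_induct)
  case (insert x F)
  then show ?case using extended_span_add[of \<phi> Z "\<lambda>k. \<Sum>j\<in>F. u j k" "u x"] by simp
qed (auto intro: extended_span.zero)

lemma extended_span_finite:
  "extended_span \<phi> Z u \<Longrightarrow> \<exists>n r w. (\<forall>j<(n::nat). r j \<in> Z) \<and> u = (\<lambda>k. \<Sum>j<n. \<phi> (r j k) * w j)"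
proof (induction u rule: extended_span.induct)
  case zero
  show ?case by (rule exI[of _ 0]) simp
next
  case (step u r w)
  then obtain n r' w' where *: "\<forall>j<(n::nat). r' j \<in> Z" "u = (\<lambda>k. \<Sum>j<n. \<phi> (r' j k) * w' j)" by blast
  show ?case
    by (rule exI[of _ "Suc n"], rule exI[of _ "r'(n := r)"], rule exI[of _ "w'(n := w)"])
      (use step * in \<open>auto simp: less_Suc_eq\<close>)
qed

text \<open>Flatness is tested on modules whose elements are sets, so an ideal is encoded through singletons. The
  multiplication and the unit of the record are dummies.\<close>

definition singleton_module :: "'a::comm_ring_1 set \<Rightarrow> ('a, 'a set) module" where
  "singleton_module I = \<lparr>carrier = (\<lambda>a. {a}) ` I, monoid.mult = (\<lambda>X Y. {}), one = {}, zero = {0},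
     add = (\<lambda>X Y. {the_elem X + the_elem Y}), smult = (\<lambda>r X. {r * the_elem X})\<rparr>"

lemma module_singleton_module:
  assumes "idl (I :: 'v mpoly set)"
  shows "Module.module mpoly_ring (singleton_module I)"
proof (rule Module.moduleI)
  show "cring mpoly_ring" by (rule cring_mpoly_ring)
  show "abelian_group (singleton_module I)"
  proof (rule abelian_groupI)
    fix x assume "x \<in> carrier (singleton_module I)"
    then obtain a where a: "a \<in> I" "x = {a}" by (auto simp: singleton_module_def)
    then show "\<exists>y\<in>carrier (singleton_module I). y \<oplus>\<^bsub>singleton_module I\<^esub> x = \<zero>\<^bsub>singleton_module I\<^esub>"
      using idlD[OF assms] by (intro bexI[of _ "{- a}"]) (auto simp: singleton_module_def)
  qed (use idlD[OF assms] in \<open>auto simp: singleton_module_def add_ac\<close>)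
qed (use idlD[OF assms] in \<open>auto simp: singleton_module_def mpoly_ring_def distrib_left distrib_right mult.assoc\<close>)


text \<open>The defining relations of the tensor product of I with the target ring, decoded from
  singletons.\<close>

definition tensor_generators ::
  "('m mpoly \<Rightarrow> 'n mpoly) \<Rightarrow> 'm mpoly set \<Rightarrow> ('m mpoly set \<times> 'n mpoly \<Rightarrow>\<^sub>0 int) set" where
  "tensor_generators \<phi> I =
      {frag_of ({a + b}, y) - frag_of ({a}, y) - frag_of ({b}, y) | a b y. a \<in> I \<and> b \<in> I} \<union>
      {frag_of ({a}, y + z) - frag_of ({a}, y) - frag_of ({a}, z) | a y z. a \<in> I} \<union>
      {frag_of ({r * a}, y) - frag_of ({a}, \<phi> r * y) | r a y. a \<in> I}"

lemma tensor_relations_eq: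
  "tensor_relations mpoly_ring (singleton_module I) (scalar_restriction mpoly_ring \<phi>) =
    generate (free_Abelian_group ((\<lambda>a. {a}) ` I \<times> UNIV)) (tensor_generators \<phi> I)"
proof -
  let ?M = "singleton_module I" and ?N = "scalar_restriction mpoly_ring \<phi>"
  have c: "carrier ?M = (\<lambda>a. {a}) ` I" "carrier ?N = UNIV" "carrier mpoly_ring = UNIV"
    and ops: "{a} \<oplus>\<^bsub>?M\<^esub> {b} = {a + b}" "y \<oplus>\<^bsub>?N\<^esub> z = y + z" "r \<odot>\<^bsub>?M\<^esub> {a} = {r * a}"
      "r \<odot>\<^bsub>?N\<^esub> y = \<phi> r * y" for a b r y z
    by (simp_all add: singleton_module_def scalar_restriction_def mpoly_ring_def)
  let ?G = "{frag_of (x \<oplus>\<^bsub>?M\<^esub> x', y) - frag_of (x, y) - frag_of (x', y) | x x' y.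
           x \<in> carrier ?M \<and> x' \<in> carrier ?M \<and> y \<in> carrier ?N} \<union>
        {frag_of (x, y \<oplus>\<^bsub>?N\<^esub> y') - frag_of (x, y) - frag_of (x, y') | x y y'.
           x \<in> carrier ?M \<and> y \<in> carrier ?N \<and> y' \<in> carrier ?N} \<union>
        {frag_of (r \<odot>\<^bsub>?M\<^esub> x, y) - frag_of (x, r \<odot>\<^bsub>?N\<^esub> y) | r x y.
           r \<in> carrier mpoly_ring \<and> x \<in> carrier ?M \<and> y \<in> carrier ?N}"
  have "?G = tensor_generators \<phi> I"
  proof (rule Set.equalityI; rule subsetI)
    fix h assume "h \<in> ?G"
    then show "h \<in> tensor_generators \<phi> I"
      unfolding c tensor_generators_def by (elim UnE CollectE exE conjE imageE; simp only: ops; blast)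
  next
    fix h assume "h \<in> tensor_generators \<phi> I"
    then consider
      (1) a b y where "h = frag_of ({a} \<oplus>\<^bsub>?M\<^esub> {b}, y) - frag_of ({a}, y) - frag_of ({b}, y)" "{a} \<in> carrier ?M" "{b} \<in> carrier ?M"
    | (2) a y z where "h = frag_of ({a}, y \<oplus>\<^bsub>?N\<^esub> z) - frag_of ({a}, y) - frag_of ({a}, z)" "{a} \<in> carrier ?M"
    | (3) r a y where "h = frag_of (r \<odot>\<^bsub>?M\<^esub> {a}, y) - frag_of ({a}, r \<odot>\<^bsub>?N\<^esub> y)" "{a} \<in> carrier ?M"
      unfolding tensor_generators_def c ops by blast
    then show "h \<in> ?G" unfolding c(2,3) by cases blast+
  qed
  then show ?thesis unfolding tensor_relations_def c(1,2) by (simp only:)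
qed

lemma tensor_generators_subset:
  assumes I: "idl I"
  shows "tensor_generators \<phi> I \<subseteq> carrier (free_Abelian_group ((\<lambda>a. {a}) ` I \<times> UNIV))"
proof -
  let ?S = "(\<lambda>a. {a}) ` I \<times> (UNIV :: 'b mpoly set)"
  have d: "keys (s - t) \<subseteq> ?S" if "keys s \<subseteq> ?S" "keys t \<subseteq> ?S"
    for s t :: "'a mpoly set \<times> 'b mpoly \<Rightarrow>\<^sub>0 int" using keys_diff[of s t] that by blast
  have f: "keys (frag_of ({a}, y)) \<subseteq> ?S" if "a \<in> I" for a and y :: "'b mpoly"
    using that by (simp add: keys_frag_of)
  have "keys h \<subseteq> ?S" if "h \<in> tensor_generators \<phi> I" for h
    by (insert that, unfold tensor_generators_def)
      (elim UnE CollectE exE conjE; simp only:; intro d f idlD(2,3)[OF I]; assumption)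
  then show ?thesis by (auto simp: free_Abelian_group_def)
qed

lemma tensor_relations_closed:
  fixes \<phi> :: "'m mpoly \<Rightarrow> 'n mpoly"
  assumes I: "idl I"
  defines "Rel \<equiv> tensor_relations mpoly_ring (singleton_module I) (scalar_restriction mpoly_ring \<phi>)"
  shows "0 \<in> Rel" "s \<in> Rel \<Longrightarrow> t \<in> Rel \<Longrightarrow> s + t \<in> Rel" "s \<in> Rel \<Longrightarrow> - s \<in> Rel"
    "s \<in> tensor_generators \<phi> I \<Longrightarrow> s \<in> Rel"
    "s \<in> Rel \<Longrightarrow> keys s \<subseteq> (\<lambda>a. {a}) ` I \<times> UNIV"
proof -
  let ?G = "free_Abelian_group ((\<lambda>a. {a}) ` I \<times> (UNIV :: 'n mpoly set))"
  interpret group ?G by simp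
  interpret subgroup Rel ?G unfolding Rel_def tensor_relations_eq
    by (rule generate_is_subgroup[OF tensor_generators_subset[OF I]])
  show "0 \<in> Rel" using one_closed by (simp add: free_Abelian_group_def)
  show "s \<in> Rel \<Longrightarrow> t \<in> Rel \<Longrightarrow> s + t \<in> Rel" using m_closed[of s t] by (simp add: free_Abelian_group_def)
  show keys: "s \<in> Rel \<Longrightarrow> keys s \<subseteq> (\<lambda>a. {a}) ` I \<times> UNIV"
    for s using mem_carrier[of s] by (simp add: free_Abelian_group_def)
  show "- s \<in> Rel" if "s \<in> Rel" using m_inv_closed[OF that] inv_free_Abelian_group[OF keys[OF that]] by simp
  show "s \<in> tensor_generators \<phi> I \<Longrightarrow> s \<in> Rel" unfolding Rel_def tensor_relations_eq by (rule generate.incl)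
qed

lemma tensor_relations_induct [consumes 2, case_names zero add minus gen]:
  fixes \<phi> :: "'m mpoly \<Rightarrow> 'n mpoly"
  assumes I: "idl I" and t: "t \<in> tensor_relations mpoly_ring (singleton_module I) (scalar_restriction mpoly_ring \<phi>)"
    and P: "P 0" "\<And>s t. P s \<Longrightarrow> P t \<Longrightarrow> P (s + t)" "\<And>s. P s \<Longrightarrow> P (- s)" "\<And>s. s \<in> tensor_generators \<phi> I \<Longrightarrow> P s"
  shows "P t"
  using t unfolding tensor_relations_eq
proof (induction t rule: generate.induct)
  case one
  show ?case using P(1) by (simp add: free_Abelian_group_def)
next
  case (inv h)
  then have "keys h \<subseteq> (\<lambda>a. {a}) ` I \<times> UNIV"
    using tensor_generators_subset[OF I, of \<phi>] by (auto simp: free_Abelian_group_def)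
  then show ?case using P(3)[OF P(4)[OF inv]] by (simp add: inv_free_Abelian_group)
next
  case (eng h1 h2)
  then show ?case using P(2) by (simp add: free_Abelian_group_def)
qed (fact P(4))

text \<open>Moving each a k across the tensor sign turns the sum into 1 tensor \<Sum> \<phi>(a k) s
  k, which is 1 tensor 0.\<close>

lemma tensor_one_relation:
  fixes \<phi> :: "'m mpoly \<Rightarrow> 'n mpoly"
  assumes "finite K" "(\<Sum>k\<in>K. \<phi> (a k) * s k) = 0"
  shows "(\<Sum>k\<in>K. frag_of ({a k}, s k)) \<in>
    tensor_relations mpoly_ring (singleton_module UNIV) (scalar_restriction mpoly_ring \<phi>)"
    (is "_ \<in> ?Rel")
proof -
  have U: "idl UNIV" by (simp add: idl_def)
  note cl = tensor_relations_closed[OF U, where \<phi> = \<phi>]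
  have diff: "u - v \<in> ?Rel" if "u \<in> ?Rel" "v \<in> ?Rel" for u v
    using cl(2)[OF that(1) cl(3)[OF that(2)]] by simp
  \<comment> \<open>Additivity at 0 + 0 is the negative of the symbol 1 tensor 0.\<close>
  have "frag_of ({1}, 0 + 0) - frag_of ({1}, 0) - frag_of ({1}, 0) \<in> tensor_generators \<phi> UNIV"
    unfolding tensor_generators_def by blast
  then have zero: "frag_of ({1}, 0) \<in> ?Rel" using cl(3)[OF cl(4)] by fastforce
  have "(\<Sum>k\<in>K. frag_of ({a k}, s k)) - frag_of ({1}, \<Sum>k\<in>K. \<phi> (a k) * s k) \<in> ?Rel"
    using assms(1)
  proof (induction K rule: finite_induct)
    case empty
    show ?case using cl(3)[OF zero] by simp
  next
    case (insert k K)
    let ?y = "\<phi> (a k) * s k" and ?z = "\<Sum>k\<in>K. \<phi> (a k) * s k"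
    have 1: "frag_of ({a k * 1}, s k) - frag_of ({1}, ?y) \<in> ?Rel"
      by (rule cl(4)) (unfold tensor_generators_def, blast)
    have 2: "frag_of ({1}, ?y + ?z) - frag_of ({1}, ?y) - frag_of ({1}, ?z) \<in> ?Rel"
      by (rule cl(4)) (unfold tensor_generators_def, blast)
    have "(\<Sum>k\<in>insert k K. frag_of ({a k}, s k)) - frag_of ({1}, \<Sum>k\<in>insert k K. \<phi> (a k) * s k) =
      ((frag_of ({a k * 1}, s k) - frag_of ({1}, ?y)) +
       ((\<Sum>k\<in>K. frag_of ({a k}, s k)) - frag_of ({1}, ?z))) -
      (frag_of ({1}, ?y + ?z) - frag_of ({1}, ?y) - frag_of ({1}, ?z))"
      using insert.hyps by (simp add: algebra_simps)
    then show ?case using diff[OF cl(2)[OF 1 insert.IH] 2] by simp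
  qed
  from cl(2)[OF this zero] show ?thesis using assms(2) by simp
qed

text \<open>Injectivity of the map from I tensor N to R tensor N, phrased for representatives: an
  element supported on I that is zero in the larger product is already zero in the smaller
  one.\<close>

lemma flat_tensor_relation:
  fixes \<phi> :: "'m mpoly \<Rightarrow> 'n mpoly"
  assumes flat: "flat_ring_hom mpoly_ring mpoly_ring \<phi>" and I: "idl I"
    and t: "t \<in> tensor_relations mpoly_ring (singleton_module UNIV) (scalar_restriction mpoly_ring \<phi>)"
      "keys t \<subseteq> (\<lambda>a. {a}) ` I \<times> UNIV"
  shows "t \<in> tensor_relations mpoly_ring (singleton_module I) (scalar_restriction mpoly_ring \<phi>)"
proof -
  let ?M = "singleton_module I" and ?M' = "singleton_module (UNIV :: 'm mpoly set)"
    and ?N = "scalar_restriction mpoly_ring \<phi>"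
  let ?R = "tensor_relations mpoly_ring ?M ?N" and ?R' = "tensor_relations mpoly_ring ?M' ?N"
  let ?G = "free_Abelian_group (carrier ?M \<times> carrier ?N)" and ?G' = "free_Abelian_group (carrier ?M' \<times> carrier ?N)"
  have U: "idl (UNIV :: 'm mpoly set)" by (simp add: idl_def)
  note cl = tensor_relations_closed[OF I, where \<phi> = \<phi>] and cl' = tensor_relations_closed[OF U, where \<phi> = \<phi>]
  have c: "carrier ?M = (\<lambda>a. {a}) ` I" "carrier ?N = UNIV"
    by (simp_all add: singleton_module_def scalar_restriction_def mpoly_ring_def)
  have "(\<lambda>X. X) \<in> linear_maps mpoly_ring ?M ?M'"
    by (auto simp: linear_maps_def singleton_module_def)
  then have inj: "inj_on (tensor_map mpoly_ring ?M' ?N (\<lambda>X. X)) (carrier (tensor_product mpoly_ring ?M ?N))"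
    using flat module_singleton_module[OF I] module_singleton_module[OF U]
    unfolding flat_ring_hom_def by (metis inj_on_id2)
  have sub: "?R \<subseteq> ?R'"
  proof
    fix u assume "u \<in> ?R"
    with I show "u \<in> ?R'"
    proof (induction u rule: tensor_relations_induct)
      case (gen s)
      then have "s \<in> tensor_generators \<phi> UNIV" unfolding tensor_generators_def by blast
      then show ?case by (rule cl'(4))
    qed (use cl' in auto)
  qed
  \<comment> \<open>Cosets of relations over R all go to the zero coset. Comparing the cosets of t
    and 0 under the injective map then gives the claim.\<close>
  have map: "tensor_map mpoly_ring ?M' ?N (\<lambda>X. X) (?R #>\<^bsub>?G\<^esub> u) = ?R'" if u: "u \<in> ?R'" for u
  proof -
    have ext: "frag_extend (\<lambda>(x, y). frag_of (x, y)) w = w" for w :: "'m mpoly set \<times> 'n mpoly \<Rightarrow>\<^sub>0 int"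
      using frag_expansion[of w] by (simp add: case_prod_beta')
    have "?R' #>\<^bsub>?G'\<^esub> w = ?R'" if "w \<in> ?R'" for w
    proof -
      have "v = (v + - w) + w" for v :: "'m mpoly set \<times> 'n mpoly \<Rightarrow>\<^sub>0 int" by simp
      then show ?thesis using that cl'(2,3) unfolding r_coset_def free_Abelian_group_def
        by (auto; metis)
    qed
    moreover have "w \<in> ?R'" if "w \<in> ?R #>\<^bsub>?G\<^esub> u" for w
      using that u sub cl'(2) unfolding r_coset_def free_Abelian_group_def by auto
    moreover have "u \<in> ?R #>\<^bsub>?G\<^esub> u"
      using cl(1) unfolding r_coset_def free_Abelian_group_def by force
    ultimately show ?thesis unfolding tensor_map_def ext by blast
  qed
  have "?R #>\<^bsub>?G\<^esub> 0 \<in> carrier (tensor_product mpoly_ring ?M ?N)" "?R #>\<^bsub>?G\<^esub> t \<in> carrier (tensor_product mpoly_ring ?M ?N)"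
    using t(2) unfolding tensor_product_def FactGroup_def RCOSETS_def by (auto simp: c free_Abelian_group_def)
  then have "?R #>\<^bsub>?G\<^esub> t = ?R #>\<^bsub>?G\<^esub> 0"
    using inj_onD[OF inj] map[OF t(1)] map[OF cl'(1)] by metis
  moreover have "t \<in> ?R #>\<^bsub>?G\<^esub> t"
    using cl(1) unfolding r_coset_def free_Abelian_group_def by force
  ultimately show ?thesis unfolding r_coset_def free_Abelian_group_def by auto
qed

text \<open>By flatness \<Sum> a k tensor s k vanishes in I tensor the target ring. Writing elements
  of I through the generators a k maps this tensor product to coefficient vectors modulo extended
  relations, so the image of that zero element is an extended relation. It differs from s only by
  further extended relations.\<close>

lemma flat_equation:
  fixes \<phi> :: "'m mpoly \<Rightarrow> 'n mpoly"
  assumes flat: "flat_ring_hom mpoly_ring mpoly_ring \<phi>" and hom: "rhom \<phi>" and K: "finite K"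
    and eq: "(\<Sum>k\<in>K. \<phi> (a k) * s k) = 0"
  shows "\<exists>u. extended_span \<phi> {r. (\<Sum>k\<in>K. a k * r k) = 0} u \<and> (\<forall>k\<in>K. u k = s k)"
proof -
  let ?Z = "{r. (\<Sum>k\<in>K. a k * r k) = 0}"
  define I where "I = {\<Sum>k\<in>K. c k * a k | c. True}"
  have I: "idl I" unfolding I_def by (rule idl_combinations)
  \<comment> \<open>An arbitrary choice of coefficients for each x in I. It is not linear, but its
    failure to be additive or homogeneous is always a relation among the a k.\<close>
  define \<rho> where "\<rho> x = (SOME r. (\<Sum>k\<in>K. a k * r k) = x)" for x
  have \<rho>: "(\<Sum>k\<in>K. a k * \<rho> x k) = x" if "x \<in> I" for x
  proof -
    have "\<exists>r. (\<Sum>k\<in>K. a k * r k) = x" using that unfolding I_def by (auto simp: mult.commute)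
    then show ?thesis unfolding \<rho>_def by (rule someI_ex)
  qed

  have aI: "a k \<in> I" if "k \<in> K" for k
  proof -
    have "(\<Sum>j\<in>K. (if j = k then 1 else 0) * a j) = (\<Sum>j\<in>K. if j = k then a j else 0)" by (intro sum.cong) auto
    then have "a k = (\<Sum>j\<in>K. (if j = k then 1 else 0) * a j)" using that K by simp
    then show ?thesis unfolding I_def by (intro CollectI exI[of _ "\<lambda>j. if j = k then 1 else 0"] conjI TrueI)
  qed
  \<comment> \<open>\<open>\<Phi>\<close> sends \<open>x \<otimes> y\<close> to the coefficients of \<open>x\<close> times \<open>y\<close>; it is only defined modulo extended relations.\<close>
  define \<Phi> where "\<Phi> t k = (\<Sum>p\<in>keys t. of_int (lookup t p) * (\<phi> (\<rho> (the_elem (fst p)) k) * snd p))"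
    for t :: "'m mpoly set \<times> 'n mpoly \<Rightarrow>\<^sub>0 int" and k
  have \<Phi>_sup: "\<Phi> t k = (\<Sum>p\<in>B. of_int (lookup t p) * (\<phi> (\<rho> (the_elem (fst p)) k) * snd p))"
    if "finite B" "keys t \<subseteq> B" for t B k
    unfolding \<Phi>_def using that by (intro sum.mono_neutral_left) (auto simp: in_keys_iff)
  have \<Phi>_add: "\<Phi> (t + t') k = \<Phi> t k + \<Phi> t' k" for t t' k
  proof -
    let ?B = "keys t \<union> keys t'"
    have "keys (t + t') \<subseteq> ?B" by (rule Poly_Mapping.keys_add)
    then show ?thesis
      by (subst (1 2 3) \<Phi>_sup[where B = ?B]) (auto simp: lookup_add sum.distrib distrib_right)
  qed
  have \<Phi>_zero: "\<Phi> 0 k = 0" for k by (simp add: \<Phi>_def)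
  have \<Phi>_neg: "\<Phi> (- t) k = - \<Phi> t k" for t k
    using \<Phi>_add[of t "- t" k] by (simp add: \<Phi>_zero eq_neg_iff_add_eq_0 add.commute)
  have \<Phi>_diff: "\<Phi> (t - t') k = \<Phi> t k - \<Phi> t' k" for t t' k
    using \<Phi>_add[of t "- t'" k] by (simp add: \<Phi>_neg)
  have \<Phi>_of: "\<Phi> (frag_of ({x}, y)) k = \<phi> (\<rho> x k) * y" for x y k
    by (subst \<Phi>_sup[where B = "{({x}, y)}"]) auto
  have \<Phi>_sum: "\<Phi> (\<Sum>j\<in>L. t j) k = (\<Sum>j\<in>L. \<Phi> (t j) k)" for t k and L :: "'a set"
    by (induction L rule: infinite_finite_induct) (auto simp: \<Phi>_zero \<Phi>_add)
  have span: "extended_span \<phi> ?Z (\<Phi> t)"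
    if "t \<in> tensor_relations mpoly_ring (singleton_module I) (scalar_restriction mpoly_ring \<phi>)" for t
    using I that
  proof (induction t rule: tensor_relations_induct)
    case zero
    have "\<Phi> 0 = (\<lambda>k. 0)" by (rule ext) (rule \<Phi>_zero)
    then show ?case using extended_span.zero by simp
  next
    case (add s t)
    have "\<Phi> (s + t) = (\<lambda>k. \<Phi> s k + \<Phi> t k)" by (rule ext) (rule \<Phi>_add)
    then show ?case using extended_span_add[OF add(2,1)] by simp
  next
    case (minus s)
    have "\<Phi> (- s) = (\<lambda>k. - 1 * \<Phi> s k)" by (rule ext) (simp add: \<Phi>_neg)
    then show ?case using extended_span_scale[OF minus, of "- 1"] by simp
  next
    case (gen t)
    then consider
      (1) a' b y where "t = frag_of ({a' + b}, y) - frag_of ({a'}, y) - frag_of ({b}, y)" "a' \<in> I" "b \<in> I"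
    | (2) a' y z where "t = frag_of ({a'}, y + z) - frag_of ({a'}, y) - frag_of ({a'}, z)" "a' \<in> I"
    | (3) r a' y where "t = frag_of ({r * a'}, y) - frag_of ({a'}, \<phi> r * y)" "a' \<in> I"
      unfolding tensor_generators_def by blast
    then show ?case
    proof cases
      case 1
      have "\<Phi> t = (\<lambda>k. \<phi> (\<rho> (a' + b) k - \<rho> a' k - \<rho> b k) * y)"
        by (rule ext, unfold 1 \<Phi>_diff \<Phi>_of rhom_diff[OF hom]) (simp add: algebra_simps)
      moreover have "(\<lambda>k. \<rho> (a' + b) k - \<rho> a' k - \<rho> b k) \<in> ?Z"
        using \<rho>[OF 1(2)] \<rho>[OF 1(3)] \<rho>[OF idlD(2)[OF I 1(2,3)]]
        by (simp add: right_diff_distrib sum_subtractf)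
      ultimately show ?thesis using extended_span_base[of "\<lambda>k. \<rho> (a' + b) k - \<rho> a' k - \<rho> b k" ?Z \<phi> y] by simp
    next
      case 2
      have "\<Phi> t = (\<lambda>k. 0)" by (rule ext, unfold 2 \<Phi>_diff \<Phi>_of) (simp add: algebra_simps)
      then show ?thesis using extended_span.zero by simp
    next
      case 3
      have "\<Phi> t = (\<lambda>k. \<phi> (\<rho> (r * a') k - r * \<rho> a' k) * y)"
        by (rule ext, unfold 3 \<Phi>_diff \<Phi>_of rhom_diff[OF hom] rhom_simps(4)[OF hom]) (simp add: algebra_simps)
      moreover have "(\<Sum>k\<in>K. a k * (r * \<rho> a' k)) = r * (\<Sum>k\<in>K. a k * \<rho> a' k)"
        by (simp add: sum_distrib_left mult.left_commute)
      then have "(\<lambda>k. \<rho> (r * a') k - r * \<rho> a' k) \<in> ?Z"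
        using \<rho>[OF 3(2)] \<rho>[OF idlD(3)[OF I 3(2), of r]] by (simp add: right_diff_distrib sum_subtractf)
      ultimately show ?thesis using extended_span_base[of "\<lambda>k. \<rho> (r * a') k - r * \<rho> a' k" ?Z \<phi> y] by simp
    qed
  qed
  let ?t = "\<Sum>k\<in>K. frag_of ({a k}, s k)"
  have "keys ?t \<subseteq> (\<Union>k\<in>K. {({a k}, s k)})"
    using Poly_Mapping.keys_sum[of "\<lambda>k. frag_of ({a k}, s k)" K] by (simp add: keys_frag_of)
  then have "keys ?t \<subseteq> (\<lambda>a. {a}) ` I \<times> UNIV" using aI by auto
  then have "?t \<in> tensor_relations mpoly_ring (singleton_module I) (scalar_restriction mpoly_ring \<phi>)"
    by (rule flat_tensor_relation[OF flat I tensor_one_relation[of K \<phi>, OF K eq]])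
  then have "extended_span \<phi> ?Z (\<Phi> ?t)" by (rule span)
  moreover have "\<Phi> ?t = (\<lambda>k. \<Sum>j\<in>K. \<phi> (\<rho> (a j) k) * s j)" by (rule ext) (simp add: \<Phi>_sum \<Phi>_of)
  ultimately have s1: "extended_span \<phi> ?Z (\<lambda>k. \<Sum>j\<in>K. \<phi> (\<rho> (a j) k) * s j)" by simp
  \<comment> \<open>The unit vector at j and \<rho> (a j) both represent a j, so their difference is
    a relation. Adding these corrections to \<open>s1\<close> recovers s on K.\<close>
  have s2: "extended_span \<phi> ?Z (\<lambda>k. \<Sum>j\<in>K. \<phi> ((if k = j then 1 else 0) - \<rho> (a j) k) * s j)"
  proof (rule extended_span_sum, rule extended_span_base, rule CollectI)
    fix j assume j: "j \<in> K"
    have "(\<Sum>k\<in>K. a k * (if k = j then 1 else 0)) = (\<Sum>k\<in>K. if k = j then a k else 0)" by (intro sum.cong) auto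
    then show "(\<Sum>k\<in>K. a k * ((if k = j then 1 else 0) - \<rho> (a j) k)) = 0"
      using \<rho>[OF aI[OF j]] j K by (simp add: right_diff_distrib sum_subtractf)
  qed
  have "(\<Sum>j\<in>K. \<phi> (\<rho> (a j) k) * s j) + (\<Sum>j\<in>K. \<phi> ((if k = j then 1 else 0) - \<rho> (a j) k) * s j) = s k"
    if "k \<in> K" for k
  proof -
    have "(\<Sum>j\<in>K. \<phi> ((if k = j then 1 else 0) - \<rho> (a j) k) * s j) =
      (\<Sum>j\<in>K. \<phi> (if k = j then 1 else 0) * s j) - (\<Sum>j\<in>K. \<phi> (\<rho> (a j) k) * s j)"
      by (simp add: rhom_diff[OF hom] left_diff_distrib sum_subtractf)
    moreover have "(\<Sum>j\<in>K. \<phi> (if k = j then 1 else 0) * s j) = (\<Sum>j\<in>K. if k = j then s j else 0)"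
      by (intro sum.cong) (auto simp: rhom_simps[OF hom])
    ultimately show ?thesis using that K by simp
  qed
  then show ?thesis using extended_span_add[OF s2 s1] by blast
qed

text \<open>Equations are imposed one at a time: the current solution is expressed through solutions
  over the source ring, and the next equation becomes a single linear equation for the multipliers w
  j.\<close>

lemma flat_system:
  fixes \<phi> :: "'m mpoly \<Rightarrow> 'n mpoly"
  assumes flat: "flat_ring_hom mpoly_ring mpoly_ring \<phi>" and hom: "rhom \<phi>" and E: "finite E"
    and eq: "\<And>e. e \<in> E \<Longrightarrow> (\<Sum>x\<in>UNIV. \<phi> (c e x) * u x) = 0"
  shows "extended_span \<phi> {r. \<forall>e\<in>E. (\<Sum>x\<in>UNIV. c e x * r (x :: 'x::finite)) = 0} u"
  using E eq
proof (induction E rule: finite_induct)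
  case empty
  have "extended_span \<phi> UNIV (\<lambda>x. \<Sum>y\<in>UNIV. \<phi> (if x = y then 1 else 0) * u y)"
    by (intro extended_span_sum extended_span_base) simp
  moreover have "(\<Sum>y\<in>UNIV. \<phi> (if x = y then 1 else 0) * u y) = u x" for x
  proof -
    have "(\<Sum>y\<in>UNIV. \<phi> (if x = y then 1 else 0) * u y) = (\<Sum>y\<in>UNIV. if x = y then u y else 0)"
      by (intro sum.cong) (auto simp: rhom_simps[OF hom])
    then show ?thesis by simp
  qed
  ultimately show ?case by simp
next
  case (insert e E)
  obtain n r w where *: "\<forall>j<(n::nat). r j \<in> {r. \<forall>e\<in>E. (\<Sum>x\<in>UNIV. c e x * r x) = 0}"
    "u = (\<lambda>x. \<Sum>j<n. \<phi> (r j x) * w j)"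
  proof -
    have "extended_span \<phi> {r. \<forall>e\<in>E. (\<Sum>x\<in>UNIV. c e x * r x) = 0} u"
      using insert.IH insert.prems by blast
    from extended_span_finite[OF this] show ?thesis using that by blast
  qed
  \<comment> \<open>The value of the new equation on the generator r j. The relations q among these
    values combine the r j into solutions of the enlarged system.\<close>
  define a where "a j = (\<Sum>x\<in>UNIV. c e x * r j x)" for j
  have "(\<Sum>j<n. \<phi> (a j) * w j) = (\<Sum>x\<in>UNIV. \<phi> (c e x) * u x)"
    unfolding *(2) a_def rhom_sum[OF hom] rhom_simps(4)[OF hom] sum_distrib_left sum_distrib_right
    by (subst sum.swap) (simp add: mult.assoc)
  then have "(\<Sum>j<n. \<phi> (a j) * w j) = 0" using insert.prems by simp
  then obtain v where v: "extended_span \<phi> {q. (\<Sum>j<n. a j * q j) = 0} v" "\<forall>j<n. v j = w j"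
    using flat_equation[OF flat hom, of "{..<n}" a w] by auto
  obtain N q y where q: "\<forall>l<(N::nat). q l \<in> {q. (\<Sum>j<n. a j * q j) = 0}" "v = (\<lambda>j. \<Sum>l<N. \<phi> (q l j) * y l)"
    using extended_span_finite[OF v(1)] by blast
  have "u x = (\<Sum>l<N. \<phi> (\<Sum>j<n. r j x * q l j) * y l)" for x
  proof -
    have "u x = (\<Sum>j<n. \<phi> (r j x) * v j)" unfolding *(2) using v(2) by simp
    also have "\<dots> = (\<Sum>l<N. \<phi> (\<Sum>j<n. r j x * q l j) * y l)"
      unfolding q(2) rhom_sum[OF hom] rhom_simps(4)[OF hom] sum_distrib_left sum_distrib_right
      by (subst sum.swap) (simp add: mult.assoc)
    finally show ?thesis .
  qed
  then have u: "u = (\<lambda>x. \<Sum>l<N. \<phi> (\<Sum>j<n. r j x * q l j) * y l)" by (rule ext)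
  show ?case unfolding u
  proof (rule extended_span_sum, rule extended_span_base, intro CollectI ballI)
    fix l e' assume l: "l \<in> {..<N}" and e': "e' \<in> insert e E"
    have swap: "(\<Sum>x\<in>UNIV. c e' x * (\<Sum>j<n. r j x * q l j)) = (\<Sum>j<n. (\<Sum>x\<in>UNIV. c e' x * r j x) * q l j)"
      unfolding sum_distrib_left sum_distrib_right by (subst sum.swap) (simp add: mult.assoc)
    show "(\<Sum>x\<in>UNIV. c e' x * (\<Sum>j<n. r j x * q l j)) = 0"
    proof (cases "e' = e")
      case True
      then show ?thesis unfolding swap using q(1) l by (simp add: a_def)
    next
      case False
      then have "(\<Sum>x\<in>UNIV. c e' x * r j x) = 0" if "j < n" for j using *(1) e' that by auto
      then show ?thesis unfolding swap by simp
    qed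
  qed
qed

section \<open>Codimension\<close>

definition vanishing_ideal :: "('v::finite \<Rightarrow> complex) set \<Rightarrow> 'v mpoly set" where
  "vanishing_ideal Y = {p. \<forall>z\<in>Y. meval p z = 0}"

lemma idl_vanishing_ideal [simp]: "idl (vanishing_ideal Y)"
  by (auto simp: idl_def vanishing_ideal_def meval_simps)

lemma closedin_zariski: "closedin zariski C \<longleftrightarrow> (\<exists>T. C = zero_set T)"
proof -
  have "closedin zariski C \<longleftrightarrow> (\<exists>T. - C = - zero_set T)"
    unfolding closedin_def openin_zariski by (simp add: Compl_eq_Diff_UNIV)
  then show ?thesis by simp
qed

lemma zero_set_vanishing_ideal: "closedin zariski C \<Longrightarrow> zero_set (vanishing_ideal C) = C"
  unfolding closedin_zariski zero_set_def vanishing_ideal_def by auto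

lemma vanishing_ideal_zero_set: "prime_idl P \<Longrightarrow> vanishing_ideal (zero_set P) = P"
  using prime_idl_nullstellensatz[of P] unfolding vanishing_ideal_def zero_set_def by blast

lemma vanishing_ideal_strict_antimono:
  assumes "closedin zariski C" "closedin zariski D" "C \<subset> D"
  shows "\<exists>e. e \<in> vanishing_ideal C \<and> e \<notin> vanishing_ideal D"
proof (rule ccontr)
  assume "\<not> ?thesis"
  then have "vanishing_ideal C \<subseteq> vanishing_ideal D" by blast
  then have "zero_set (vanishing_ideal D) \<subseteq> zero_set (vanishing_ideal C)" unfolding zero_set_def by blast
  then show False using assms by (simp add: zero_set_vanishing_ideal)
qed

lemma prime_idl_vanishing_ideal:
  assumes "irreducible_closed zariski Y"
  shows "prime_idl (vanishing_ideal Y)"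
  unfolding prime_idl_def
proof (intro conjI allI impI)
  have Y: "closedin zariski Y" "Y \<noteq> {}" using assms by (auto simp: irreducible_closed_def)
  show "1 \<notin> vanishing_ideal Y" using Y(2) by (auto simp: vanishing_ideal_def)
  fix f g assume "f * g \<in> vanishing_ideal Y"
  then have "Y \<subseteq> zero_set {f} \<union> zero_set {g}" by (auto simp: vanishing_ideal_def zero_set_def meval_simps)
  moreover have "closedin zariski (zero_set {f})" "closedin zariski (zero_set {g})"
    unfolding closedin_zariski by blast+
  ultimately have "Y \<subseteq> zero_set {f} \<or> Y \<subseteq> zero_set {g}" using assms unfolding irreducible_closed_def by blast
  then show "f \<in> vanishing_ideal Y \<or> g \<in> vanishing_ideal Y" by (auto simp: vanishing_ideal_def zero_set_def)
qed simp

text \<open>By the Nullstellensatz the vanishing ideal of the zero set is P again, so primality of P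
  gives irreducibility and properness gives nonemptiness.\<close>

lemma irreducible_closed_zero_set:
  assumes P: "prime_idl P"
  shows "irreducible_closed zariski (zero_set P)"
  unfolding irreducible_closed_def
proof (intro conjI allI impI)
  show "closedin zariski (zero_set P)" unfolding closedin_zariski by blast
  show "zero_set P \<noteq> {}"
  proof
    assume "zero_set P = {}"
    then have "1 \<in> vanishing_ideal (zero_set P)" by (simp add: vanishing_ideal_def)
    then show False using P unfolding vanishing_ideal_zero_set[OF P] by (simp add: prime_idl_def)
  qed
  fix A B assume "closedin zariski A \<and> closedin zariski B \<and> zero_set P \<subseteq> A \<union> B"
  then obtain S T where AB: "A = zero_set S" "B = zero_set T" "zero_set P \<subseteq> A \<union> B"
    unfolding closedin_zariski by blast
  show "zero_set P \<subseteq> A \<or> zero_set P \<subseteq> B"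
  proof (rule ccontr)
    assume "\<not> ?thesis"
    then obtain f g where fg: "f \<in> S" "g \<in> T" "f \<notin> vanishing_ideal (zero_set P)" "g \<notin> vanishing_ideal (zero_set P)"
      unfolding AB zero_set_def vanishing_ideal_def by blast
    have "f * g \<in> vanishing_ideal (zero_set P)"
      using fg(1,2) AB unfolding vanishing_ideal_def zero_set_def by (fastforce simp: meval_simps)
    then show False using P fg(3,4) unfolding vanishing_ideal_zero_set[OF P] prime_idl_def by blast
  qed
qed

text \<open>A supremum of lengths that is at least k forces one length to be at least k, and a
  longer chain can be cut off.\<close>

lemma codim_chain:
  assumes "codim T A \<ge> enat k" "irreducible_closed T Y" "Y \<subseteq> A"
  shows "\<exists>C. C 0 = Y \<and> (\<forall>j\<le>k. irreducible_closed T (C j)) \<and> (\<forall>j<k. C j \<subset> C (Suc j))"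
proof (rule ccontr)
  let ?L = "{k. \<exists>C. C 0 = Y \<and> (\<forall>j\<le>k. irreducible_closed T (C j)) \<and> (\<forall>j<k. C j \<subset> C (Suc j))}"
  assume no: "\<not> ?thesis"
  have k: "k \<noteq> 0"
  proof
    assume "k = 0"
    then show False using no assms(2) by (auto dest!: spec[of _ "\<lambda>_. Y"])
  qed
  have lt: "l < k" if "l \<in> ?L" for l
  proof (rule ccontr)
    assume l: "\<not> l < k"
    from that have "\<exists>C. C 0 = Y \<and> (\<forall>j\<le>l. irreducible_closed T (C j)) \<and> (\<forall>j<l. C j \<subset> C (Suc j))"
      by (rule CollectD)
    then obtain C where "C 0 = Y \<and> (\<forall>j\<le>l. irreducible_closed T (C j)) \<and> (\<forall>j<l. C j \<subset> C (Suc j))" ..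
    then have "C 0 = Y \<and> (\<forall>j\<le>k. irreducible_closed T (C j)) \<and> (\<forall>j<k. C j \<subset> C (Suc j))" using l by auto
    then show False by (rule notE[OF no, OF exI[of _ C]])
  qed
  have "enat l \<le> enat (k - 1)" if "l \<in> ?L" for l
    using lt[OF that] by simp
  then have "(SUP l\<in>?L. enat l) \<le> enat (k - 1)" by (rule SUP_least)
  moreover have "codim T A \<le> (SUP l\<in>?L. enat l)" unfolding codim_def
    using assms(2,3) by (intro INF_lower CollectI conjI)
  ultimately have "enat k \<le> enat (k - 1)" using assms(1) by (meson order_trans)
  then show False using k by simp
qed

text \<open>The factor e ^ m can be cancelled modulo P' because e is not in P'. Reduction modulo P,
  which contains e, then leaves only the lowest coefficient.\<close>

lemma lowest_coefficient_in_prime: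
  assumes P': "prime_idl P'" "e \<notin> P'" and P: "idl P" "P' \<subseteq> P" "e \<in> P"
    and sum: "(\<Sum>l<k. e ^ l * Q l) \<in> P'" and m: "m < (k::nat)" "\<And>l. l < m \<Longrightarrow> Q l = 0"
  shows "Q m \<in> P"
proof -
  have "(\<Sum>l<k. e ^ l * Q l) = (\<Sum>l\<in>{m..<k}. e ^ l * Q l)"
    using m by (intro sum.mono_neutral_right) auto
  also have "\<dots> = e ^ m * Q m + (\<Sum>l\<in>{Suc m..<k}. e ^ l * Q l)"
    using m(1) by (simp add: sum.atLeast_Suc_lessThan)
  also have "(\<Sum>l\<in>{Suc m..<k}. e ^ l * Q l) = e ^ m * (\<Sum>l\<in>{Suc m..<k}. e ^ (l - m) * Q l)"
    unfolding sum_distrib_left by (intro sum.cong) (auto simp: power_add[symmetric] mult.assoc[symmetric])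
  finally have "e ^ m * (Q m + (\<Sum>l\<in>{Suc m..<k}. e ^ (l - m) * Q l)) \<in> P'"
    using sum by (simp add: distrib_left)
  then have "Q m + (\<Sum>l\<in>{Suc m..<k}. e ^ (l - m) * Q l) \<in> P"
    using P' P(2) prime_idl_power[OF P'(1)] unfolding prime_idl_def by blast
  moreover have "(\<Sum>l\<in>{Suc m..<k}. e ^ (l - m) * Q l) \<in> P"
  proof (rule idl_sum[OF P(1)])
    fix l assume "l \<in> {Suc m..<k}"
    then have "e ^ (l - m) * Q l = e ^ (l - m - 1) * Q l * e" by (simp add: power_eq_if mult_ac)
    then show "e ^ (l - m) * Q l \<in> P" using idlD(3)[OF P(1,3)] by metis
  qed
  ultimately show ?thesis using idlD(6)[OF P(1)] by fastforce
qed

lemma deg_lt_power: "deg_lt x (Suc d) p \<Longrightarrow> deg_lt x (Suc (d * k)) (p ^ k)"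
proof (induction k)
  case 0
  show ?case by (simp add: deg_lt_def)
next
  case (Suc k)
  then show ?case using deg_lt_mult[of x d p "Suc (d * k)" "p ^ k"] by simp
qed

lemma deg_lt_monomial:
  assumes "finite F" "\<And>t. t \<in> F \<Longrightarrow> a t < k"
  shows "deg_lt x (Suc k) (\<Prod>t\<in>F. mvar t ^ a t)"
proof -
  have "deg_lt x (Suc (if x \<in> F then a x else 0)) (\<Prod>t\<in>F. mvar t ^ a t)" using assms(1)
  proof (induction F rule: finite_induct)
    case empty
    show ?case by (simp add: deg_lt_def)
  next
    case (insert t F)
    have "deg_lt x (Suc (if x = t then a x else 0)) (mvar t ^ a t)"
      by (simp add: mvar_power deg_lt_def lookup_single when_def)
    from deg_lt_mult[OF this insert.IH] show ?case using insert.hyps by (auto split: if_splits)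
  qed
  then show ?thesis by (rule deg_lt_mono) (use assms(2) in \<open>auto intro: less_imp_le\<close>)
qed

text \<open>The last exponent becomes the outermost summation index, matching the order in which e2,
  e1, e0 are eliminated along the chain of primes.\<close>

lemma sum_4_times:
  "(\<Sum>q\<in>A \<times> {..<k} \<times> {..<k} \<times> {..<k}. g (fst q) (fst (snd q)) (fst (snd (snd q))) (snd (snd (snd q)))) =
   (\<Sum>l<(k::nat). \<Sum>j<(k::nat). \<Sum>i<(k::nat). \<Sum>a\<in>A. g a i j l)"
proof -
  have "(\<Sum>q\<in>A \<times> {..<k} \<times> {..<k} \<times> {..<k}. g (fst q) (fst (snd q)) (fst (snd (snd q))) (snd (snd (snd q)))) =
    (\<Sum>a\<in>A. \<Sum>i<k. \<Sum>j<k. \<Sum>l<k. g a i j l)"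
    unfolding sum.cartesian_product by (intro sum.cong) auto
  also have "\<dots> = (\<Sum>a\<in>A. \<Sum>l<k. \<Sum>j<k. \<Sum>i<k. g a i j l)"
  proof (rule sum.cong[OF refl])
    fix a
    have "(\<Sum>i<k. \<Sum>j<k. \<Sum>l<k. g a i j l) = (\<Sum>i<k. \<Sum>l<k. \<Sum>j<k. g a i j l)" by (intro sum.cong refl sum.swap)
    also have "\<dots> = (\<Sum>l<k. \<Sum>i<k. \<Sum>j<k. g a i j l)" by (rule sum.swap)
    also have "\<dots> = (\<Sum>l<k. \<Sum>j<k. \<Sum>i<k. g a i j l)" by (intro sum.cong refl sum.swap)
    finally show "(\<Sum>i<k. \<Sum>j<k. \<Sum>l<k. g a i j l) = (\<Sum>l<k. \<Sum>j<k. \<Sum>i<k. g a i j l)" .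
  qed
  also have "\<dots> = (\<Sum>l<k. \<Sum>a\<in>A. \<Sum>j<k. \<Sum>i<k. g a i j l)" by (rule sum.swap)
  also have "\<dots> = (\<Sum>l<k. \<Sum>j<k. \<Sum>a\<in>A. \<Sum>i<k. g a i j l)" by (intro sum.cong refl sum.swap)
  also have "\<dots> = (\<Sum>l<k. \<Sum>j<k. \<Sum>i<k. \<Sum>a\<in>A. g a i j l)" by (intro sum.cong refl sum.swap)
  finally show ?thesis .
qed

text \<open>Three strict inclusions of primes below \<open>P0\<close> raise the transcendence degree by three, which
  is detected by counting the monomials in the variables \<open>T\<close> and the elements \<open>e0\<close>, \<open>e1\<close>, \<open>e2\<close>.\<close>

lemma prime_chain_meets_subring:
  fixes P0 :: "'v::finite mpoly set"
  assumes P: "prime_idl P0" "prime_idl P1" "prime_idl P2" "prime_idl P3"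
    and sub: "P1 \<subseteq> P0" "P2 \<subseteq> P1" "P3 \<subseteq> P2"
    and e: "e0 \<in> P0" "e0 \<notin> P1" "e1 \<in> P1" "e1 \<notin> P2" "e2 \<in> P2" "e2 \<notin> P3"
    and T: "CARD('v) \<le> card T + 2"
  shows "meets_subring P0 T"
proof -
  obtain E where E: "\<And>x. deg_lt x (Suc E) e0" "\<And>x. deg_lt x (Suc E) e1" "\<And>x. deg_lt x (Suc E) e2"
  proof -
    obtain B0 B1 B2 where "\<forall>a\<in>keys e0. \<forall>i. lookup a i < B0"
      "\<forall>a\<in>keys e1. \<forall>i. lookup a i < B1"
      "\<forall>a\<in>keys e2. \<forall>i. lookup a i < B2" using mpoly_exponent_bound by metis
    then have "deg_lt x B0 e0" "deg_lt x B1 e1" "deg_lt x B2 e2" for x by (auto simp: deg_lt_def)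
    then have "deg_lt x (Suc (B0 + B1 + B2)) e0" "deg_lt x (Suc (B0 + B1 + B2)) e1"
      "deg_lt x (Suc (B0 + B1 + B2)) e2" for x
      using deg_lt_mono[of x _ _ "Suc (B0 + B1 + B2)"] by (meson le_SucI le_add1 le_add2 order_trans)+
    then show ?thesis by (rule that)
  qed
  \<comment> \<open>There are k ^ (card T + 3) products of monomials, with all exponents below B. As
    B is at most (2 + 3 * E) * k, this choice of k makes k ^ (CARD('v) + 1) exceed the dimension B ^
    CARD('v), and a linear relation exists.\<close>
  define k where "k = Suc ((2 + 3 * E) ^ CARD('v))"
  define B where "B = Suc (k + 3 * (E * k))"
  define A where "A = Pi\<^sub>E T (\<lambda>_. {..<k})"
  define mon where "mon a = (\<Prod>t\<in>T. mvar t ^ a t)" for a :: "'v \<Rightarrow> nat"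
  define K where "K = A \<times> {..<k} \<times> {..<k} \<times> {..<k}"
  define f where "f q = mon (fst q) * e0 ^ fst (snd q) * e1 ^ fst (snd (snd q)) * e2 ^ snd (snd (snd q))" for q
  have fin: "finite A" unfolding A_def by (intro finite_PiE) auto
  have finK: "finite K" unfolding K_def using fin by auto
  have "card A = k ^ card T" unfolding A_def by (simp add: card_PiE)
  then have cardK: "card K = k ^ (card T + 3)"
    unfolding K_def by (simp add: card_cartesian_product power_add eval_nat_numeral)
  have "B \<le> (2 + 3 * E) * k" unfolding B_def k_def by (simp add: algebra_simps)
  then have "B ^ CARD('v) \<le> (2 + 3 * E) ^ CARD('v) * k ^ CARD('v)"
    unfolding power_mult_distrib[symmetric] by (intro power_mono) simp_all
  also have "\<dots> < k * k ^ CARD('v)" by (intro mult_strict_right_mono) (simp_all add: k_def)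
  also have "\<dots> = k ^ (CARD('v) + 1)" by simp
  also have "\<dots> \<le> k ^ (card T + 3)" using T by (intro power_increasing) (auto simp: k_def)
  finally have big: "B ^ CARD('v) < card K" unfolding cardK .
  have "lookup b x < B" if qK: "q \<in> K" and b: "b \<in> keys (f q)" for q b x
  proof -
    obtain a i j l where q: "q = (a, i, j, l)" "a \<in> A" "i < k" "j < k" "l < k"
      using qK unfolding K_def by auto
    have "deg_lt x (Suc k) (mon a)" unfolding mon_def
      using q(2) by (intro deg_lt_monomial) (auto simp: A_def)
    from deg_lt_mult[OF this deg_lt_power[OF E(1)], of i] have "deg_lt x (Suc (k + E * i)) (mon a * e0 ^ i)" by simp
    from deg_lt_mult[OF this deg_lt_power[OF E(2)], of j] have "deg_lt x (Suc (k + E * i + E * j)) (mon a * e0 ^ i * e1 ^ j)" by simp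
    from deg_lt_mult[OF this deg_lt_power[OF E(3)], of l]
    have "deg_lt x (Suc (k + E * i + E * j + E * l)) (f q)" unfolding f_def q(1) by simp
    moreover have "E * i \<le> E * k" "E * j \<le> E * k" "E * l \<le> E * k" using q by simp_all
    then have "Suc (k + E * i + E * j + E * l) \<le> B" unfolding B_def by linarith
    ultimately have "deg_lt x B (f q)" by (rule deg_lt_mono)
    then show ?thesis using b by (simp add: deg_lt_def)
  qed
  then obtain c' where c': "\<exists>q\<in>K. c' q \<noteq> 0" "(\<Sum>q\<in>K. mconst (c' q) * f q) = 0"
    using mpolys_dependent[OF finK big] by blast
  define c where "c a i j l = c' (a, i, j, l)" for a i j l
  define q where "q l j i = (\<Sum>a\<in>A. mconst (c a i j l) * mon a)" for l j i
  have rel: "(\<Sum>l<k. e2 ^ l * (\<Sum>j<k. e1 ^ j * (\<Sum>i<k. e0 ^ i * q l j i))) = 0"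
  proof -
    have "0 = (\<Sum>q\<in>K. mconst (c (fst q) (fst (snd q)) (fst (snd (snd q))) (snd (snd (snd q)))) * f q)"
      unfolding c'(2)[symmetric] c_def by simp
    also have "\<dots> = (\<Sum>l<k. \<Sum>j<k. \<Sum>i<k. \<Sum>a\<in>A. mconst (c a i j l) * (mon a * e0 ^ i * e1 ^ j * e2 ^ l))"
      unfolding K_def f_def by (rule sum_4_times[where g = "\<lambda>a i j l. mconst (c a i j l) * (mon a * e0 ^ i * e1 ^ j * e2 ^ l)"])
    also have "\<dots> = (\<Sum>l<k. e2 ^ l * (\<Sum>j<k. e1 ^ j * (\<Sum>i<k. e0 ^ i * q l j i)))"
      unfolding q_def sum_distrib_left by (intro sum.cong refl) (simp only: mult_ac)
    finally show ?thesis by simp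
  qed
  \<comment> \<open>The lexicographically least exponents (l0, j0, i0) carrying a nonzero
    coefficient. They locate the lowest coefficient in e2, then e1, then e0, as the relation
    descends from P3 to P0.\<close>
  define l0 where "l0 = (LEAST l. l < k \<and> (\<exists>j<k. \<exists>i<k. \<exists>a\<in>A. c a i j l \<noteq> 0))"
  have "\<exists>l. l < k \<and> (\<exists>j<k. \<exists>i<k. \<exists>a\<in>A. c a i j l \<noteq> 0)" using c'(1) unfolding K_def c_def by auto
  then have l0: "l0 < k \<and> (\<exists>j<k. \<exists>i<k. \<exists>a\<in>A. c a i j l0 \<noteq> 0)" unfolding l0_def by (rule LeastI_ex)
  have l0_min: "\<forall>j<k. \<forall>i<k. \<forall>a\<in>A. c a i j l = 0" if "l < l0" for l
    using not_less_Least[OF that[unfolded l0_def]] that l0 by (meson order.strict_trans)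
  define j0 where "j0 = (LEAST j. j < k \<and> (\<exists>i<k. \<exists>a\<in>A. c a i j l0 \<noteq> 0))"
  have j0: "j0 < k \<and> (\<exists>i<k. \<exists>a\<in>A. c a i j0 l0 \<noteq> 0)" unfolding j0_def by (rule LeastI_ex) (use l0 in blast)
  have j0_min: "\<forall>i<k. \<forall>a\<in>A. c a i j l0 = 0" if "j < j0" for j
    using not_less_Least[OF that[unfolded j0_def]] that j0 by (meson order.strict_trans)
  define i0 where "i0 = (LEAST i. i < k \<and> (\<exists>a\<in>A. c a i j0 l0 \<noteq> 0))"
  have i0: "i0 < k \<and> (\<exists>a\<in>A. c a i0 j0 l0 \<noteq> 0)" unfolding i0_def by (rule LeastI_ex) (use j0 in blast)
  have i0_min: "\<forall>a\<in>A. c a i j0 l0 = 0" if "i < i0" for i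
    using not_less_Least[OF that[unfolded i0_def]] that i0 by (meson order.strict_trans)
  have idl: "idl P0" "idl P1" "idl P2" "idl P3" using P by (auto simp: prime_idl_def)
  have "(\<Sum>j<k. e1 ^ j * (\<Sum>i<k. e0 ^ i * q l0 j i)) \<in> P2"
    using rel idlD(1)[OF idl(4)] l0 l0_min
    by (intro lowest_coefficient_in_prime[OF P(4) e(6) idl(3) sub(3) e(5), where k = k and m = l0
          and Q = "\<lambda>l. \<Sum>j<k. e1 ^ j * (\<Sum>i<k. e0 ^ i * q l j i)"])
      (auto simp: q_def intro!: sum.neutral)
  then have "(\<Sum>i<k. e0 ^ i * q l0 j0 i) \<in> P1"
    using j0 j0_min
    by (intro lowest_coefficient_in_prime[OF P(3) e(4) idl(2) sub(2) e(3), where k = k and m = j0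
          and Q = "\<lambda>j. \<Sum>i<k. e0 ^ i * q l0 j i"])
      (auto simp: q_def intro!: sum.neutral)
  then have in_P0: "q l0 j0 i0 \<in> P0"
    using i0 i0_min
    by (intro lowest_coefficient_in_prime[OF P(2) e(2) idl(1) sub(1) e(1), where k = k and m = i0
          and Q = "q l0 j0"])
      (auto simp: q_def intro!: sum.neutral)
  have "vars_in T (mon a)" for a
    unfolding mon_def by (intro vars_in_prod vars_in_power vars_in_mvar)
  then have "vars_in T (q l0 j0 i0)" unfolding q_def
    by (intro vars_in_sum vars_in_mult vars_in_mconst)
  moreover have "q l0 j0 i0 \<noteq> 0"
  proof
    define ex where "ex a = (\<Sum>t\<in>T. single t (a t))" for a :: "'v \<Rightarrow> nat"
    have mon: "mon a = single (ex a) 1" for a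
      unfolding mon_def ex_def mvar_power
      by (induction T rule: infinite_finite_induct) (simp_all add: mult_single)
    have lookup_ex: "lookup (ex a) t = (if t \<in> T then a t else 0)" for a t
      unfolding ex_def by (simp add: lookup_sum lookup_single when_def)
    have ex_inj: "ex a = ex b \<longleftrightarrow> a = b" if "a \<in> A" "b \<in> A" for a b
    proof
      assume eq: "ex a = ex b"
      show "a = b"
      proof (rule PiE_ext[OF that[unfolded A_def]])
        fix t assume "t \<in> T"
        then show "a t = b t" using lookup_ex[of a t] lookup_ex[of b t] eq by simp
      qed
    qed simp
    obtain a where a: "a \<in> A" "c a i0 j0 l0 \<noteq> 0" using i0 by blast
    assume "q l0 j0 i0 = 0"
    then have "0 = lookup (q l0 j0 i0) (ex a)" by simp
    also have "\<dots> = (\<Sum>b\<in>A. if b = a then c b i0 j0 l0 else 0)"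
      unfolding q_def lookup_sum lookup_mconst_mult mon
      using a ex_inj by (intro sum.cong) (auto simp: lookup_single when_def)
    also have "\<dots> = c a i0 j0 l0" using a fin by simp
    finally show False using a by simp
  qed
  ultimately show ?thesis using in_P0 unfolding meets_subring_def by blast
qed

text \<open>The nonzero polynomials in the variables T form a multiplicative set.\<close>

lemma ex_prime_idl_not_meeting:
  fixes I :: "'v::finite mpoly set"
  assumes "idl I" "\<not> meets_subring I T"
  obtains P where "prime_idl P" "I \<subseteq> P" "\<not> meets_subring P T"
proof -
  let ?M = "{p. p \<noteq> 0 \<and> vars_in T p}"
  have "I \<inter> ?M = {}" using assms(2) by (auto simp: meets_subring_def)
  moreover have "1 \<in> ?M" by simp
  moreover have "x * y \<in> ?M" if "x \<in> ?M" "y \<in> ?M" for x y using that by (auto intro: vars_in_mult)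
  ultimately have "\<exists>P. prime_idl P \<and> I \<subseteq> P \<and> P \<inter> ?M = {}"
    using ex_prime_idl_avoiding[OF assms(1), of ?M] by blast
  then obtain P where "prime_idl P" "I \<subseteq> P" "P \<inter> ?M = {}" by blast
  moreover then have "\<not> meets_subring P T" unfolding meets_subring_def by blast
  ultimately show ?thesis using that by blast
qed

text \<open>Otherwise a prime P over I also misses the polynomials in T. Its zero set lies in V and
  starts a chain of length three, whose vanishing ideals descend strictly from P; counting
  transcendence degrees then forces P to meet them.\<close>

lemma codim_3_meets_subring:
  fixes T :: "'v::finite set"
  assumes I: "idl I" "codim zariski V \<ge> 3"
    and V: "\<And>P. prime_idl P \<Longrightarrow> I \<subseteq> P \<Longrightarrow> zero_set P \<subseteq> V"
    and T: "CARD('v) \<le> card T + 2"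
  shows "meets_subring I T"
proof (rule ccontr)
  assume "\<not> meets_subring I T"
  then obtain P where P: "prime_idl P" "I \<subseteq> P" "\<not> meets_subring P T"
    using ex_prime_idl_not_meeting I by blast
  have "codim zariski V \<ge> enat 3" using I(2) by (simp add: numeral_eq_enat)
  then obtain C where C: "C 0 = zero_set P" "\<And>j. j \<le> 3 \<Longrightarrow> irreducible_closed zariski (C j)"
    "\<And>j. j < 3 \<Longrightarrow> C j \<subset> C (Suc j)"
  proof -
    from codim_chain[OF \<open>codim zariski V \<ge> enat 3\<close> irreducible_closed_zero_set[OF P(1)] V[OF P(1,2)]]
    show ?thesis using that by metis
  qed
  define J where "J j = vanishing_ideal (C j)" for j
  have prime: "prime_idl (J j)" if "j \<le> 3" for j
    unfolding J_def using prime_idl_vanishing_ideal C(2)[OF that] .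
  have sub: "J (Suc j) \<subseteq> J j" if "j < 3" for j
    using C(3)[OF that] unfolding J_def vanishing_ideal_def by blast
  have e: "\<exists>e. e \<in> J j \<and> e \<notin> J (Suc j)" if "j < 3" for j
    unfolding J_def using C(2)[of j] C(2)[of "Suc j"] C(3)[OF that] that
    by (intro vanishing_ideal_strict_antimono) (auto simp: irreducible_closed_def)
  obtain e0 where e0: "e0 \<in> J 0" "e0 \<notin> J (Suc 0)" using e[of 0] by auto
  obtain e1 where e1: "e1 \<in> J (Suc 0)" "e1 \<notin> J (Suc (Suc 0))" using e[of "Suc 0"] by auto
  obtain e2 where e2: "e2 \<in> J (Suc (Suc 0))" "e2 \<notin> J (Suc (Suc (Suc 0)))" using e[of "Suc (Suc 0)"] by auto
  have "meets_subring (J 0) T"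
    by (rule prime_chain_meets_subring[OF prime prime prime prime sub sub sub e0 e1 e2 T]) simp_all
  then show False using P(3) unfolding J_def C(1) vanishing_ideal_zero_set[OF P(1)] by simp
qed

section \<open>The class group and its character group\<close>

lemma lookup_character_divisor:
  "lookup (character_divisor v u) i = fst u * fst (v i) + snd u * snd (v i)"
proof -
  have "lookup (character_divisor v u) i =
    (\<Sum>x\<in>UNIV. if x = i then fst u * fst (v x) + snd u * snd (v x) else 0)"
    unfolding character_divisor_def lookup_sum by (intro sum.cong) auto
  then show ?thesis by simp
qed

lemma subgroup_character_divisors:
  "subgroup (range (character_divisor v)) (free_Abelian_group UNIV)"
proof (rule group.subgroupI[OF group_free_Abelian_group])
  show "range (character_divisor v) \<subseteq> carrier (free_Abelian_group UNIV)" by (simp add: free_Abelian_group_def)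
  show "range (character_divisor v) \<noteq> {}" by simp
  fix E assume "E \<in> range (character_divisor v)"
  then obtain u where u: "E = character_divisor v u" by blast
  have "- E = character_divisor v (- u)"
    unfolding u by (intro poly_mapping_eqI) (simp add: lookup_character_divisor)
  then show "inv\<^bsub>free_Abelian_group UNIV\<^esub> E \<in> range (character_divisor v)"
    by (simp add: inv_free_Abelian_group)
  fix E' assume "E' \<in> range (character_divisor v)"
  then obtain u' where u': "E' = character_divisor v u'" by blast
  have "E + E' = character_divisor v (u + u')"
    unfolding u u' by (intro poly_mapping_eqI) (simp add: lookup_character_divisor lookup_add algebra_simps)
  then show "E \<otimes>\<^bsub>free_Abelian_group UNIV\<^esub> E' \<in> range (character_divisor v)"
    by (simp add: free_Abelian_group_def)
qed

lemma normal_character_divisors: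
  "normal (range (character_divisor v)) (free_Abelian_group UNIV)"
proof -
  interpret comm_group "free_Abelian_group (UNIV :: 'a set)" by (rule abelian_free_Abelian_group)
  show ?thesis by (rule subgroup_imp_normal[OF subgroup_character_divisors])
qed

lemma group_class_group: "group (class_group v)"
  unfolding class_group_def by (rule normal.factorgroup_is_group[OF normal_character_divisors])

lemma carrier_class_group: "carrier (class_group v) = range (divisor_class v)"
  unfolding class_group_def divisor_class_def FactGroup_def RCOSETS_def by (auto simp: free_Abelian_group_def)

lemma divisor_class_add:
  "divisor_class v E \<otimes>\<^bsub>class_group v\<^esub> divisor_class v E' = divisor_class v (E + E')"
  unfolding class_group_def divisor_class_def
  using normal.rcos_sum[OF normal_character_divisors, of E E' v]
  by (simp add: FactGroup_def free_Abelian_group_def)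

lemma toric_group_hom:
  assumes "g \<in> toric_group v"
  shows "g (divisor_class v E) \<noteq> 0"
    and "g (divisor_class v (E + E')) = g (divisor_class v E) * g (divisor_class v E')"
    and "g (divisor_class v 0) = 1"
    and "g (divisor_class v (E - E')) = g (divisor_class v E) / g (divisor_class v E')"
proof -
  show nz: "g (divisor_class v E) \<noteq> 0" for E
    using assms unfolding toric_group_def hom_def complex_units_def carrier_class_group by auto
  show add: "g (divisor_class v (E + E')) = g (divisor_class v E) * g (divisor_class v E')" for E E'
    using assms unfolding toric_group_def hom_def complex_units_def carrier_class_group divisor_class_add[symmetric] by auto
  show "g (divisor_class v 0) = 1" using add[of 0 0] nz[of 0] by simp
  show "g (divisor_class v (E - E')) = g (divisor_class v E) / g (divisor_class v E')"
    using add[of "E - E'" E'] nz[of E'] by (simp add: field_simps)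
qed

lemma toric_groupI:
  assumes "\<And>E. g (divisor_class v E) \<noteq> 0"
    "\<And>E E'. g (divisor_class v (E + E')) = g (divisor_class v E) * g (divisor_class v E')"
  shows "g \<in> toric_group v"
  using assms unfolding toric_group_def hom_def complex_units_def carrier_class_group
  by (auto simp: divisor_class_add)

lemma toric_group_one: "(\<lambda>_. 1) \<in> toric_group v"
  by (rule toric_groupI) simp_all

lemma toric_group_monomial:
  assumes "g \<in> toric_group v"
  shows "g (divisor_class v (\<Sum>i\<in>UNIV. frag_cmul (int (a i)) (frag_of i))) =
    (\<Prod>i\<in>UNIV. g (prime_divisor_class v i) ^ a i)"
proof -
  have "g (divisor_class v (frag_cmul (int k) (frag_of i))) = g (prime_divisor_class v i) ^ k" for k i
  proof (induction k)
    case 0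
    show ?case using toric_group_hom(3)[OF assms] by simp
  next
    case (Suc k)
    have "frag_cmul (int (Suc k)) (frag_of i) = frag_of i + frag_cmul (int k) (frag_of i)"
      using frag_cmul_distrib[of 1 "int k" "frag_of i"] by simp
    then show ?case using Suc toric_group_hom(2)[OF assms] by simp
  qed
  moreover have "g (divisor_class v (\<Sum>i\<in>K. f i)) = (\<Prod>i\<in>K. g (divisor_class v (f i)))" for f and K :: "'a set"
    by (induction K rule: infinite_finite_induct) (simp_all add: toric_group_hom[OF assms])
  ultimately show ?thesis by simp
qed

definition torus_act :: "('m::finite \<Rightarrow> int \<times> int) \<Rightarrow> (('m \<Rightarrow>\<^sub>0 int) set \<Rightarrow> complex) \<Rightarrow> ('m \<Rightarrow> complex) \<Rightarrow> 'm \<Rightarrow> complex" where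
  "torus_act v g z = (\<lambda>i. g (prime_divisor_class v i) * z i)"

lemma toric_proj_eq: "toric_proj v z = {torus_act v g z | g. g \<in> toric_group v}"
  by (simp add: toric_proj_def torus_act_def)

lemma mem_toric_proj_self: "z \<in> toric_proj v z"
proof -
  have "z = torus_act v (\<lambda>_. 1) z" by (simp add: torus_act_def)
  then show ?thesis unfolding toric_proj_eq using toric_group_one by blast
qed

lemma toric_proj_torus_act:
  assumes g: "g \<in> toric_group v"
  shows "toric_proj v (torus_act v g z) = toric_proj v z"
proof -
  have mult: "(\<lambda>c. h c * k c) \<in> toric_group v" if "h \<in> toric_group v" "k \<in> toric_group v" for h k
    using that by (intro toric_groupI) (simp_all add: toric_group_hom)
  have inv: "(\<lambda>c. 1 / g c) \<in> toric_group v"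
    using g by (intro toric_groupI) (simp_all add: toric_group_hom)
  have sub: "toric_proj v (torus_act v h w) \<subseteq> toric_proj v w" if "h \<in> toric_group v" for h w
  proof
    fix x assume "x \<in> toric_proj v (torus_act v h w)"
    then obtain k where k: "x = torus_act v k (torus_act v h w)" "k \<in> toric_group v"
      unfolding toric_proj_eq by blast
    have "x = torus_act v (\<lambda>c. k c * h c) w" unfolding k torus_act_def by (simp add: mult.assoc)
    then show "x \<in> toric_proj v w" unfolding toric_proj_eq using mult[OF k(2) that] by blast
  qed
  have "torus_act v (\<lambda>c. 1 / g c) (torus_act v g z) = z"
    unfolding torus_act_def using toric_group_hom(1)[OF g] by simp
  then show ?thesis using sub[OF g, of z] sub[OF inv, of "torus_act v g z"] by simp
qed

lemma meval_torus_act: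
  assumes g: "g \<in> toric_group v" and p: "class_homogeneous v \<beta> p"
  shows "meval p (torus_act v g z) = g \<beta> * meval p z"
proof -
  have "lookup p a * (\<Prod>i\<in>UNIV. torus_act v g z i ^ lookup a i) =
    g \<beta> * (lookup p a * (\<Prod>i\<in>UNIV. z i ^ lookup a i))"
    if "a \<in> keys p" for a
    using toric_group_monomial[OF g, of "lookup a"] p that
    unfolding class_homogeneous_def torus_act_def by (simp add: power_mult_distrib prod.distrib mult_ac)
  then show ?thesis unfolding meval_def msubst_def sum_distrib_left by (intro sum.cong) auto
qed

text \<open>The composite of p with the action of g, needed as a polynomial so that invariant sets
  can be exhibited as zero sets.\<close>

definition torus_translate ::
  "('m::finite \<Rightarrow> int \<times> int) \<Rightarrow> (('m \<Rightarrow>\<^sub>0 int) set \<Rightarrow> complex) \<Rightarrow> 'm mpoly \<Rightarrow> 'm mpoly" where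
  "torus_translate v g = pullback (\<lambda>i. mconst (g (prime_divisor_class v i)) * mvar i)"

lemma meval_torus_translate: "meval (torus_translate v g p) z = meval p (torus_act v g z)"
  unfolding torus_translate_def meval_pullback torus_act_def poly_map_def by (simp add: meval_mult)

section \<open>Zeros of a form on the toric surface\<close>

lemma zero_set_ideal_gen: "zero_set (ideal_gen T) = zero_set T"
proof
  show "zero_set (ideal_gen T) \<subseteq> zero_set T" using ideal_gen_incl[of T] unfolding zero_set_def by blast
  have "ideal_gen T \<subseteq> vanishing_ideal (zero_set T)"
    by (rule ideal_gen_minimal[OF idl_vanishing_ideal]) (auto simp: vanishing_ideal_def zero_set_def)
  then show "zero_set T \<subseteq> zero_set (ideal_gen T)" unfolding vanishing_ideal_def zero_set_def by blast
qed

lemma not_in_irrelevant_locus: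
  "z \<notin> irrelevant_locus \<Sigma> v \<longleftrightarrow> (\<exists>\<sigma>\<in>\<Sigma>. \<forall>i. i \<notin> rays_of_cone v \<sigma> \<longrightarrow> z i \<noteq> 0)"
  unfolding irrelevant_locus_def irrelevant_ideal_def zero_set_ideal_gen
  by (auto simp: zero_set_def meval_simps)

lemma torus_act_irrelevant_locus:
  assumes "g \<in> toric_group v"
  shows "torus_act v g z \<in> irrelevant_locus \<Sigma> v \<longleftrightarrow> z \<in> irrelevant_locus \<Sigma> v"
  using not_in_irrelevant_locus[of "torus_act v g z" \<Sigma> v] not_in_irrelevant_locus[of z \<Sigma> v]
    toric_group_hom(1)[OF assms] unfolding torus_act_def by auto

lemma closedin_toric_variety:
  "closedin (toric_variety \<Sigma> v) C \<longleftrightarrow> C \<subseteq> toric_proj v ` (- irrelevant_locus \<Sigma> v) \<and>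
    (\<exists>T. {z \<in> - irrelevant_locus \<Sigma> v. toric_proj v z \<in> C} = zero_set T \<inter> - irrelevant_locus \<Sigma> v)"
proof -
  let ?\<Omega> = "- irrelevant_locus \<Sigma> v" and ?\<pi> = "toric_proj v"
  have top: "topspace (subtopology zariski ?\<Omega>) = ?\<Omega>" by simp
  have "closedin (toric_variety \<Sigma> v) C \<longleftrightarrow> C \<subseteq> ?\<pi> ` ?\<Omega> \<and>
      openin (subtopology zariski ?\<Omega>) {z \<in> ?\<Omega>. ?\<pi> z \<in> ?\<pi> ` ?\<Omega> - C}"
    unfolding closedin_def quotient_variety_def openin_quotient_topology topspace_quotient_topology top by blast
  also have "{z \<in> ?\<Omega>. ?\<pi> z \<in> ?\<pi> ` ?\<Omega> - C} = ?\<Omega> - {z \<in> ?\<Omega>. ?\<pi> z \<in> C}" by blast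
  also have "openin (subtopology zariski ?\<Omega>) (?\<Omega> - {z \<in> ?\<Omega>. ?\<pi> z \<in> C}) \<longleftrightarrow>
      closedin (subtopology zariski ?\<Omega>) {z \<in> ?\<Omega>. ?\<pi> z \<in> C}"
    unfolding closedin_def top by blast
  also have "\<dots> \<longleftrightarrow> (\<exists>T. {z \<in> ?\<Omega>. ?\<pi> z \<in> C} = zero_set T \<inter> ?\<Omega>)"
    unfolding closedin_subtopology closedin_zariski by blast
  finally show ?thesis .
qed

lemma irreducible_closedD:
  assumes "irreducible_closed T Y"
  shows "closedin T Y" and "closedin T A \<Longrightarrow> closedin T B \<Longrightarrow> Y \<subseteq> A \<union> B \<Longrightarrow> Y \<subseteq> A \<or> Y \<subseteq> B"
  using assms by (simp_all add: irreducible_closed_def)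

lemma closedin_toric_varietyE:
  assumes "closedin (toric_variety \<Sigma> v) C"
  obtains T where "\<And>z. z \<in> - irrelevant_locus \<Sigma> v \<Longrightarrow> toric_proj v z \<in> C \<longleftrightarrow> z \<in> zero_set T"
proof -
  from assms obtain T where
    "{z \<in> - irrelevant_locus \<Sigma> v. toric_proj v z \<in> C} = zero_set T \<inter> - irrelevant_locus \<Sigma> v"
    unfolding closedin_toric_variety by (elim conjE exE)
  then have "z \<in> - irrelevant_locus \<Sigma> v \<Longrightarrow> toric_proj v z \<in> C \<longleftrightarrow> z \<in> zero_set T" for z by blast
  then show ?thesis by (rule that)
qed

text \<open>The fibres of the projection are the orbits, so an invariant set is saturated and is the
  full preimage of its image.\<close>

lemma closedin_toric_variety_image:
  assumes "V \<subseteq> - irrelevant_locus \<Sigma> v" "V = zero_set T \<inter> - irrelevant_locus \<Sigma> v"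
    and "\<And>g z. g \<in> toric_group v \<Longrightarrow> z \<in> V \<Longrightarrow> torus_act v g z \<in> V"
  shows "closedin (toric_variety \<Sigma> v) (toric_proj v ` V)"
    and "\<And>z. toric_proj v z \<in> toric_proj v ` V \<Longrightarrow> z \<in> V"
proof -
  show *: "z \<in> V" if z: "toric_proj v z \<in> toric_proj v ` V" for z
  proof -
    obtain z' where z': "z' \<in> V" "toric_proj v z = toric_proj v z'" using z by blast
    then have "z \<in> toric_proj v z'" using mem_toric_proj_self[of z v] by simp
    then show ?thesis unfolding toric_proj_eq using assms(3) z'(1) by blast
  qed
  have "{z \<in> - irrelevant_locus \<Sigma> v. toric_proj v z \<in> toric_proj v ` V} = V" using * assms(1) by blast
  then show "closedin (toric_variety \<Sigma> v) (toric_proj v ` V)"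
    unfolding closedin_toric_variety using assms(1,2) by blast
qed

text \<open>A prime of height one is principal after inverting a leading coefficient.\<close>

lemma ex_pseudo_generator:
  fixes P :: "'v::finite mpoly set"
  assumes P: "prime_idl P" "\<not> meets_subring P T" "UNIV - {x} \<subseteq> T" and p: "p \<in> P" "p \<noteq> 0"
  obtains w c d w' where "w \<in> P" "w = c * mvar x ^ d + w'" "deg_lt x 1 c" "deg_lt x d w'" "c \<noteq> 0" "c \<notin> P" "d \<noteq> 0"
    "\<And>a. a \<in> P \<Longrightarrow> \<exists>k e. c ^ k * a = w * e"
proof -
  have idl: "idl P" using P by (simp add: prime_idl_def)
  let ?Q = "\<lambda>d. \<exists>w\<in>P. w \<noteq> 0 \<and> deg_lt x d w"
  \<comment> \<open>The least degree bound in x among the nonzero elements of P. A pseudo-remainder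
    modulo an element attaining it lies in P with smaller degree, hence vanishes.\<close>
  define D where "D = (LEAST d. ?Q d)"
  have "\<exists>d. ?Q d" using p ex_deg_lt by blast
  then have "?Q D" unfolding D_def by (rule LeastI_ex)
  then obtain w where w: "w \<in> P" "w \<noteq> 0" "deg_lt x D w" by blast
  obtain d c w' where lead: "w = c * mvar x ^ d + w'" "c \<noteq> 0" "deg_lt x 1 c" "deg_lt x d w'"
    by (rule leading_coefficient_nonzero[OF w(2), where x = x])
  have small: "\<rho> = 0" if "\<rho> \<in> P" "deg_lt x d \<rho>" for \<rho>
  proof (rule ccontr)
    assume "\<rho> \<noteq> 0"
    then have "D \<le> d" unfolding D_def using that by (intro Least_le) blast
    then show False using not_deg_lt[OF lead(2,4)] deg_lt_mono[OF w(3)] lead(1) by simp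
  qed
  have "vars_in UNIV c" by simp
  then have "vars_in T c" using vars_in_remove[OF _ lead(3)] vars_in_mono[OF _ P(3)] by blast
  then have cP: "c \<notin> P" using P(2) lead(2) unfolding meets_subring_def by blast
  have "d \<noteq> 0"
  proof
    assume "d = 0"
    then have "w = c" using lead by (simp add: deg_lt_zero_iff)
    then show False using w(1) cP by simp
  qed
  moreover have "\<exists>k e. c ^ k * a = w * e" if "a \<in> P" for a
  proof -
    obtain k e \<rho> where *: "c ^ k * a = w * e + \<rho>" "deg_lt x d \<rho>" using pseudo_division[OF lead(1,3,4)] by blast
    have "\<rho> = c ^ k * a - w * e" using *(1) by simp
    then have "\<rho> \<in> P" using that w(1) idl by (simp add: idlD)
    then have "\<rho> = 0" using small *(2) by simp
    then show ?thesis using *(1) by auto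
  qed
  ultimately show ?thesis using that w(1) lead cP by blast
qed

text \<open>As long as the cofactor lies in P, another factor w can be split off up to a power of c.
  Since d is positive, each division lowers the degree in x, so the process ends.\<close>

lemma ex_cofactor_not_in_prime:
  fixes P :: "'v::finite mpoly set"
  assumes w: "w = c * mvar x ^ d + w'" "deg_lt x 1 c" "deg_lt x d w'" "c \<noteq> 0" "d \<noteq> 0"
    and gen: "\<And>a. a \<in> P \<Longrightarrow> \<exists>k e. c ^ k * a = w * e" and "r \<noteq> 0"
  shows "\<exists>k j e. c ^ k * r = w ^ j * e \<and> e \<notin> P"
proof -
  have "deg_lt x n r \<Longrightarrow> r \<noteq> 0 \<Longrightarrow> \<exists>k j e. c ^ k * r = w ^ j * e \<and> e \<notin> P" for n
  proof (induction n arbitrary: r)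
    case 0
    then show ?case by (simp add: deg_lt_zero_iff)
  next
    case (Suc n)
    show ?case
    proof (cases "r \<in> P")
      case False
      then show ?thesis by (intro exI[of _ 0] exI[of _ r]) simp
    next
      case True
      then obtain k e where ke: "c ^ k * r = w * e" using gen by blast
      then have "e \<noteq> 0" using Suc.prems w(4) by auto
      have "deg_lt x (d + n) (w * e)"
        unfolding ke[symmetric] using w(5)
        by (intro deg_lt_mono[OF deg_lt_free_mult[OF free_power[OF w(2)] Suc.prems(1)]]) simp
      then have "deg_lt x n e" by (rule deg_lt_cofactor[OF w(1-4)])
      then obtain k' j e' where e': "c ^ k' * e = w ^ j * e'" "e' \<notin> P" using Suc.IH \<open>e \<noteq> 0\<close> by blast
      have "c ^ (k' + k) * r = c ^ k' * (c ^ k * r)" by (simp add: power_add mult.assoc)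
      also have "\<dots> = w * (c ^ k' * e)" unfolding ke by (simp add: mult.left_commute)
      also have "\<dots> = w ^ Suc j * e'" unfolding e' by (simp add: mult.assoc)
      finally show ?thesis using e'(2) by blast
    qed
  qed
  then show ?thesis using ex_deg_lt[of x r] assms(7) by blast
qed

text \<open>Otherwise the common zeros contain the closure \<open>Y\<close> of the image of a prime divisor \<open>W0\<close>, and \<open>Y\<close> has
  a proper irreducible enlargement \<open>C1\<close> other than the whole surface. An equation \<open>r\<close> of \<open>C1\<close>, divided by the
  equation \<open>w\<close> of \<open>W0\<close> as often as possible, vanishes on \<open>C1 - Y\<close> but not on \<open>Y\<close>, so that \<open>C1\<close> is reducible.\<close>

lemma toric_codim_2_meets_subring:
  fixes v :: "'m::finite \<Rightarrow> int \<times> int" and f :: "'i \<Rightarrow> 'm mpoly"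
  assumes rays: "primitive_ray_generators \<Sigma> v"
    and hom: "\<And>i. class_homogeneous v (\<beta> i) (f i)"
    and codim: "codim (toric_variety \<Sigma> v)
      (toric_proj v ` {z. z \<notin> irrelevant_locus \<Sigma> v \<and> (\<forall>i. meval (f i) z = 0)}) \<ge> 2"
    and nz: "f i0 \<noteq> 0" and T: "CARD('m) \<le> card T + 1"
  shows "meets_subring (ideal_gen (range f)) T"
proof (rule ccontr)
  let ?\<Omega> = "- irrelevant_locus \<Sigma> v" and ?\<pi> = "toric_proj v" and ?X = "toric_variety \<Sigma> v"
  assume no: "\<not> meets_subring (ideal_gen (range f)) T"
  then obtain P where P: "prime_idl P" "ideal_gen (range f) \<subseteq> P" "\<not> meets_subring P T"
    using ex_prime_idl_not_meeting[OF idl_ideal_gen] by blast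
  have idl: "idl P" using P by (simp add: prime_idl_def)
  have fP: "f i \<in> P" for i using P(2) ideal_gen_incl[of "range f"] by blast
  have "T \<noteq> UNIV" using P(3) fP[of i0] nz unfolding meets_subring_def by auto
  then obtain x where x: "x \<notin> T" by blast
  \<comment> \<open>By its size T omits only the variable x.\<close>
  have TX: "UNIV - {x} \<subseteq> T"
  proof
    fix y assume y: "y \<in> UNIV - {x}"
    show "y \<in> T"
    proof (rule ccontr)
      assume "y \<notin> T"
      then have "card T \<le> card (UNIV - {x, y})" using x by (intro card_mono) auto
      also have "\<dots> = CARD('m) - 2" using y by (subst card_Diff_subset) auto
      finally have "CARD('m) \<le> 1" using T by linarith
      moreover have "card {x, y} \<le> CARD('m)" by (intro card_mono) auto
      ultimately show False using y by simp
    qed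
  qed
  define W0 where "W0 = zero_set P \<inter> ?\<Omega>"
  have van: "s \<in> P" if s: "\<And>z. z \<in> W0 \<Longrightarrow> meval s z = 0" for s
  proof -
    \<comment> \<open>For the ray belonging to x, the monomial m involves only variables in T, so it
      is not in P. It vanishes on the irrelevant locus, and s * m therefore vanishes on all zeros of
      P.\<close>
    define \<sigma> where "\<sigma> = ray (v x)"
    have \<sigma>: "\<sigma> \<in> \<Sigma>" using rays unfolding primitive_ray_generators_def \<sigma>_def by auto
    have "x \<in> rays_of_cone v \<sigma>" unfolding rays_of_cone_def \<sigma>_def ray_def
      by (auto intro: face_of_refl convex_convex_cone_hull)
    define m where "m = (\<Prod>i\<in>- rays_of_cone v \<sigma>. mvar i :: 'm mpoly)"
    have "m \<notin> P"
    proof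
      assume "m \<in> P"
      then obtain k where k: "k \<notin> rays_of_cone v \<sigma>" "mvar k \<in> P"
        unfolding m_def using prime_idl_prod[OF P(1)] by blast
      have "k \<noteq> x" using k(1) \<open>x \<in> rays_of_cone v \<sigma>\<close> by metis
      then have "k \<in> T" using TX by auto
      then have "meets_subring P T" unfolding meets_subring_def
        using k(2) vars_in_mvar[of k T] by (intro bexI[of _ "mvar k"]) auto
      then show False using P(3) by contradiction
    qed
    have "meval (s * m) z = 0" if "\<forall>p\<in>P. meval p z = 0" for z
    proof (cases "z \<in> ?\<Omega>")
      case True
      then show ?thesis using s[of z] that by (simp add: W0_def zero_set_def meval_mult)
    next
      case False
      then have "meval m z = 0" using not_in_irrelevant_locus[of z \<Sigma> v] \<sigma>
        by (auto simp: m_def meval_simps)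
      then show ?thesis by (simp add: meval_mult)
    qed
    then have "s * m \<in> P" by (rule prime_idl_nullstellensatz[OF P(1)])
    then show ?thesis using P(1) \<open>m \<notin> P\<close> unfolding prime_idl_def by blast
  qed
  define S0 where "S0 = {z. z \<notin> irrelevant_locus \<Sigma> v \<and> (\<forall>i. meval (f i) z = 0)}"
  have S0_closed: "closedin ?X (?\<pi> ` S0)"
  proof (rule closedin_toric_variety_image(1)[where T = "range f"])
    show "S0 \<subseteq> ?\<Omega>" by (auto simp: S0_def)
    show "S0 = zero_set (range f) \<inter> ?\<Omega>" by (auto simp: S0_def zero_set_def)
    fix g z assume "g \<in> toric_group v" "z \<in> S0"
    then show "torus_act v g z \<in> S0"
      using torus_act_irrelevant_locus[of g v z \<Sigma>] meval_torus_act[OF _ hom, of g]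
      by (simp add: S0_def)
  qed
  have "W0 \<subseteq> S0" using fP unfolding W0_def S0_def zero_set_def by blast
  define Y where "Y = ?X closure_of (?\<pi> ` W0)"
  have top: "topspace ?X = ?\<pi> ` ?\<Omega>" by (simp add: quotient_variety_def topspace_quotient_topology)
  have W0Y: "?\<pi> ` W0 \<subseteq> Y" unfolding Y_def by (rule closure_of_subset) (auto simp: top W0_def)
  have Ymin: "Y \<subseteq> C" if "closedin ?X C" "?\<pi> ` W0 \<subseteq> C" for C
    unfolding Y_def using that by (intro closure_of_minimal)
  have Y: "irreducible_closed ?X Y" unfolding irreducible_closed_def
  proof (intro conjI allI impI)
    show "closedin ?X Y" unfolding Y_def by simp
    show "Y \<noteq> {}"
    proof
      assume "Y = {}"
      then have "W0 = {}" using W0Y by auto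
      then have "1 \<in> P" using van[of 1] by simp
      then show False using P(1) by (simp add: prime_idl_def)
    qed
    fix A B assume AB: "closedin ?X A \<and> closedin ?X B \<and> Y \<subseteq> A \<union> B"
    obtain S where S: "\<And>z. z \<in> ?\<Omega> \<Longrightarrow> ?\<pi> z \<in> A \<longleftrightarrow> z \<in> zero_set S"
      by (rule closedin_toric_varietyE[of \<Sigma> v A]) (use AB in auto)
    obtain R where R: "\<And>z. z \<in> ?\<Omega> \<Longrightarrow> ?\<pi> z \<in> B \<longleftrightarrow> z \<in> zero_set R"
      by (rule closedin_toric_varietyE[of \<Sigma> v B]) (use AB in auto)
    show "Y \<subseteq> A \<or> Y \<subseteq> B"
    proof (rule ccontr)
      assume "\<not> ?thesis"
      then have "\<not> ?\<pi> ` W0 \<subseteq> A" "\<not> ?\<pi> ` W0 \<subseteq> B" using Ymin AB by blast+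
      then obtain a b where ab: "a \<in> W0" "?\<pi> a \<notin> A" "b \<in> W0" "?\<pi> b \<notin> B" by blast
      then have "a \<notin> zero_set S" "b \<notin> zero_set R" using S R unfolding W0_def by blast+
      then obtain p q where pq: "p \<in> S" "meval p a \<noteq> 0" "q \<in> R" "meval q b \<noteq> 0" by (auto simp: zero_set_def)
      have "meval (p * q) z = 0" if "z \<in> W0" for z
      proof -
        have "?\<pi> z \<in> A \<or> ?\<pi> z \<in> B" "z \<in> ?\<Omega>" using W0Y AB that unfolding W0_def by blast+
        then have "z \<in> zero_set S \<or> z \<in> zero_set R" using S R by blast
        then show ?thesis using pq unfolding zero_set_def by (auto simp: meval_mult)
      qed
      then have "p * q \<in> P" by (rule van)
      then have "p \<in> P \<or> q \<in> P" using P(1) unfolding prime_idl_def by blast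
      then show False using pq ab unfolding W0_def zero_set_def by blast
    qed
  qed
  have "Y \<subseteq> ?\<pi> ` S0" by (rule Ymin[OF S0_closed]) (use \<open>W0 \<subseteq> S0\<close> in blast)
  moreover have "codim ?X (?\<pi> ` S0) \<ge> enat 2" using codim unfolding S0_def by (simp add: numeral_eq_enat)
  ultimately obtain C where C: "C 0 = Y" "\<And>j. j \<le> 2 \<Longrightarrow> irreducible_closed ?X (C j)" "\<And>j. j < 2 \<Longrightarrow> C j \<subset> C (Suc j)"
    using codim_chain[OF _ Y] by metis
  define C1 where "C1 = C 1"
  have C1: "irreducible_closed ?X C1" "Y \<subset> C1" "C1 \<subset> C 2"
    using C(1) C(2)[of 1] C(3)[of 0] C(3)[of 1] unfolding C1_def by (simp_all add: eval_nat_numeral)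
  have "closedin ?X (C 2)" using C(2)[of 2] by (simp add: irreducible_closed_def)
  then have "C 2 \<subseteq> ?\<pi> ` ?\<Omega>" using closedin_subset top by blast
  then obtain z1 where z1: "z1 \<in> ?\<Omega>" "?\<pi> z1 \<notin> C1" using C1(3) by blast
  have C1_closed: "closedin ?X C1" using C1(1) by (simp add: irreducible_closed_def)
  obtain Q where Q: "\<And>z. z \<in> ?\<Omega> \<Longrightarrow> ?\<pi> z \<in> C1 \<longleftrightarrow> z \<in> zero_set Q"
    by (rule closedin_toric_varietyE[of \<Sigma> v C1]) (use C1_closed in auto)
  then have "z1 \<notin> zero_set Q" using z1 by blast
  \<comment> \<open>An equation of C1 that is not identically zero; it exists because C1 misses the
    point z1.\<close>
  then obtain r where r: "r \<in> Q" "meval r z1 \<noteq> 0" by (auto simp: zero_set_def)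
  then have "r \<noteq> 0" by auto
  have rz: "meval r z = 0" if "z \<in> ?\<Omega>" "?\<pi> z \<in> C1" for z
    using Q r(1) that unfolding zero_set_def by blast
  obtain w c d w' where w: "w \<in> P" "w = c * mvar x ^ d + w'" "deg_lt x 1 c" "deg_lt x d w'" "c \<noteq> 0" "c \<notin> P" "d \<noteq> 0"
    and gen: "\<And>a. a \<in> P \<Longrightarrow> \<exists>k e. c ^ k * a = w * e"
    using ex_pseudo_generator[OF P(1,3) TX fP[of i0] nz] by metis
  obtain k j e where e: "c ^ k * r = w ^ j * e" "e \<notin> P"
    using ex_cofactor_not_in_prime[OF w(2-5,7) gen \<open>r \<noteq> 0\<close>] by blast
  \<comment> \<open>The factor c matters: where c is nonzero, the vanishing of w already forces all
    of P to vanish, that is, the point to lie in W0.\<close>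
  define s where "s = c * e"
  have sP: "s \<notin> P" using w(6) e(2) P(1) unfolding s_def prime_idl_def by blast
  have sz: "meval s z = 0" if z: "z \<in> ?\<Omega>" "?\<pi> z \<in> C1" "?\<pi> z \<notin> Y" for z
  proof (rule ccontr)
    assume "meval s z \<noteq> 0"
    then have ce: "meval c z \<noteq> 0" "meval e z \<noteq> 0" by (auto simp: s_def meval_mult)
    have "meval w z ^ j * meval e z = 0" using arg_cong[OF e(1), of "\<lambda>p. meval p z"] rz[OF z(1,2)]
      by (simp add: meval_simps)
    then have wz: "meval w z = 0" using ce by simp
    have "meval a z = 0" if a: "a \<in> P" for a
    proof -
      obtain l b where "c ^ l * a = w * b" using gen[OF a] by blast
      from arg_cong[OF this, of "\<lambda>p. meval p z"] show ?thesis using wz ce by (simp add: meval_simps)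
    qed
    then have "z \<in> W0" using z(1) by (simp add: W0_def zero_set_def)
    then show False using z(3) W0Y by blast
  qed
  \<comment> \<open>The polynomial s need not be homogeneous for the class grading, so all its
    translates are imposed; V is the largest invariant part of its zeros.\<close>
  define V where "V = {z \<in> ?\<Omega>. \<forall>g\<in>toric_group v. meval s (torus_act v g z) = 0}"
  have act2: "torus_act v g (torus_act v h z) = torus_act v (\<lambda>c. g c * h c) z" for g h z
    by (simp add: torus_act_def mult.assoc)
  have mult: "(\<lambda>c. h c * k c) \<in> toric_group v" if "h \<in> toric_group v" "k \<in> toric_group v" for h k
    using that by (intro toric_groupI) (simp_all add: toric_group_hom)
  have V: "V \<subseteq> ?\<Omega>" "V = zero_set ((\<lambda>g. torus_translate v g s) ` toric_group v) \<inter> ?\<Omega>"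
    "\<And>g z. g \<in> toric_group v \<Longrightarrow> z \<in> V \<Longrightarrow> torus_act v g z \<in> V"
    unfolding V_def zero_set_def by (auto simp: meval_torus_translate torus_act_irrelevant_locus act2 mult)
  have V_closed: "closedin ?X (?\<pi> ` V)" by (rule closedin_toric_variety_image(1)[OF V(1,2)]) (rule V(3))
  have V_sat: "z \<in> V" if "?\<pi> z \<in> ?\<pi> ` V" for z
    using that by (rule closedin_toric_variety_image(2)[OF V(1,2), rotated]) (rule V(3))
  have cover: "C1 \<subseteq> Y \<union> ?\<pi> ` V"
  proof
    fix q assume q: "q \<in> C1"
    have "C1 \<subseteq> ?\<pi> ` ?\<Omega>" using C1_closed closedin_subset top by blast
    then obtain z where z: "z \<in> ?\<Omega>" "q = ?\<pi> z" using q by blast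
    show "q \<in> Y \<union> ?\<pi> ` V"
    proof (cases "q \<in> Y")
      case False
      have "meval s (torus_act v g z) = 0" if "g \<in> toric_group v" for g
        using sz[of "torus_act v g z"] q False z that
        by (simp add: toric_proj_torus_act torus_act_irrelevant_locus)
      then have "z \<in> V" using z(1) by (simp add: V_def)
      then show ?thesis using z(2) by blast
    qed simp
  qed
  have "C1 \<subseteq> Y \<or> C1 \<subseteq> ?\<pi> ` V"
    by (rule irreducible_closedD(2)[OF C1(1) irreducible_closedD(1)[OF Y] V_closed cover])
  then have "C1 \<subseteq> ?\<pi> ` V" using C1(2) by blast
  have "meval s z = 0" if "z \<in> W0" for z
  proof -
    have "?\<pi> z \<in> ?\<pi> ` V" using that W0Y C1(2) \<open>C1 \<subseteq> ?\<pi> ` V\<close> by blast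
    then have "z \<in> V" by (rule V_sat)
    then have "meval s (torus_act v (\<lambda>_. 1) z) = 0" unfolding V_def using toric_group_one by blast
    then show ?thesis by (simp add: torus_act_def)
  qed
  then show False using van sP by blast
qed

section \<open>Degrees of a lifting\<close>

lemma meval_homogeneous:
  assumes "homogeneous d p"
  shows "meval p (\<lambda>j. c * x j) = c ^ d * meval p x"
proof -
  have "(\<Prod>i\<in>UNIV. (c * x i) ^ lookup a i) = c ^ d * (\<Prod>i\<in>UNIV. x i ^ lookup a i)"
    if "a \<in> keys p" for a
  proof -
    have "c ^ d = (\<Prod>i\<in>UNIV. c ^ lookup a i)"
      using assms that by (simp add: homogeneous_def mon_degree_def power_sum[symmetric])
    then show ?thesis by (simp add: power_mult_distrib prod.distrib)
  qed
  then show ?thesis unfolding meval_def msubst_def sum_distrib_left by (intro sum.cong) (auto simp: mult_ac)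
qed

text \<open>The vectors z and 2z define the same projective point, so F(2z) and F(z) lie in one
  orbit. At a z where no F i vanishes, the element moving one to the other must have coordinates 2 ^
  d i.\<close>

lemma lifting_degrees:
  fixes F :: "'m::finite \<Rightarrow> 'n::finite mpoly"
  assumes rays: "primitive_ray_generators \<Sigma> v" and rat: "rational_map \<Sigma> v U \<phi>"
    and lift: "complete_lifting \<Sigma> v U \<phi> F" and nz: "\<And>i. F i \<noteq> 0" and hom: "\<And>i. homogeneous (d i) (F i)"
  shows "\<exists>g\<in>toric_group v. \<forall>i. g (prime_divisor_class v i) = 2 ^ d i"
proof -
  have "openin proj_space U" "U \<noteq> {}" using rat by (auto simp: rational_map_def toric_morphism_def)
  then have U: "U \<subseteq> proj_point ` (- {\<lambda>_. 0})"
    "openin (subtopology zariski (- {\<lambda>_. 0})) {x \<in> - {\<lambda>_. 0}. proj_point x \<in> U}"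
    unfolding quotient_variety_def openin_quotient_topology by simp_all
  then obtain T where T: "{x \<in> - {\<lambda>_. 0}. proj_point x \<in> U} = - zero_set T \<inter> - {\<lambda>_. 0}"
    unfolding openin_subtopology openin_zariski by blast
  obtain x0 where "x0 \<noteq> (\<lambda>_. 0)" "proj_point x0 \<in> U" using U(1) \<open>U \<noteq> {}\<close> by blast
  then have "x0 \<notin> zero_set T" using T by blast
  then obtain t where t: "t \<in> T" "meval t x0 \<noteq> 0" by (auto simp: zero_set_def)
  obtain j :: 'n where True by simp
  \<comment> \<open>A single nonvanishing condition for three requirements: t puts the point into U,
    the F i are nonzero there, and the variable excludes the origin.\<close>
  have "t * (\<Prod>i\<in>UNIV. F i) * mvar j \<noteq> 0"
    using t(2) nz by (auto simp: mpoly_prod_eq_0_iff)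
  then obtain z where "meval (t * (\<Prod>i\<in>UNIV. F i) * mvar j) z \<noteq> 0" using ex_meval_nonzero by blast
  then have z: "meval t z \<noteq> 0" "\<And>i. meval (F i) z \<noteq> 0" "z j \<noteq> 0" by (auto simp: meval_simps)
  have good: "\<phi> (proj_point y) = toric_proj v (poly_map F y)"
    if y: "y \<noteq> (\<lambda>_. 0)" "proj_point y \<in> U" "\<And>i. meval (F i) y \<noteq> 0" for y
  proof -
    obtain i :: 'm where True by simp
    have "ray (v i) \<in> \<Sigma>" using rays unfolding primitive_ray_generators_def by auto
    then have "poly_map F y \<notin> irrelevant_locus \<Sigma> v"
      unfolding not_in_irrelevant_locus using y(3) by (auto simp: poly_map_def)
    then show ?thesis using lift y(1,2) unfolding complete_lifting_def by blast
  qed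
  have z0: "z \<noteq> (\<lambda>_. 0)" using z(3) by auto
  have zU: "proj_point z \<in> U" using T t(1) z(1) z0 unfolding zero_set_def by blast
  let ?y = "\<lambda>j. 2 * z j"
  have yz: "proj_point ?y = proj_point z" unfolding proj_point_def
  proof (intro Set.set_eqI iffI; elim CollectE exE conjE)
    fix x c assume "x = (\<lambda>j. c * (2 * z j))" "c \<noteq> (0::complex)"
    then show "x \<in> {\<lambda>j. c * z j | c. c \<noteq> 0}" by (intro CollectI exI[of _ "c * 2"]) (auto simp: mult.assoc)
  next
    fix x c assume "x = (\<lambda>j. c * z j)" "c \<noteq> (0::complex)"
    then show "x \<in> {\<lambda>j. c * (2 * z j) | c. c \<noteq> 0}" by (intro CollectI exI[of _ "c / 2"]) auto
  qed
  have Fy: "meval (F i) ?y = 2 ^ d i * meval (F i) z" for i by (rule meval_homogeneous[OF hom])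
  have "?y \<noteq> (\<lambda>_. 0)" using z(3) by (auto dest: fun_cong[of _ _ j])
  then have "toric_proj v (poly_map F ?y) = toric_proj v (poly_map F z)"
    using good[OF z0 zU z(2)] good[of ?y] zU z(2) yz Fy by simp
  then have "poly_map F ?y \<in> toric_proj v (poly_map F z)" using mem_toric_proj_self[of "poly_map F ?y" v] by simp
  then obtain g where g: "g \<in> toric_group v" "poly_map F ?y = torus_act v g (poly_map F z)"
    unfolding toric_proj_eq by blast
  have "g (prime_divisor_class v i) = 2 ^ d i" for i
    using fun_cong[OF g(2), of i] z(2)[of i] unfolding poly_map_def torus_act_def Fy by simp
  then show ?thesis using g(1) by blast
qed

text \<open>Each monomial of A i multiplied by z i has class \<D>. Evaluating g on that class gives
  2 to the weight, and powers of 2 determine their exponent.\<close>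

lemma reflexive_form_weights:
  assumes D: "\<D> \<in> carrier (class_group v)" and A: "A \<in> reflexive_one_forms v \<psi> \<D>"
    and g: "g \<in> toric_group v" "\<And>i. g (prime_divisor_class v i) = 2 ^ d i"
  shows "\<exists>\<delta>. \<forall>i. \<forall>a\<in>keys (A i). (\<Sum>k\<in>UNIV. lookup a k * d k) + d i = \<delta>"
proof -
  interpret group "class_group v" by (rule group_class_group)
  have eq: "2 ^ ((\<Sum>k\<in>UNIV. lookup a k * d k) + d i) = g \<D>" if a: "a \<in> keys (A i)" for i a
  proof -
    have cl: "prime_divisor_class v i \<in> carrier (class_group v)" by (simp add: carrier_class_group)
    have "divisor_class v (\<Sum>k\<in>UNIV. frag_cmul (int (lookup a k)) (frag_of k)) =
      \<D> \<otimes>\<^bsub>class_group v\<^esub> inv\<^bsub>class_group v\<^esub> prime_divisor_class v i" (is "?E = _")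
      using A a unfolding reflexive_one_forms_def class_homogeneous_def by blast
    then have "?E \<otimes>\<^bsub>class_group v\<^esub> prime_divisor_class v i = \<D>" using D cl by (simp add: m_assoc)
    then have "g \<D> = g (?E) * g (prime_divisor_class v i)"
      unfolding divisor_class_add using toric_group_hom(2)[OF g(1)] by metis
    also have "g ?E = (\<Prod>k\<in>UNIV. 2 ^ (lookup a k * d k))"
      unfolding toric_group_monomial[OF g(1)] g(2) by (simp add: power_mult[symmetric] mult.commute)
    finally show ?thesis by (simp add: g(2) power_add power_sum)
  qed
  show ?thesis
  proof (cases "\<exists>i a. a \<in> keys (A i)")
    case True
    then obtain i0 a0 where a0: "a0 \<in> keys (A i0)" by blast
    have "(\<Sum>k\<in>UNIV. lookup a k * d k) + d i = (\<Sum>k\<in>UNIV. lookup a0 k * d k) + d i0"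
      if "a \<in> keys (A i)" for i a
    proof -
      have "(2 :: complex) ^ ((\<Sum>k\<in>UNIV. lookup a k * d k) + d i) = 2 ^ ((\<Sum>k\<in>UNIV. lookup a0 k * d k) + d i0)"
        using eq[OF that] eq[OF a0] by simp
      from arg_cong[OF this, of norm] show ?thesis by (simp add: norm_power)
    qed
    then show ?thesis by blast
  qed blast
qed

section \<open>Minors of the Jacobian matrix\<close>

text \<open>Cramer's rule: \<open>ad i k\<close> is the determinant with row i replaced by the k-th
  unit vector. By linearity the sum puts row i' in place of row i, and a repeated row kills the
  determinant.\<close>

lemma ex_adjugate:
  fixes N :: "'a::comm_ring_1 ^ 'm ^ 'm"
  shows "\<exists>ad. \<forall>i i'. (\<Sum>k\<in>UNIV. N $ i' $ k * ad i k) = (if i = i' then det N else 0)"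
proof -
  define ad where "ad i k = det (\<chi> l. if l = i then axis k 1 else N $ l)" for i k
  have "(\<Sum>k\<in>UNIV. N $ i' $ k * ad i k) = (if i = i' then det N else 0)" for i i'
  proof -
    have "(\<Sum>k\<in>UNIV. N $ i' $ k *s axis k 1) = N $ i'"
      by (simp add: vec_eq_iff axis_def if_distrib[of "\<lambda>x. _ * x"] cong: if_cong)
    then have "(\<Sum>k\<in>UNIV. N $ i' $ k * ad i k) = det (\<chi> l. if l = i then N $ i' else N $ l)"
      unfolding ad_def det_row_mul[symmetric]
      by (subst det_linear_row_sum[symmetric]) (simp_all cong: if_cong)
    also have "\<dots> = (if i = i' then det N else 0)"
    proof (cases "i = i'")
      case True
      have "(\<chi> l. if l = i' then N $ i' else N $ l) = N" by (simp add: vec_eq_iff)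
      then show ?thesis using True by simp
    next
      case False
      then have "row i (\<chi> l. if l = i then N $ i' else N $ l) = row i' (\<chi> l. if l = i then N $ i' else N $ l)"
        by (simp add: row_def)
      then show ?thesis using False det_identical_rows[of i i'] by simp
    qed
    finally show ?thesis .
  qed
  then show ?thesis by blast
qed

text \<open>Exchange argument: starting from the identity matrix, unit rows are replaced by vectors
  c j one by one. Linearity of the determinant in that row always leaves a choice of j with nonzero
  determinant.\<close>

lemma ex_nonzero_minor:
  fixes c :: "'n::finite \<Rightarrow> 'a::comm_ring_1 ^ 'm"
  assumes "\<And>k. \<exists>w. (\<Sum>j\<in>UNIV. w j *s c j) = axis k 1"
  shows "\<exists>\<tau>. det (\<chi> k. c (\<tau> k)) \<noteq> 0"
proof -
  have "\<exists>\<tau>. det (\<chi> k. if k \<in> K then c (\<tau> k) else axis k 1) \<noteq> 0" if "finite K" for K :: "'m set"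
    using that
  proof (induction K rule: finite_induct)
    case empty
    have "(\<chi> k. axis k 1) = (mat 1 :: 'a ^ 'm ^ 'm)" by (simp add: vec_eq_iff axis_def mat_def)
    then show ?case by simp
  next
    case (insert k K)
    then obtain \<tau> where \<tau>: "det (\<chi> l. if l \<in> K then c (\<tau> l) else axis l 1) \<noteq> 0" by blast
    obtain w where w: "(\<Sum>j\<in>UNIV. w j *s c j) = axis k 1" using assms by blast
    define B where "B l = (if l \<in> K then c (\<tau> l) else axis l 1)" for l
    have "(\<chi> l. if l \<in> K then c (\<tau> l) else axis l 1) = (\<chi> l. if l = k then \<Sum>j\<in>UNIV. w j *s c j else B l)"
      unfolding w B_def using insert.hyps by (simp add: vec_eq_iff)
    then have "det (\<chi> l. if l \<in> K then c (\<tau> l) else axis l 1) = (\<Sum>j\<in>UNIV. w j * det (\<chi> l. if l = k then c j else B l))"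
      by (simp add: det_linear_row_sum[of UNIV k "\<lambda>i j. w j *s c j" B] det_row_mul)
    then obtain j where j: "det (\<chi> l. if l = k then c j else B l) \<noteq> 0"
      using \<tau> by (metis (no_types, lifting) mult_zero_right sum.neutral)
    have "(\<chi> l. if l \<in> insert k K then c ((\<tau>(k := j)) l) else axis l 1) = (\<chi> l. if l = k then c j else B l)"
      unfolding B_def by (simp add: vec_eq_iff)
    then have "det (\<chi> l. if l \<in> insert k K then c ((\<tau>(k := j)) l) else axis l 1) \<noteq> 0" using j by (simp only: not_False_eq_True)
    then show ?case by (intro exI[of _ "\<tau>(k := j)"])
  qed
  from this[of UNIV] show ?thesis by simp
qed

text \<open>The columns are chosen by an arbitrary function; repeated columns merely give
  zero.\<close>

definition jacobian_minor :: "('m::finite \<Rightarrow> 'n mpoly) \<Rightarrow> ('m \<Rightarrow> 'n) \<Rightarrow> 'n mpoly" where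
  "jacobian_minor F \<tau> = det (\<chi> i k. mderiv (\<tau> k) (F i))"

lemma critical_if_minors_vanish:
  fixes F :: "'m::finite \<Rightarrow> 'n::finite mpoly"
  assumes "\<And>\<tau>. meval (jacobian_minor F \<tau>) p = 0"
  shows "p \<in> critical_points F"
proof (rule ccontr)
  assume "p \<notin> critical_points F"
  then have surj: "surj (differential F p)" by (simp add: critical_points_def)
  define c where "c j = (\<chi> i. meval (mderiv j (F i)) p)" for j
  have "\<exists>w. (\<Sum>j\<in>UNIV. w j *s c j) = axis k 1" for k
  proof -
    obtain w where "differential F p w = (\<lambda>i. if i = k then 1 else 0)" using surj by (metis surjD)
    then have "(\<Sum>j\<in>UNIV. meval (mderiv j (F i)) p * w j) = (if i = k then 1 else 0)" for i
      unfolding differential_def by (rule fun_cong)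
    then have "(\<Sum>j\<in>UNIV. w j *s c j) = axis k 1"
      by (simp add: vec_eq_iff c_def axis_def mult.commute)
    then show ?thesis by blast
  qed
  then obtain \<tau> where \<tau>: "det (\<chi> k. c (\<tau> k)) \<noteq> 0" using ex_nonzero_minor by blast
  have "meval (jacobian_minor F \<tau>) p = det (\<chi> i k. meval (mderiv (\<tau> k) (F i)) p)"
    unfolding jacobian_minor_def by (simp add: rhom_det[OF rhom_meval])
  also have "\<dots> = det (transpose (\<chi> k. c (\<tau> k)))"
    by (rule arg_cong[of _ _ det]) (simp add: vec_eq_iff transpose_def c_def)
  finally show False using \<tau> assms by simp
qed

text \<open>A prime containing the squares contains the minors, so its zeros are critical points.
  Squares are the natural input because recovering a coefficient of d\<alpha> from d\<omega> uses
  Cramer's rule twice.\<close>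

lemma minors_meet_subring:
  fixes F :: "'m::finite \<Rightarrow> 'n::finite mpoly"
  assumes "idl I" "codim zariski (critical_points F) \<ge> 3"
    and "\<And>\<tau>. jacobian_minor F \<tau> ^ 2 \<in> I" and "CARD('n) \<le> card T + 2"
  shows "meets_subring I T"
proof (rule codim_3_meets_subring[OF assms(1,2) _ assms(4)])
  fix P assume P: "prime_idl P" "I \<subseteq> P"
  have "jacobian_minor F \<tau> \<in> P" for \<tau>
    using assms(3) P(2) prime_idl_power[OF P(1)] by blast
  then show "zero_set P \<subseteq> critical_points F"
    by (auto simp: zero_set_def intro!: critical_if_minors_vanish)
qed

section \<open>Pullbacks of integrable forms\<close>

lemma sum_option: "(\<Sum>x\<in>UNIV. f x) = f None + (\<Sum>y\<in>UNIV. f (Some (y :: 'y::finite)))"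
proof -
  have "(\<Sum>x\<in>UNIV. f x) = f None + (\<Sum>x\<in>range Some. f x)"
    unfolding UNIV_option_conv by (subst sum.insert) auto
  then show ?thesis by (simp add: sum.reindex)
qed

lemma extended_span_coordinate:
  "extended_span \<phi> Z u \<Longrightarrow> idl I \<Longrightarrow> (\<And>r. r \<in> Z \<Longrightarrow> \<phi> (r x) \<in> I) \<Longrightarrow> u x \<in> I"
  by (induction u rule: extended_span.induct) (auto intro: idlD)

text \<open>The relation \<phi>(p) * 1 = 0 would come from relations p * r = 0, which force r = 0
  and hence 1 = 0.\<close>

lemma flat_injective:
  assumes flat: "flat_ring_hom mpoly_ring mpoly_ring \<phi>" and hom: "rhom \<phi>" and p: "p \<noteq> (0 :: 'm::finite mpoly)"
  shows "\<phi> p \<noteq> (0 :: 'n mpoly)"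
proof
  assume "\<phi> p = 0"
  then have "(\<Sum>k\<in>{()}. \<phi> p * 1) = 0" by simp
  then obtain u where u: "extended_span \<phi> {r. (\<Sum>k\<in>{()}. p * r k) = 0} u" "u () = 1"
    using flat_equation[OF flat hom, of "{()}" "\<lambda>_. p" "\<lambda>_. 1"] by auto
  have "u () \<in> {0}"
    by (rule extended_span_coordinate[OF u(1)]) (use p in \<open>auto simp: idl_def rhom_simps[OF hom]\<close>)
  then show False using u(2) by simp
qed

text \<open>For the zero form J is the zero ideal while K is the whole ring.\<close>

lemma form_nonzero:
  assumes "form_ideal_J A = form_ideal_K A"
  shows "\<exists>i. A i \<noteq> 0"
proof (rule ccontr)
  assume "\<not> ?thesis"
  then have A: "A = (\<lambda>_. 0)" by auto
  have "1 \<in> form_ideal_K A"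
    unfolding form_ideal_K_def form_ideal_J_def ideal_colon_ideal_gen[OF idl_ideal_gen]
    by (auto simp: A ext_deriv1_def intro: idlD(1))
  then have "1 \<in> ideal_gen (range A)" using assms by (simp add: form_ideal_J_def)
  then have "1 \<in> {0 :: 'a mpoly}"
    by (rule subsetD[OF ideal_gen_minimal, rotated 2]) (auto simp: A idl_def)
  then show False by simp
qed

text \<open>The algebraic data for the division argument. \<open>J_meets\<close> says that the zeros
  of \<alpha> in affine space, irrelevant locus included, have codimension at least two.\<close>

locale integrable_pullback =
  fixes F :: "'m::finite \<Rightarrow> 'n::finite mpoly" and A :: "'m \<Rightarrow> 'm mpoly"
  assumes integrable: "\<And>i j k. wedge12 A (ext_deriv1 A) i j k = 0"
    and flat: "flat_ring_hom mpoly_ring mpoly_ring (pullback F)"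
    and J_eq_K: "form_ideal_J A = form_ideal_K A"
    and J_meets: "\<And>T. CARD('m) \<le> card T + 1 \<Longrightarrow> meets_subring (form_ideal_J A) T"
    and critical_codim: "codim zariski (critical_points F) \<ge> 3"
begin

definition a where "a i = pullback F (A i)"
definition b where "b i j = pullback F (ext_deriv1 A i j)"
definition \<omega> where "\<omega> = pullback_form F A"
definition I where "I = ideal_gen (range a)"

lemma I_iff: "x \<in> I \<longleftrightarrow> (\<exists>c. x = (\<Sum>i\<in>UNIV. c i * a i))"
  unfolding I_def ideal_gen_range by blast

lemma idl_I [simp]: "idl I" by (simp add: I_def)

lemma a_in_I [simp]: "a i \<in> I" unfolding I_def using ideal_gen_incl[of "range a"] by blast

lemma wedge: "a i * b j k - a j * b i k + a k * b i j = 0"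
  using arg_cong[OF integrable[of i j k], of "pullback F"] by (simp add: wedge12_def a_def b_def)

lemma wedge': "a i * b j k - a j * b i k = - b i j * a k"
  using wedge[of i j k] by (simp add: eq_neg_iff_add_eq_0 mult.commute)

lemma pullback_J: "p \<in> form_ideal_J A \<Longrightarrow> pullback F p \<in> I"
  unfolding form_ideal_J_def ideal_gen_range I_iff a_def by (auto simp: pullback_sum)

lemma a_nonzero: "\<exists>i. a i \<noteq> 0"
  using form_nonzero[OF J_eq_K] flat_injective[OF flat rhom_pullback] unfolding a_def by blast

lemma F_nonzero: "F i \<noteq> 0"
  using flat_injective[OF flat rhom_pullback, of "mvar i"] by simp

text \<open>The hypothesis is a linear system with pulled back coefficients, whose unknowns are s
  (index \<open>None\<close>) and the coefficients expressing each s * b i j through the a k. By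
  flatness it suffices that every solution over the Cox ring has its \<open>None\<close> coordinate
  in J, and this is the equality of J and K.\<close>

lemma colon_pullback:
  assumes "\<And>i j. s * b i j \<in> I"
  shows "s \<in> I"
proof -
  have "\<forall>i j. \<exists>t. s * b i j = (\<Sum>k\<in>UNIV. t k * a k)" using assms unfolding I_iff by blast
  then obtain t where t: "\<And>i j. s * b i j = (\<Sum>k\<in>UNIV. t i j k * a k)" by metis
  define u where "u x = (case x of None \<Rightarrow> s | Some (i, j, k) \<Rightarrow> t i j k)" for x :: "('m \<times> 'm \<times> 'm) option"
  define c where "c e x = (case x of None \<Rightarrow> ext_deriv1 A (fst e) (snd e) |
      Some (i, j, k) \<Rightarrow> if (i, j) = e then - A k else 0)" for e :: "'m \<times> 'm" and x :: "('m \<times> 'm \<times> 'm) option"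
  have sum3: "(\<Sum>y\<in>UNIV. case y of (i', j', k) \<Rightarrow> if (i', j') = (i, j) then f i' j' k else 0) = (\<Sum>k\<in>UNIV. f i j k)"
    for i j :: 'm and f :: "'m \<Rightarrow> 'm \<Rightarrow> 'm \<Rightarrow> 'z::comm_ring_1"
  proof -
    have "(\<Sum>y\<in>UNIV. case y of (i', j', k) \<Rightarrow> if (i', j') = (i, j) then f i' j' k else 0) =
      (\<Sum>y\<in>{i} \<times> {j} \<times> UNIV. case y of (i', j', k) \<Rightarrow> f i' j' k)"
      by (rule sum.mono_neutral_cong_right) (auto split: if_splits)
    then show ?thesis by (simp add: sum.cartesian_product[symmetric])
  qed
  have eqs: "(\<Sum>x\<in>UNIV. pullback F (c e x) * u x) = 0" for e
  proof (cases e)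
    case (Pair i j)
    have "(\<Sum>x\<in>UNIV. pullback F (c e x) * u x) = s * b i j +
      (\<Sum>y\<in>UNIV. case y of (i', j', k) \<Rightarrow> if (i', j') = (i, j) then - (t i' j' k * a k) else 0)"
      unfolding sum_option c_def u_def Pair
      by (intro arg_cong2[of _ _ _ _ "(+)"] sum.cong) (auto simp: b_def a_def)
    then show ?thesis unfolding sum3 t by (simp add: sum_negf)
  qed
  have "extended_span (pullback F) {r. \<forall>e\<in>UNIV. (\<Sum>x\<in>UNIV. c e x * r x) = 0} u"
    by (rule flat_system[OF flat rhom_pullback]) (use eqs in auto)
  then have "u None \<in> I"
  proof (rule extended_span_coordinate[OF _ idl_I])
    fix r assume "r \<in> {r. \<forall>e\<in>UNIV. (\<Sum>x\<in>UNIV. c e x * r x) = 0}"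
    then have r: "(\<Sum>x\<in>UNIV. c (i, j) x * r x) = 0" for i j by blast
    have "r None * ext_deriv1 A i j \<in> form_ideal_J A" for i j
    proof -
      have "(\<Sum>x\<in>UNIV. c (i, j) x * r x) = r None * ext_deriv1 A i j +
        (\<Sum>y\<in>UNIV. case y of (i', j', k) \<Rightarrow> if (i', j') = (i, j) then - (r (Some (i', j', k)) * A k) else 0)"
        unfolding sum_option c_def
        by (intro arg_cong2[of _ _ _ _ "(+)"] sum.cong) auto
      then have "r None * ext_deriv1 A i j = (\<Sum>k\<in>UNIV. r (Some (i, j, k)) * A k)"
        using r[of i j] unfolding sum3 by (simp add: sum_negf)
      then show ?thesis unfolding form_ideal_J_def ideal_gen_range
        by (intro CollectI exI[of _ "\<lambda>k. r (Some (i, j, k))"] conjI TrueI)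
    qed
    then have "r None \<in> form_ideal_K A"
      unfolding form_ideal_K_def form_ideal_J_def ideal_colon_ideal_gen[OF idl_ideal_gen] by blast
    then show "pullback F (r None) \<in> I" using pullback_J J_eq_K by simp
  qed
  then show ?thesis by (simp add: u_def)
qed

text \<open>The equations are linear in x with pulled back coefficients. Over the Cox ring their
  solutions are multiples of A because J has grade at least two, and flatness carries this
  over.\<close>

lemma proportional_a:
  assumes "\<And>i j. a i * x j = a j * x i"
  shows "\<exists>e. \<forall>i. x i = a i * e"
proof -
  define c where "c p k = (if k = snd p then A (fst p) else 0) - (if k = fst p then A (snd p) else 0)" for p k
  have sum_c: "(\<Sum>k\<in>UNIV. \<phi> (c (i, j) k) * y k) = \<phi> (A i) * y j - \<phi> (A j) * y i"
    if "rhom \<phi>" for \<phi> :: "'m mpoly \<Rightarrow> 'z::comm_ring_1" and y i j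
  proof -
    have "(\<Sum>k\<in>UNIV. \<phi> (c (i, j) k) * y k) =
      (\<Sum>k\<in>UNIV. (if k = j then \<phi> (A i) * y k else 0) - (if k = i then \<phi> (A j) * y k else 0))"
      by (intro sum.cong) (auto simp: c_def rhom_diff[OF that] rhom_simps[OF that] algebra_simps)
    then show ?thesis by (simp add: sum_subtractf)
  qed
  have "extended_span (pullback F) {r. \<forall>p\<in>UNIV. (\<Sum>k\<in>UNIV. c p k * r k) = 0} x"
  proof (rule flat_system[OF flat rhom_pullback])
    fix p :: "'m \<times> 'm"
    show "(\<Sum>k\<in>UNIV. pullback F (c p k) * x k) = 0"
      using sum_c[OF rhom_pullback, of F "fst p" "snd p" x] assms[of "fst p" "snd p"] by (simp add: a_def)
  qed simp
  then show ?thesis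
  proof (induction x rule: extended_span.induct)
    case zero
    show ?case by (rule exI[of _ 0]) simp
  next
    case (step u r w)
    then obtain e where e: "\<And>i. u i = a i * e" by blast
    have "A i * r j = A j * r i" for i j
      using step.hyps(2) sum_c[OF rhom_id, of i j r] by simp
    then obtain e' where e': "\<And>i. r i = A i * e'"
      using proportional_family[of A r] J_meets unfolding form_ideal_J_def by blast
    have "u i + pullback F (r i) * w = a i * (e + pullback F e' * w)" for i
      unfolding e e' by (simp add: a_def algebra_simps)
    then show ?case by blast
  qed
qed

section \<open>Cramer's rule for \<omega> and d\<omega>\<close>

lemma minor_adjugate:
  "\<exists>ad. \<forall>i i'. (\<Sum>k\<in>UNIV. mderiv (\<tau> k) (F i') * ad i k) = (if i = i' then jacobian_minor F \<tau> else 0)"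
  using ex_adjugate[of "\<chi> i k. mderiv (\<tau> k) (F i)"] unfolding jacobian_minor_def by auto

lemma omega_eq: "\<omega> j = (\<Sum>i\<in>UNIV. a i * mderiv j (F i))"
  by (simp add: \<omega>_def pullback_form_def a_def)

lemma d_omega_eq: "ext_deriv1 \<omega> j k = (\<Sum>i\<in>UNIV. \<Sum>i'\<in>UNIV. b i i' * mderiv j (F i) * mderiv k (F i'))"
  unfolding \<omega>_def b_def by (rule ext_deriv1_pullback_form)

lemma minor_times_a:
  assumes "\<And>i i'. (\<Sum>k\<in>UNIV. mderiv (\<tau> k) (F i') * ad i k) = (if i = i' then jacobian_minor F \<tau> else 0)"
  shows "(\<Sum>k\<in>UNIV. \<omega> (\<tau> k) * ad i k) = jacobian_minor F \<tau> * a i"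
proof -
  have "(\<Sum>k\<in>UNIV. \<omega> (\<tau> k) * ad i k) = (\<Sum>i'\<in>UNIV. a i' * (\<Sum>k\<in>UNIV. mderiv (\<tau> k) (F i') * ad i k))"
    unfolding omega_eq sum_distrib_left sum_distrib_right by (subst sum.swap) (simp add: mult.assoc)
  also have "\<dots> = (\<Sum>i'\<in>UNIV. if i' = i then a i' * jacobian_minor F \<tau> else 0)"
    unfolding assms by (intro sum.cong) auto
  finally show ?thesis by (simp add: mult.commute)
qed

text \<open>d\<omega> is \<Sum> b i i' dF i dF i'; contracting both arguments with adjugate vectors
  isolates one coefficient, and each contraction contributes one factor of the minor.\<close>

lemma minor_squared_times_b:
  assumes ad: "\<And>i i'. (\<Sum>k\<in>UNIV. mderiv (\<tau> k) (F i') * ad i k) = (if i = i' then jacobian_minor F \<tau> else 0)"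
  shows "(\<Sum>k\<in>UNIV. \<Sum>k'\<in>UNIV. ext_deriv1 \<omega> (\<tau> k) (\<tau> k') * ad i k * ad i' k') = jacobian_minor F \<tau> ^ 2 * b i i'"
proof -
  let ?D = "\<lambda>k i. mderiv (\<tau> k) (F i)"
  have pick: "(\<Sum>l\<in>UNIV. f l * (if i = l then c else 0)) = f i * c" for f and i :: 'm and c :: "'n mpoly"
    by (simp add: if_distrib[of "\<lambda>x. _ * x"] cong: if_cong)
  have "(\<Sum>k\<in>UNIV. \<Sum>k'\<in>UNIV. ext_deriv1 \<omega> (\<tau> k) (\<tau> k') * ad i k * ad i' k') =
    (\<Sum>k\<in>UNIV. \<Sum>k'\<in>UNIV. \<Sum>l\<in>UNIV. \<Sum>l'\<in>UNIV. b l l' * (?D k l * ad i k) * (?D k' l' * ad i' k'))"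
    unfolding d_omega_eq sum_distrib_right by (intro sum.cong refl) (simp only: mult_ac)
  also have "\<dots> = (\<Sum>k\<in>UNIV. \<Sum>l\<in>UNIV. \<Sum>k'\<in>UNIV. \<Sum>l'\<in>UNIV. b l l' * (?D k l * ad i k) * (?D k' l' * ad i' k'))"
    by (intro sum.cong refl sum.swap)
  also have "\<dots> = (\<Sum>l\<in>UNIV. \<Sum>k\<in>UNIV. \<Sum>k'\<in>UNIV. \<Sum>l'\<in>UNIV. b l l' * (?D k l * ad i k) * (?D k' l' * ad i' k'))"
    by (rule sum.swap)
  also have "\<dots> = (\<Sum>l\<in>UNIV. \<Sum>k\<in>UNIV. \<Sum>l'\<in>UNIV. \<Sum>k'\<in>UNIV. b l l' * (?D k l * ad i k) * (?D k' l' * ad i' k'))"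
    by (intro sum.cong refl sum.swap)
  also have "\<dots> = (\<Sum>l\<in>UNIV. \<Sum>l'\<in>UNIV. \<Sum>k\<in>UNIV. \<Sum>k'\<in>UNIV. b l l' * (?D k l * ad i k) * (?D k' l' * ad i' k'))"
    by (intro sum.cong refl sum.swap)
  also have "\<dots> = (\<Sum>l\<in>UNIV. \<Sum>l'\<in>UNIV. b l l' * (\<Sum>k\<in>UNIV. ?D k l * ad i k) * (\<Sum>k'\<in>UNIV. ?D k' l' * ad i' k'))"
    by (simp only: sum_distrib_left sum_distrib_right) (intro sum.cong refl sum.swap)
  also have "\<dots> = (\<Sum>l\<in>UNIV. b l i' * jacobian_minor F \<tau> * (if i = l then jacobian_minor F \<tau> else 0))"
    unfolding ad by (intro sum.cong refl) (subst pick, simp only: mult_ac)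
  also have "\<dots> = jacobian_minor F \<tau> ^ 2 * b i i'"
    by (subst pick) (simp only: power2_eq_square mult_ac)
  finally show ?thesis .
qed

text \<open>If the field n is tangent to \<alpha>, contracting \<alpha> \<and> d\<alpha> = 0 with n
  shows that \<alpha> wedged with the contraction of d\<alpha> vanishes, so that contraction is a
  multiple of \<alpha>.\<close>

lemma contraction_multiple:
  assumes "(\<Sum>k\<in>UNIV. a k * n k) = 0"
  shows "\<exists>e. \<forall>i. (\<Sum>k\<in>UNIV. b i k * n k) = a i * e"
proof (rule proportional_a)
  fix i j
  have "a i * (\<Sum>k\<in>UNIV. b j k * n k) - a j * (\<Sum>k\<in>UNIV. b i k * n k) =
    (\<Sum>k\<in>UNIV. (a i * b j k - a j * b i k) * n k)"
    by (simp add: sum_distrib_left sum_subtractf left_diff_distrib mult.assoc)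
  also have "\<dots> = (\<Sum>k\<in>UNIV. - b i j * (a k * n k))"
    unfolding wedge' by (simp add: mult.assoc)
  also have "\<dots> = 0" unfolding sum_distrib_left[symmetric] assms by simp
  finally show "a i * (\<Sum>k\<in>UNIV. b j k * n k) = a j * (\<Sum>k\<in>UNIV. b i k * n k)" by simp
qed

text \<open>Three elements of the annihilator of \<open>h\<close> modulo \<open>I\<close> that form a regular sequence after
  inverting \<open>C\<close> produce a form \<open>\<beta>\<close> with \<open>C h d\<alpha> = \<alpha> \<and> \<beta>\<close>.\<close>

lemma in_I_if_minors:
  assumes h: "\<And>\<tau>. jacobian_minor F \<tau> ^ 2 * h \<in> I"
  shows "h \<in> I"
proof (rule ccontr)
  assume "h \<notin> I"
  let ?Q = "{s. s * h \<in> I}"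
  have Q: "idl ?Q" by (auto simp: idl_def[of ?Q] distrib_right mult.assoc intro: idlD)
  have "1 \<notin> ?Q" using \<open>h \<notin> I\<close> by simp
  from ex_maximal_independent[OF Q this] obtain T where T: "\<not> meets_subring ?Q T"
    and alg: "\<And>x. x \<notin> T \<Longrightarrow> \<exists>w c d w'. w \<in> ?Q \<and> vars_in (insert x T) w \<and> w \<noteq> 0 \<and> w = c * mvar x ^ d + w' \<and>
       deg_lt x d w' \<and> c \<noteq> 0 \<and> vars_in T c" by blast
  have "\<not> CARD('n) \<le> card T + 2"
    using T minors_meet_subring[OF Q critical_codim] h by blast
  then have "3 \<le> card (- T)" by (simp add: Compl_eq_Diff_UNIV card_Diff_subset)
  then obtain S where S: "S \<subseteq> - T" "card S = 3" using obtain_subset_with_card_n by metis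
  then obtain p q o' where pqo: "p \<notin> T" "q \<notin> T" "o' \<notin> T" "p \<noteq> q" "p \<noteq> o'" "q \<noteq> o'"
    by (auto simp: card_3_iff)
  obtain w1 c1 d1 w1' where w1: "w1 \<in> ?Q" "vars_in (insert p T) w1" "w1 \<noteq> 0" "w1 = c1 * mvar p ^ d1 + w1'"
    "deg_lt p d1 w1'" "c1 \<noteq> 0" "vars_in T c1" using alg[OF pqo(1)] by blast
  obtain w2 c2 d2 w2' where w2: "w2 \<in> ?Q" "vars_in (insert q T) w2" "w2 \<noteq> 0" "w2 = c2 * mvar q ^ d2 + w2'"
    "deg_lt q d2 w2'" "c2 \<noteq> 0" "vars_in T c2" using alg[OF pqo(2)] by blast
  obtain w3 where w3: "w3 \<in> ?Q" "vars_in (insert o' T) w3" "w3 \<noteq> 0" using alg[OF pqo(3)] by blast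
  have free: "deg_lt p 1 c1" "deg_lt q 1 c2" "deg_lt p 1 w2" "deg_lt p 1 w3" "deg_lt q 1 w3"
    using vars_in_imp_free[OF w1(7)] vars_in_imp_free[OF w2(7)] vars_in_imp_free[OF w2(2)] vars_in_imp_free[OF w3(2)] pqo
    by auto
  obtain x1 where x1: "w1 * h = (\<Sum>k\<in>UNIV. x1 k * a k)" using w1(1) I_iff by blast
  obtain x2 where x2: "w2 * h = (\<Sum>k\<in>UNIV. x2 k * a k)" using w2(1) I_iff by blast
  obtain x3 where x3: "w3 * h = (\<Sum>k\<in>UNIV. x3 k * a k)" using w3(1) I_iff by blast
  \<comment> \<open>The contraction of d\<alpha> with the field x, up to sign.\<close>
  define X where "X x i = (\<Sum>k\<in>UNIV. b i k * x k)" for x i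
  have X_diff: "X (\<lambda>k. u * x k - u' * y k) i = u * X x i - u' * X y i" for u x u' y i
    unfolding X_def by (simp add: right_diff_distrib sum_subtractf sum_distrib_left mult.left_commute)
  \<comment> \<open>Both u' x and u y contract \<alpha> to u u' h, so their difference is tangent to
    \<alpha>.\<close>
  have syz: "\<exists>e. \<forall>i. u' * X x i - u * X y i = a i * e"
    if "u * h = (\<Sum>k\<in>UNIV. x k * a k)" "u' * h = (\<Sum>k\<in>UNIV. y k * a k)" for u u' x y
  proof -
    have "(\<Sum>k\<in>UNIV. a k * (u' * x k - u * y k)) = u' * (\<Sum>k\<in>UNIV. x k * a k) - u * (\<Sum>k\<in>UNIV. y k * a k)"
      by (simp add: right_diff_distrib sum_subtractf sum_distrib_left mult_ac)
    also have "\<dots> = 0" unfolding that[symmetric] by (simp add: mult_ac)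
    finally obtain e where e: "\<And>i. (\<Sum>k\<in>UNIV. b i k * (u' * x k - u * y k)) = a i * e"
      using contraction_multiple[of "\<lambda>k. u' * x k - u * y k"] by blast
    show ?thesis unfolding X_diff[symmetric] unfolding X_def e by blast
  qed
  obtain e12 where e12: "\<And>i. w2 * X x1 i - w1 * X x2 i = a i * e12" using syz[OF x1 x2] by blast
  obtain e13 where e13: "\<And>i. w3 * X x1 i - w1 * X x3 i = a i * e13" using syz[OF x1 x3] by blast
  obtain e23 where e23: "\<And>i. w3 * X x2 i - w2 * X x3 i = a i * e23" using syz[OF x2 x3] by blast
  \<comment> \<open>The Koszul relation among e12, e13, e23: multiplied by a i, all terms in X
    cancel in pairs, and some a i is nonzero.\<close>
  have "a i * (w3 * e12) = a i * (w1 * (- e23) + w2 * e13)" for i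
  proof -
    have "a i * (w3 * e12) - a i * (w1 * (- e23) + w2 * e13) = w3 * (a i * e12) - w2 * (a i * e13) + w1 * (a i * e23)"
      by (simp add: algebra_simps)
    also have "\<dots> = 0" unfolding e12[symmetric] e13[symmetric] e23[symmetric] by (simp add: algebra_simps)
    finally show ?thesis by simp
  qed
  then have cocycle: "w3 * e12 = w1 * (- e23) + w2 * e13" using a_nonzero by auto
  \<comment> \<open>This is where a third element is needed: regularity of w1, w2, w3 makes the
    cocycle a boundary, up to the leading coefficients.\<close>
  obtain k k' e e' where ee: "c1 ^ k * c2 ^ k' * e12 = w1 * e + w2 * e'"
    using regular_triple[OF w1(4) free(1) w1(5,6) w2(4) free(2) w2(5,6) free(3,4,5) w3(3) cocycle] by blast
  define C where "C = c1 ^ k * c2 ^ k'"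
  \<comment> \<open>Subtracting a i * e' makes w2 times the contraction divisible by w1; regularity
    of the pair then divides the corrected contraction itself by w1.\<close>
  have "\<exists>l \<beta>. c1 ^ l * (C * X x1 i - a i * e') = w1 * \<beta>" for i
  proof (rule regular_pair[OF w1(4) free(1) w1(5,6) free(3) w2(3)])
    have "w2 * (C * X x1 i - a i * e') - w1 * (C * X x2 i + a i * e) =
      C * (w2 * X x1 i - w1 * X x2 i) - a i * (w1 * e + w2 * e')" by (simp add: algebra_simps)
    also have "\<dots> = 0" unfolding e12 ee[symmetric] C_def by (simp add: mult_ac)
    finally show "w2 * (C * X x1 i - a i * e') = w1 * (C * X x2 i + a i * e)" by simp
  qed
  then obtain l \<beta>' where l: "\<And>i. c1 ^ l i * (C * X x1 i - a i * e') = w1 * \<beta>' i" by metis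
  \<comment> \<open>One exponent serving all i at once.\<close>
  define L where "L = (\<Sum>i\<in>UNIV. l i)"
  define \<beta> where "\<beta> i = c1 ^ (L - l i) * \<beta>' i" for i
  have \<beta>: "c1 ^ L * (C * X x1 i - a i * e') = w1 * \<beta> i" for i
  proof -
    have "l i \<le> L" unfolding L_def by (rule member_le_sum) auto
    then have "c1 ^ L = c1 ^ (L - l i) * c1 ^ l i" by (simp add: power_add[symmetric])
    then show ?thesis unfolding \<beta>_def using l[of i] by (simp add: mult.assoc mult.left_commute)
  qed
  \<comment> \<open>Contracting \<alpha> \<and> d\<alpha> = 0 with x1 expresses w1 * h * d\<alpha>
    as a wedge of \<alpha> with X x1. The correction a i * e' is parallel to \<alpha> and drops out,
    so that w1 can be cancelled.\<close>
  have "c1 ^ L * C * h * b i j \<in> I" for i j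
  proof -
    have "a j * X x1 i - a i * X x1 j = (\<Sum>k\<in>UNIV. (a j * b i k - a i * b j k) * x1 k)"
      unfolding X_def by (simp add: sum_distrib_left sum_subtractf left_diff_distrib mult.assoc)
    also have "\<dots> = (\<Sum>k\<in>UNIV. b i j * (x1 k * a k))"
    proof (intro sum.cong refl)
      fix k
      have "a j * b i k - a i * b j k = b i j * a k" using wedge'[of i j k] by (simp add: algebra_simps)
      then show "(a j * b i k - a i * b j k) * x1 k = b i j * (x1 k * a k)" by (simp add: mult_ac)
    qed
    also have "\<dots> = b i j * (w1 * h)" unfolding x1 sum_distrib_left ..
    finally have X: "a j * X x1 i - a i * X x1 j = b i j * (w1 * h)" .
    have "w1 * (a j * \<beta> i - a i * \<beta> j) = a j * (w1 * \<beta> i) - a i * (w1 * \<beta> j)" by (simp add: algebra_simps)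
    also have "\<dots> = c1 ^ L * C * (a j * X x1 i - a i * X x1 j)" unfolding \<beta>[symmetric] by (simp add: algebra_simps)
    also have "\<dots> = w1 * (c1 ^ L * C * h * b i j)" unfolding X by (simp add: mult_ac)
    finally have "c1 ^ L * C * h * b i j = a j * \<beta> i - a i * \<beta> j" using w1(3) by simp
    then show ?thesis by (simp add: idlD)
  qed
  then have "c1 ^ L * C * h \<in> I" by (rule colon_pullback)
  then have "c1 ^ L * C \<in> ?Q" by simp
  moreover have "c1 ^ L * C \<noteq> 0" using w1(6) w2(6) by (simp add: C_def)
  moreover have "vars_in T (c1 ^ L * C)" unfolding C_def using w1(7) w2(7) by (intro vars_in_mult vars_in_power)
  ultimately show False using T unfolding meets_subring_def by blast
qed

text \<open>Only divisibility by \<omega> of the right-hand side matters, since the coefficients of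
  \<omega> lie in I; so \<sigma> is arbitrary.\<close>

lemma unfolding_in_I:
  assumes "\<And>i j. h * ext_deriv1 \<omega> i j = wedge11 \<omega> \<sigma> i j"
  shows "h \<in> I"
proof (rule in_I_if_minors, rule colon_pullback)
  fix \<tau> i j
  obtain ad where ad: "\<And>i i'. (\<Sum>k\<in>UNIV. mderiv (\<tau> k) (F i') * ad i k) = (if i = i' then jacobian_minor F \<tau> else 0)"
    using minor_adjugate[of \<tau>] by blast
  have \<omega>I: "\<omega> j \<in> I" for j unfolding omega_eq by (intro idl_sum idlD(4)) simp_all
  have hI: "h * ext_deriv1 \<omega> k k' \<in> I" for k k'
    unfolding assms wedge11_def using \<omega>I by (intro idlD(6) idlD(4)) simp_all
  have "(\<Sum>k\<in>UNIV. \<Sum>k'\<in>UNIV. h * ext_deriv1 \<omega> (\<tau> k) (\<tau> k') * (ad i k * ad j k')) \<in> I"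
    by (intro idl_sum[OF idl_I] idlD(4)[OF idl_I hI])
  also have "(\<Sum>k\<in>UNIV. \<Sum>k'\<in>UNIV. h * ext_deriv1 \<omega> (\<tau> k) (\<tau> k') * (ad i k * ad j k')) =
    h * (\<Sum>k\<in>UNIV. \<Sum>k'\<in>UNIV. ext_deriv1 \<omega> (\<tau> k) (\<tau> k') * ad i k * ad j k')"
    by (simp add: sum_distrib_left mult.assoc)
  also have "\<dots> = jacobian_minor F \<tau> ^ 2 * h * b i j"
    unfolding minor_squared_times_b[OF ad] by (simp add: mult_ac)
  finally show "jacobian_minor F \<tau> ^ 2 * h * b i j \<in> I" .
qed

text \<open>If all minors vanished, the zero ideal would contain their squares and would have to
  contain a nonzero polynomial.\<close>

lemma ex_minor_nonzero: "\<exists>\<tau>. jacobian_minor F \<tau> \<noteq> 0"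
proof (rule ccontr)
  assume "\<not> ?thesis"
  then have "meets_subring {0 :: 'n mpoly} UNIV"
    by (intro minors_meet_subring[OF _ critical_codim]) (auto simp: idl_def)
  then show False by (simp add: meets_subring_def)
qed

lemma omega_nonzero: "\<exists>j. \<omega> j \<noteq> 0"
proof (rule ccontr)
  assume "\<not> ?thesis"
  then have z: "\<omega> j = 0" for j by simp
  obtain \<tau> where \<tau>: "jacobian_minor F \<tau> \<noteq> 0" using ex_minor_nonzero by blast
  obtain i where i: "a i \<noteq> 0" using a_nonzero by blast
  obtain ad where ad: "\<And>i i'. (\<Sum>k\<in>UNIV. mderiv (\<tau> k) (F i') * ad i k) = (if i = i' then jacobian_minor F \<tau> else 0)"
    using minor_adjugate[of \<tau>] by blast
  show False using minor_times_a[OF ad, of i] \<tau> i by (simp add: z)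
qed

text \<open>The division is done twice. For fixed \<tau>, Cramer's rule turns proportionality to
  \<omega> into proportionality to the a i, giving a multiplier for the minor times \<theta>. These
  multipliers are proportional to the minors, which have grade at least two, so the minors can be
  divided out.\<close>

lemma proportional_omega:
  assumes \<theta>: "\<And>j k. \<omega> j * \<theta> k = \<omega> k * \<theta> j"
  shows "\<exists>c. \<forall>j. \<theta> j = \<omega> j * c"
proof -
  obtain j0 where j0: "\<omega> j0 \<noteq> 0" using omega_nonzero by blast
  obtain i0 where i0: "a i0 \<noteq> 0" using a_nonzero by blast
  let ?\<Delta> = "jacobian_minor F"
  have "\<exists>c. \<forall>j. ?\<Delta> \<tau> * \<theta> j = c * \<omega> j" for \<tau>
  proof -
    obtain ad where ad: "\<And>i i'. (\<Sum>k\<in>UNIV. mderiv (\<tau> k) (F i') * ad i k) = (if i = i' then ?\<Delta> \<tau> else 0)"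
      using minor_adjugate[of \<tau>] by blast
    define y where "y i = (\<Sum>k\<in>UNIV. \<theta> (\<tau> k) * ad i k)" for i
    have y: "?\<Delta> \<tau> * a i * \<theta> j = y i * \<omega> j" for i j
      unfolding minor_times_a[OF ad, symmetric] y_def sum_distrib_right
    proof (rule sum.cong[OF refl])
      fix k
      have "\<omega> (\<tau> k) * ad i k * \<theta> j = ad i k * (\<omega> (\<tau> k) * \<theta> j)" by (simp only: mult_ac)
      then show "\<omega> (\<tau> k) * ad i k * \<theta> j = \<theta> (\<tau> k) * ad i k * \<omega> j"
        unfolding \<theta>[of "\<tau> k" j] by (simp only: mult_ac)
    qed
    have "a i * y i' = a i' * y i" for i i'
    proof -
      have "\<omega> j0 * (a i * y i') = a i * (?\<Delta> \<tau> * a i' * \<theta> j0)" unfolding y by (simp add: mult_ac)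
      also have "\<dots> = a i' * (?\<Delta> \<tau> * a i * \<theta> j0)" by (simp add: mult_ac)
      also have "\<dots> = \<omega> j0 * (a i' * y i)" unfolding y by (simp add: mult_ac)
      finally show ?thesis using j0 by simp
    qed
    then obtain c where c: "\<And>i. y i = a i * c" using proportional_a by blast
    have "a i0 * (?\<Delta> \<tau> * \<theta> j) = a i0 * (c * \<omega> j)" for j
      using y[of i0 j] unfolding c by (simp add: mult_ac)
    then show ?thesis using i0 by auto
  qed
  then obtain c where c: "\<And>\<tau> j. ?\<Delta> \<tau> * \<theta> j = c \<tau> * \<omega> j" by metis
  have "?\<Delta> \<tau> * c \<tau>' = ?\<Delta> \<tau>' * c \<tau>" for \<tau> \<tau>'
  proof -
    have "\<omega> j0 * (?\<Delta> \<tau> * c \<tau>') = ?\<Delta> \<tau> * (?\<Delta> \<tau>' * \<theta> j0)" unfolding c by (simp add: mult_ac)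
    also have "\<dots> = ?\<Delta> \<tau>' * (?\<Delta> \<tau> * \<theta> j0)" by (simp add: mult_ac)
    also have "\<dots> = \<omega> j0 * (?\<Delta> \<tau>' * c \<tau>)" unfolding c by (simp add: mult_ac)
    finally show ?thesis using j0 by simp
  qed
  moreover have "meets_subring (ideal_gen (range ?\<Delta>)) T" if "CARD('n) \<le> card T + 1" for T
  proof (rule minors_meet_subring[OF idl_ideal_gen critical_codim])
    show "?\<Delta> \<tau> ^ 2 \<in> ideal_gen (range ?\<Delta>)" for \<tau>
      unfolding power2_eq_square using ideal_gen_incl[of "range ?\<Delta>"] by (intro idlD(3)) auto
  qed (use that in simp)
  ultimately obtain e where e: "\<And>\<tau>. c \<tau> = ?\<Delta> \<tau> * e" using proportional_family[of ?\<Delta> c] by blast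
  obtain \<tau> where \<tau>: "?\<Delta> \<tau> \<noteq> 0" using ex_minor_nonzero by blast
  have "?\<Delta> \<tau> * \<theta> j = ?\<Delta> \<tau> * (\<omega> j * e)" for j unfolding c e by (simp add: mult_ac)
  then show ?thesis using \<tau> by auto
qed

text \<open>The coefficient of \<epsilon> in (F + \<epsilon> G)^* \<alpha>: a Lie derivative of
  \<alpha> along the field G on F.\<close>

definition perturbation where
  "perturbation G j = (\<Sum>i\<in>UNIV. (\<Sum>k\<in>UNIV. pullback F (mderiv k (A i)) * G k) * mderiv j (F i) + a i * mderiv j (G i))"

text \<open>Cartan's formula along F: subtracting the differential of the contraction of \<alpha>
  with G leaves the contraction of d\<alpha> with G.\<close>

lemma perturbation_minus_dh:
  "perturbation G j - mderiv j (\<Sum>i\<in>UNIV. a i * G i) = (\<Sum>i\<in>UNIV. (\<Sum>k\<in>UNIV. b k i * G k) * mderiv j (F i))"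
proof -
  have "(\<Sum>i\<in>UNIV. mderiv j (a i) * G i) = (\<Sum>i\<in>UNIV. \<Sum>k\<in>UNIV. pullback F (mderiv k (A i)) * mderiv j (F k) * G i)"
    unfolding a_def mderiv_pullback sum_distrib_right ..
  also have "\<dots> = (\<Sum>i\<in>UNIV. (\<Sum>k\<in>UNIV. pullback F (mderiv i (A k)) * G k) * mderiv j (F i))"
    unfolding sum_distrib_right by (subst sum.swap) (simp only: mult_ac)
  finally have *: "(\<Sum>i\<in>UNIV. mderiv j (a i) * G i) = (\<Sum>i\<in>UNIV. (\<Sum>k\<in>UNIV. pullback F (mderiv i (A k)) * G k) * mderiv j (F i))" .
  have "perturbation G j - mderiv j (\<Sum>i\<in>UNIV. a i * G i) =
    (\<Sum>i\<in>UNIV. (\<Sum>k\<in>UNIV. pullback F (mderiv k (A i)) * G k) * mderiv j (F i)) - (\<Sum>i\<in>UNIV. mderiv j (a i) * G i)"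
    unfolding perturbation_def by (simp add: mderiv_sum mderiv_mult sum.distrib)
  then show ?thesis unfolding * b_def ext_deriv1_def
    by (simp add: sum_subtractf left_diff_distrib)
qed

text \<open>Contracting \<alpha> \<and> d\<alpha> = 0 with G gives h d\<alpha> as the wedge of
  \<alpha> with the contraction of d\<alpha>; this is then pulled back.\<close>

lemma perturbation_unfolding:
  fixes G
  defines "h \<equiv> \<Sum>i\<in>UNIV. a i * G i"
  shows "h * ext_deriv1 \<omega> j k = wedge11 \<omega> (\<lambda>k. perturbation G k - mderiv k h) j k"
proof -
  define g where "g i = (\<Sum>l\<in>UNIV. b l i * G l)" for i
  have \<theta>: "perturbation G j - mderiv j h = (\<Sum>i\<in>UNIV. g i * mderiv j (F i))" for j
    unfolding h_def g_def by (rule perturbation_minus_dh)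
  have g: "a i * g i' - a i' * g i = h * b i i'" for i i'
  proof -
    have "a i * g i' - a i' * g i = (\<Sum>l\<in>UNIV. (a i * b l i' - a i' * b l i) * G l)"
      unfolding g_def by (simp add: sum_distrib_left sum_subtractf left_diff_distrib mult.assoc)
    also have "\<dots> = (\<Sum>l\<in>UNIV. a l * G l * b i i')"
    proof (intro sum.cong refl)
      fix l
      have "a i * b l i' - a i' * b l i = a l * b i i'" using wedge[of l i i'] by (simp add: algebra_simps)
      then show "(a i * b l i' - a i' * b l i) * G l = a l * G l * b i i'" by (simp add: mult_ac)
    qed
    finally show ?thesis unfolding h_def sum_distrib_right .
  qed
  have "wedge11 \<omega> (\<lambda>k. perturbation G k - mderiv k h) j k =
    (\<Sum>i\<in>UNIV. \<Sum>i'\<in>UNIV. a i * mderiv j (F i) * (g i' * mderiv k (F i'))) -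
    (\<Sum>i\<in>UNIV. \<Sum>i'\<in>UNIV. a i * mderiv k (F i) * (g i' * mderiv j (F i')))"
    unfolding wedge11_def \<theta> omega_eq sum_product ..
  also have "(\<Sum>i\<in>UNIV. \<Sum>i'\<in>UNIV. a i * mderiv k (F i) * (g i' * mderiv j (F i'))) =
    (\<Sum>i\<in>UNIV. \<Sum>i'\<in>UNIV. a i' * mderiv k (F i') * (g i * mderiv j (F i)))" by (rule sum.swap)
  also have "(\<Sum>i\<in>UNIV. \<Sum>i'\<in>UNIV. a i * mderiv j (F i) * (g i' * mderiv k (F i'))) - \<dots> =
    (\<Sum>i\<in>UNIV. \<Sum>i'\<in>UNIV. (a i * g i' - a i' * g i) * (mderiv j (F i) * mderiv k (F i')))"
    unfolding sum_subtractf[symmetric] by (intro sum.cong refl) (simp add: algebra_simps)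
  also have "\<dots> = h * ext_deriv1 \<omega> j k"
    unfolding g d_omega_eq sum_distrib_left by (intro sum.cong refl) (simp only: mult_ac)
  finally show ?thesis by simp
qed

end

section \<open>Homogeneous components\<close>

text \<open>\<open>codegree s e p\<close>: the monomials of \<open>p\<close> have degree \<open>e - s\<close>, without truncated subtraction.\<close>

definition codegree :: "nat \<Rightarrow> nat \<Rightarrow> 'v::finite mpoly \<Rightarrow> bool" where
  "codegree s e p \<longleftrightarrow> (\<forall>a\<in>keys p. mon_degree a + s = e)"

lemma mon_degree_add: "mon_degree (a + b) = mon_degree a + mon_degree b"
  by (simp add: mon_degree_def lookup_add sum.distrib)

lemma homogeneous_iff_codegree: "homogeneous d p \<longleftrightarrow> codegree 0 d p"
  by (simp add: homogeneous_def codegree_def)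

lemma codegree_0 [simp]: "codegree s e 0"
  by (simp add: codegree_def)

lemma codegree_add: "codegree s e p \<Longrightarrow> codegree s e q \<Longrightarrow> codegree s e (p + q)"
  unfolding codegree_def by (metis keys_add_cases)

lemma codegree_uminus: "codegree s e p \<Longrightarrow> codegree s e (- p)"
  unfolding codegree_def by simp

lemma codegree_diff: "codegree s e p \<Longrightarrow> codegree s e q \<Longrightarrow> codegree s e (p - q)"
  using codegree_add[of s e p "- q"] codegree_uminus[of s e q] by simp

lemma codegree_sum: "(\<And>k. k \<in> K \<Longrightarrow> codegree s e (f k)) \<Longrightarrow> codegree s e (sum f K)"
  by (induction K rule: infinite_finite_induct) (auto intro: codegree_add)

text \<open>The degrees e - (s + d) and d - t add up to e - (s + t); the intermediate d is at the
  caller's choice.\<close>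

lemma codegree_mult: "codegree (s + d) e p \<Longrightarrow> codegree t d q \<Longrightarrow> codegree (s + t) e (p * q)"
  unfolding codegree_def
proof
  fix a assume *: "\<forall>a\<in>keys p. mon_degree a + (s + d) = e"
    "\<forall>a\<in>keys q. mon_degree a + t = d" "a \<in> keys (p * q)"
  obtain b c where "b \<in> keys p" "c \<in> keys q" "a = b + c"
    using keys_mult_cases[OF *(3)] .
  then show "mon_degree a + (s + t) = e" using *(1,2) by (fastforce simp: mon_degree_add)
qed

lemma homogeneous_mult: "homogeneous d p \<Longrightarrow> homogeneous e q \<Longrightarrow> homogeneous (d + e) (p * q)"
  unfolding homogeneous_def
proof
  fix a assume *: "\<forall>a\<in>keys p. mon_degree a = d"
    "\<forall>a\<in>keys q. mon_degree a = e" "a \<in> keys (p * q)"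
  obtain b c where "b \<in> keys p" "c \<in> keys q" "a = b + c"
    using keys_mult_cases[OF *(3)] .
  then show "mon_degree a = d + e" using *(1,2) by (simp add: mon_degree_add)
qed

lemma homogeneous_mconst [simp]: "homogeneous 0 (mconst c)"
  unfolding homogeneous_def mconst_def by (auto simp: mon_degree_def)

lemma homogeneous_power: "homogeneous d p \<Longrightarrow> homogeneous (k * d) (p ^ k)"
proof (induction k)
  case 0
  show ?case using homogeneous_mconst[of 1] by simp
next
  case (Suc k)
  then show ?case using homogeneous_mult[of d p "k * d" "p ^ k"] by simp
qed

lemma homogeneous_prod:
  "(\<And>i. i \<in> K \<Longrightarrow> homogeneous (d i) (f i)) \<Longrightarrow> homogeneous (sum d K) (prod f K)"
proof (induction K rule: infinite_finite_induct)
  case (insert x K)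
  then show ?case using homogeneous_mult[of "d x" "f x" "sum d K" "prod f K"] by simp
qed (use homogeneous_mconst[of 1] in auto)

lemma homogeneous_mdegree:
  assumes "homogeneous d p" "p \<noteq> 0"
  shows "mdegree p = d"
proof -
  have "keys p \<noteq> {}" using assms(2) by simp
  moreover have "mon_degree ` keys p = (\<lambda>_. d) ` keys p"
    using assms(1) by (intro image_cong) (auto simp: homogeneous_def)
  ultimately have "mon_degree ` keys p = {d}" by (simp add: image_constant_conv)
  then show ?thesis using assms(2) by (simp add: mdegree_def)
qed

lemma codegree_pullback:
  assumes F: "\<And>i. homogeneous (d i) (F i)"
    and p: "\<And>a. a \<in> keys p \<Longrightarrow> (\<Sum>k\<in>UNIV. lookup a k * d k) + s = e"
  shows "codegree s e (pullback F p)"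
  unfolding pullback_def msubst_def
proof (rule codegree_sum)
  fix a assume a: "a \<in> keys p"
  have "homogeneous (0 + (\<Sum>k\<in>UNIV. lookup a k * d k))
      (mconst (lookup p a) * (\<Prod>i\<in>UNIV. F i ^ lookup a i))"
    by (intro homogeneous_mult homogeneous_prod homogeneous_power homogeneous_mconst F)
  then show "codegree s e (mconst (lookup p a) * (\<Prod>i\<in>UNIV. F i ^ lookup a i))"
    using p[OF a] unfolding homogeneous_def codegree_def by auto
qed

lemma keys_mderiv:
  assumes "b \<in> keys (mderiv i p)"
  obtains a where "a \<in> keys p" "lookup a i \<noteq> 0" "a = b + single i 1"
proof -
  have "b \<in> (\<Union>a\<in>keys p. keys (single (a - single i 1)
        (of_nat (lookup a i) * lookup p a)))"
    by (rule subsetD[OF Poly_Mapping.keys_sum assms[unfolded mderiv_def]])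
  then obtain a where a: "a \<in> keys p" "lookup a i \<noteq> 0" "b = a - single i 1"
    by (auto split: if_splits)
  then have "a = b + single i 1"
    by (intro poly_mapping_eqI) (auto simp: lookup_add lookup_minus lookup_single when_def)
  then show ?thesis using that a by blast
qed

lemma mon_degree_single [simp]: "mon_degree (single i k) = k"
  by (simp add: mon_degree_def lookup_single when_def)

lemma codegree_mderiv: "homogeneous d p \<Longrightarrow> codegree 1 d (mderiv i p)"
  unfolding codegree_def homogeneous_def
  by (metis keys_mderiv mon_degree_add mon_degree_single)

definition hom_component :: "nat \<Rightarrow> 'v::finite mpoly \<Rightarrow> 'v mpoly" where
  "hom_component e p = (\<Sum>a\<in>{a \<in> keys p. mon_degree a = e}. single a (lookup p a))"

lemma lookup_hom_component:
  "lookup (hom_component e p) a = (if mon_degree a = e then lookup p a else 0)"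
  unfolding hom_component_def lookup_sum
  by (auto simp: lookup_single when_def in_keys_iff)

lemma homogeneous_hom_component: "homogeneous e (hom_component e p)"
  by (auto simp: homogeneous_def in_keys_iff lookup_hom_component split: if_splits)

lemma hom_component_add: "hom_component e (p + q) = hom_component e p + hom_component e q"
  by (rule poly_mapping_eqI) (simp add: lookup_hom_component lookup_add)

lemma hom_component_0 [simp]: "hom_component e 0 = 0"
  by (rule poly_mapping_eqI) (simp add: lookup_hom_component)

lemma hom_component_sum: "hom_component e (sum f K) = (\<Sum>k\<in>K. hom_component e (f k))"
  by (induction K rule: infinite_finite_induct) (simp_all add: hom_component_add)

lemma hom_component_homogeneous: "homogeneous e p \<Longrightarrow> hom_component e p = p"
  by (rule poly_mapping_eqI) (auto simp: lookup_hom_component homogeneous_def in_keys_iff)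

text \<open>Multiplication by p shifts degrees by e - s. If e is smaller than s, the hypothesis
  makes p zero.\<close>

lemma hom_component_mult:
  assumes "codegree s e p"
  shows "hom_component e (p * q) = p * hom_component s q"
proof -
  have single: "hom_component e (single a c * q) = single a c * hom_component s q"
    if a: "mon_degree a + s = e" for a c
  proof (induction q rule: mpoly_induct)
    case (add b d q)
    have "hom_component e (single a c * single b d) =
      single a c * hom_component s (single b d)"
    proof -
      have hs: "hom_component k (single b' d') = (if mon_degree b' = k then single b' d' else 0)"
        for k b' and d' :: complex
        by (rule poly_mapping_eqI) (auto simp: lookup_hom_component lookup_single when_def)
      have "mon_degree (a + b) = e \<longleftrightarrow> mon_degree b = s" using a by (auto simp: mon_degree_add)
      then show ?thesis by (simp add: mult_single hs)
    qed
    then show ?case using add by (simp add: distrib_left hom_component_add)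
  qed simp
  have "p = (\<Sum>a\<in>keys p. single a (lookup p a))"
    by (rule poly_mapping_eqI) (simp add: lookup_sum lookup_single when_def in_keys_iff)
  then have "hom_component e (p * q) =
      hom_component e ((\<Sum>a\<in>keys p. single a (lookup p a)) * q)"
    by simp
  also have "\<dots> = (\<Sum>a\<in>keys p. single a (lookup p a) * hom_component s q)"
    unfolding sum_distrib_right hom_component_sum
    by (intro sum.cong refl single) (use assms in \<open>simp add: codegree_def\<close>)
  also have "\<dots> = (\<Sum>a\<in>keys p. single a (lookup p a)) * hom_component s q"
    by (simp add: sum_distrib_right)
  also have "\<dots> = p * hom_component s q"
    using \<open>p = _\<close> by simp
  finally show ?thesis .
qed

lemma homogeneous_0_const:
  assumes "homogeneous 0 (p :: 'v::finite mpoly)"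
  shows "\<exists>c. p = mconst c"
proof (rule vars_in_empty)
  show "vars_in {} p" using assms unfolding homogeneous_def vars_in_def mon_degree_def by simp
qed

section \<open>Perturbations over the dual numbers\<close>

lemma rhom_dual_mconst: "rhom (\<lambda>c. Dual (mconst c) 0)"
  by (simp add: rhom_def zero_dual_number_def one_dual_number_def plus_dual_number_def times_dual_number_def
      rhom_simps[OF rhom_mconst])

text \<open>First order Taylor expansion: the product of dual numbers is exactly the Leibniz rule
  for the second component.\<close>

lemma msubst_dual:
  "msubst (\<lambda>c. Dual (mconst c) 0) (\<lambda>i. Dual (F i) (G i)) p =
    Dual (pullback F p) (\<Sum>k\<in>UNIV. pullback F (mderiv k p) * G k)"
proof (induction p rule: mpoly_ring_induct)
  case (const c)
  show ?case by (simp add: msubst_mconst[OF rhom_dual_mconst])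
next
  case (var i)
  have "pullback F (mderiv k (mvar i)) * G k = (if k = i then G i else 0)" for k by (auto simp: mderiv_mvar)
  then show ?case by (simp add: msubst_mvar[OF rhom_dual_mconst])
next
  case (add p q)
  then show ?case
    by (simp add: msubst_add[OF rhom_dual_mconst] plus_dual_number_def mderiv_add distrib_right sum.distrib)
next
  case (mult p q)
  then show ?case
    by (simp add: msubst_mult[OF rhom_dual_mconst] times_dual_number_def mderiv_mult distrib_right sum.distrib
        distrib_left sum_distrib_left sum_distrib_right mult_ac)
qed

lemma Dual_sum: "(\<Sum>k\<in>K. Dual (f k) (g k)) = Dual (sum f K) (sum g K)"
  by (induction K rule: infinite_finite_induct) (simp_all add: zero_dual_number_def plus_dual_number_def)

lemma (in integrable_pullback) perturbed_pullback_eq: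
  "perturbed_pullback F G A j = Dual (\<omega> j) (perturbation G j)"
  unfolding perturbed_pullback_def msubst_dual perturbation_def omega_eq
  by (simp add: times_dual_number_def Dual_sum a_def add.commute)

lemma map_dual_number_mconst_mult:
  "map_dual_number mconst u * Dual x y = Dual (mconst (dual_fst u) * x) (mconst (dual_fst u) * y + mconst (dual_snd u) * x)"
  by (cases u) (simp add: times_dual_number_def)

context integrable_pullback
begin

lemma unfolding_imp_perturbation:
  assumes deg: "\<And>i. homogeneous (d i) (F i)"
    and weights: "\<And>i a. a \<in> keys (A i) \<Longrightarrow> (\<Sum>k\<in>UNIV. lookup a k * d k) + d i = l"
    and \<eta>: "\<And>j. codegree 1 l (\<eta> j)"
    and h: "homogeneous l h" "\<And>i j. h * ext_deriv1 \<omega> i j = wedge11 \<omega> (\<lambda>k. \<eta> k - ext_deriv0 h k) i j"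
  shows "\<exists>G c. (\<forall>i. homogeneous (d i) (G i)) \<and> (\<forall>j. \<eta> j = perturbation G j + mconst c * \<omega> j)"
proof -
  obtain G0 where G0: "h = (\<Sum>i\<in>UNIV. G0 i * a i)" using unfolding_in_I[OF h(2)] I_iff by blast
  \<comment> \<open>As h and the a i are homogeneous of matching degrees, only the components of
    degree d i contribute to h.\<close>
  define G where "G i = hom_component (d i) (G0 i)" for i
  have G: "homogeneous (d i) (G i)" for i unfolding G_def by (rule homogeneous_hom_component)
  have a: "codegree (d i) l (a i)" for i
    unfolding a_def by (rule codegree_pullback[OF deg weights])
  have "h = hom_component l h" using hom_component_homogeneous[OF h(1)] by simp
  also have "\<dots> = (\<Sum>i\<in>UNIV. hom_component l (a i * G0 i))" unfolding G0 hom_component_sum by (simp add: mult.commute)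
  also have "\<dots> = (\<Sum>i\<in>UNIV. a i * G i)" unfolding hom_component_mult[OF a] G_def ..
  finally have hG: "h = (\<Sum>i\<in>UNIV. a i * G i)" .
  have "codegree (0 + 1) l (a i * mderiv j (F i))" for i j
    by (rule codegree_mult[where d = "d i", OF _ codegree_mderiv[OF deg]]) (simp add: a)
  then have "codegree (0 + 1) l (\<omega> j)" for j unfolding omega_eq by (intro codegree_sum)
  then have \<omega>: "codegree 1 l (\<omega> j)" for j by simp
  have "codegree (0 + 1) l (perturbation G j)" for j unfolding perturbation_def
  proof (intro codegree_sum codegree_add)
    fix i
    show "codegree (0 + 1) l (a i * mderiv j (G i))"
      by (rule codegree_mult[where d = "d i"]) (use a codegree_mderiv[OF G] in auto)
    have "codegree (d i + 0) l (\<Sum>k\<in>UNIV. pullback F (mderiv k (A i)) * G k)"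
    proof (rule codegree_sum, rule codegree_mult)
      fix k
      show "codegree (d i + d k) l (pullback F (mderiv k (A i)))"
      proof (rule codegree_pullback[OF deg])
        fix b assume "b \<in> keys (mderiv k (A i))"
        then obtain c where c: "c \<in> keys (A i)" "c = b + single k 1" by (rule keys_mderiv)
        have "(\<Sum>m\<in>UNIV. lookup c m * d m) =
          (\<Sum>m\<in>UNIV. lookup b m * d m) + (\<Sum>m\<in>UNIV. if m = k then d m else 0)"
          unfolding c(2) sum.distrib[symmetric] by (intro sum.cong refl) (auto simp: lookup_add lookup_single when_def)
        then show "(\<Sum>m\<in>UNIV. lookup b m * d m) + (d i + d k) = l" using weights[OF c(1)] by simp
      qed
      show "codegree 0 (d k) (G k)" using G[of k] by (simp add: homogeneous_iff_codegree)
    qed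
    then show "codegree (0 + 1) l ((\<Sum>k\<in>UNIV. pullback F (mderiv k (A i)) * G k) * mderiv j (F i))"
      by (intro codegree_mult[where d = "d i"] codegree_mderiv deg) simp
  qed
  then have pert: "codegree 1 l (perturbation G j)" for j by simp
  \<comment> \<open>Both deformations unfold with the same h, so the terms in h and dh cancel and
    the difference is parallel to \<omega>.\<close>
  have "\<omega> j * (\<eta> k - perturbation G k) = \<omega> k * (\<eta> j - perturbation G j)" for j k
  proof -
    have "wedge11 \<omega> (\<lambda>k. \<eta> k - mderiv k h) j k = wedge11 \<omega> (\<lambda>k. perturbation G k - mderiv k h) j k"
      using h(2)[of j k] perturbation_unfolding[of G j k] unfolding hG[symmetric] ext_deriv0_def by simp
    then show ?thesis unfolding wedge11_def by (simp add: algebra_simps)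
  qed
  then obtain e where e: "\<And>j. \<eta> j - perturbation G j = \<omega> j * e"
    using proportional_omega[of "\<lambda>j. \<eta> j - perturbation G j"] by blast
  obtain c where c: "hom_component 0 e = mconst c" using homogeneous_0_const[OF homogeneous_hom_component] by blast
  have "\<eta> j = perturbation G j + mconst c * \<omega> j" for j
  proof -
    \<comment> \<open>The truncated l - 1 is harmless: for l = 0 the hypothesis leaves only p = 0.
      Since \<omega> and the difference have the same degree, only the constant component of e
      survives.\<close>
    have shift: "homogeneous (l - 1) p" if "codegree 1 l p" for p :: "'n mpoly"
      using that by (auto simp: homogeneous_def codegree_def)
    have "codegree 0 (l - 1) (\<omega> j)" using shift[OF \<omega>] by (simp add: homogeneous_iff_codegree)
    then have "hom_component (l - 1) (\<omega> j * e) = \<omega> j * mconst c" unfolding c[symmetric] by (rule hom_component_mult)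
    moreover have "hom_component (l - 1) (\<eta> j - perturbation G j) = \<eta> j - perturbation G j"
      by (intro hom_component_homogeneous shift codegree_diff \<eta> pert)
    ultimately have "\<eta> j - perturbation G j = \<omega> j * mconst c" unfolding e[of j, symmetric] by simp
    then show ?thesis by (simp add: algebra_simps)
  qed
  then show ?thesis using G by blast
qed

text \<open>Deformations are compared up to a unit u + \<epsilon> u': the factor u rescales h, and
  the multiple u' of \<omega> disappears in the wedge with \<omega>.\<close>

lemma perturbation_imp_unfolding:
  assumes deg: "\<And>i. homogeneous (d i) (F i)"
    and weights: "\<And>i a. a \<in> keys (A i) \<Longrightarrow> (\<Sum>k\<in>UNIV. lookup a k * d k) + d i = l"
    and G: "\<And>i. homogeneous (d i) (G i)"
    and \<eta>: "\<And>j. perturbation G j = mconst u * \<eta> j + mconst u' * \<omega> j" and u: "u \<noteq> 0"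
  shows "induced_by_unfolding l \<omega> \<eta>"
  unfolding induced_by_unfolding_def
proof (intro exI conjI allI)
  let ?h = "\<Sum>i\<in>UNIV. a i * G i"
  let ?h' = "mconst (1 / u) * ?h"
  have "codegree (0 + 0) l ?h"
  proof (intro codegree_sum codegree_mult)
    show "codegree (0 + d i) l (a i)" for i unfolding a_def by (simp add: codegree_pullback[OF deg weights])
    show "codegree 0 (d i) (G i)" for i using G[of i] by (simp add: homogeneous_iff_codegree)
  qed
  then show "homogeneous l ?h'"
    using homogeneous_mult[OF homogeneous_mconst, of l ?h] by (simp add: homogeneous_iff_codegree)
  have inv: "mconst (1 / u) * (mconst u * x) = x" for x :: "'n mpoly"
    using u by (simp add: mult.assoc[symmetric] rhom_simps(4)[OF rhom_mconst, symmetric])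
  fix i j
  have "?h' * ext_deriv1 \<omega> i j = mconst (1 / u) * wedge11 \<omega> (\<lambda>k. perturbation G k - mderiv k ?h) i j"
    using perturbation_unfolding[of G i j] by (simp add: mult.assoc)
  also have "\<dots> = wedge11 \<omega> (\<lambda>k. mconst (1 / u) * (mconst u * \<eta> k) - mconst (1 / u) * mderiv k ?h) i j"
    unfolding wedge11_def \<eta> by (simp add: algebra_simps)
  also have "\<dots> = wedge11 \<omega> (\<lambda>k. \<eta> k - ext_deriv0 ?h' k) i j"
    unfolding inv ext_deriv0_def by (simp add: mderiv_mult)
  finally show "?h' * ext_deriv1 \<omega> i j = wedge11 \<omega> (\<lambda>k. \<eta> k - ext_deriv0 ?h' k) i j" .
qed

end

theorem theoremB:
  fixes \<Sigma> :: "(real \<times> real) set set"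
    and v :: "'m::finite \<Rightarrow> int \<times> int"
    and H :: "'h monoid"
    and \<psi> :: "('m \<Rightarrow>\<^sub>0 int) set \<Rightarrow> (nat \<Rightarrow> int) \<times> 'h"
    and \<D> :: "('m \<Rightarrow>\<^sub>0 int) set"
    and A :: "'m \<Rightarrow> 'm mpoly"
    and U :: "('n::finite \<Rightarrow> complex) set set"
    and \<phi> :: "('n \<Rightarrow> complex) set \<Rightarrow> ('m \<Rightarrow> complex) set"
    and F :: "'m \<Rightarrow> 'n mpoly"
    and \<omega> \<eta> :: "'n \<Rightarrow> 'n mpoly"
    and n l :: nat
  assumes "complete_fan \<Sigma>" and "simplicial_fan \<Sigma>"
    and "primitive_ray_generators \<Sigma> v"
    and "class_group_splitting v H \<psi>"
    and "\<D> \<in> carrier (class_group v)"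
    and "A \<in> reflexive_one_forms v \<psi> \<D>"
    and "toric_foliation \<Sigma> v A"
    and "CARD('n) = n + 1" and "n > CARD('m)"
    and "rational_map \<Sigma> v U \<phi>"
    and "dominant_map \<Sigma> v U \<phi>"
    and "complete_lifting \<Sigma> v U \<phi> F"
    and "\<omega> = pullback_form F A"
    and "affinely_generic_pair \<Sigma> v F A"
    and "flat_ring_hom mpoly_ring mpoly_ring (pullback F)"
    and "first_order_deformation l \<omega> \<eta>"
  shows "induced_by_unfolding l \<omega> \<eta> \<longleftrightarrow>
    (\<exists>G. (\<forall>j. homogeneous (mdegree (F j)) (G j)) \<and>
         same_deformation (deformation_form \<omega> \<eta>) (perturbed_pullback F G A))"
proof -
  note rays = assms(3) and D = assms(5) and A = assms(6) and fol = assms(7) and rat = assms(10)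
    and lift = assms(12) and gen = assms(14) and flat = assms(15) and def = assms(16)
  have JK: "form_ideal_J A = form_ideal_K A" and crit: "codim zariski (critical_points F) \<ge> 3"
    using gen by (auto simp: affinely_generic_pair_def affinely_generic_form_def generic_pair_def)
  obtain i0 where i0: "A i0 \<noteq> 0" using form_nonzero[OF JK] by blast
  interpret integrable_pullback F A
  proof
    show "wedge12 A (ext_deriv1 A) i j k = 0" for i j k using fol by (simp add: toric_foliation_def)
    show "meets_subring (form_ideal_J A) T" if "CARD('m) \<le> card T + 1" for T
      unfolding form_ideal_J_def
    proof (rule toric_codim_2_meets_subring[OF rays, where f = A])
      show "A i0 \<noteq> 0" "CARD('m) \<le> card T + 1" by fact+
      show "class_homogeneous v (\<D> \<otimes>\<^bsub>class_group v\<^esub> inv\<^bsub>class_group v\<^esub> prime_divisor_class v i) (A i)" for i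
        using A by (simp add: reflexive_one_forms_def)
      show "codim (toric_variety \<Sigma> v)
          (toric_proj v ` {z. z \<notin> irrelevant_locus \<Sigma> v \<and> (\<forall>i. meval (A i) z = 0)}) \<ge> 2"
        using fol by (simp add: toric_foliation_def)
    qed
  qed (fact flat JK crit)+
  have \<omega>: "\<omega> = integrable_pullback.\<omega> F A" by (simp only: assms(13) \<omega>_def)
  define d where "d i = mdegree (F i)" for i
  have deg: "homogeneous (d i) (F i)" for i
    using lift F_nonzero[of i] homogeneous_mdegree unfolding complete_lifting_def d_def by metis
  obtain g where g: "g \<in> toric_group v" "\<And>i. g (prime_divisor_class v i) = 2 ^ d i"
    using lifting_degrees[OF rays rat lift F_nonzero deg] by blast
  obtain \<delta> where \<delta>: "\<And>i a. a \<in> keys (A i) \<Longrightarrow> (\<Sum>k\<in>UNIV. lookup a k * d k) + d i = \<delta>"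
    using reflexive_form_weights[OF D A g] by blast
  have \<omega>l: "codegree 1 l (\<omega> j)" and \<eta>l: "codegree 1 l (\<eta> j)" for j
    using def by (auto simp: first_order_deformation_def projective_one_forms_def codegree_def)
  \<comment> \<open>The weight \<delta> comes from the class grading and l from the deformation; a
    monomial of the nonzero form \<omega> has degree one less than each.\<close>
  have "\<delta> = l"
  proof -
    have "codegree (0 + 1) \<delta> (pullback F (A i) * mderiv j (F i))" for i j
      by (rule codegree_mult[where d = "d i", OF _ codegree_mderiv[OF deg]])
        (simp add: codegree_pullback[OF deg \<delta>])
    then have "codegree (0 + 1) \<delta> (\<omega> j)" for j unfolding \<omega> omega_eq a_def by (intro codegree_sum)
    moreover obtain j where "\<omega> j \<noteq> 0" using omega_nonzero \<omega> by auto
    moreover then obtain b where "b \<in> keys (\<omega> j)" by (metis keys_eq_empty ex_in_conv)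
    ultimately show ?thesis using \<omega>l[of j] by (auto simp: codegree_def)
  qed
  note weights = \<delta>[unfolded \<open>\<delta> = l\<close>]
  show ?thesis
  proof
    assume "induced_by_unfolding l \<omega> \<eta>"
    then obtain h where h: "homogeneous l h" "\<And>i j. h * ext_deriv1 \<omega> i j = wedge11 \<omega> (\<lambda>k. \<eta> k - ext_deriv0 h k) i j"
      unfolding induced_by_unfolding_def by blast
    obtain G c where G: "\<And>i. homogeneous (d i) (G i)" and c: "\<And>j. \<eta> j = perturbation G j + mconst c * \<omega> j"
      using unfolding_imp_perturbation[OF deg weights \<eta>l h[unfolded \<omega>]] unfolding \<omega> by blast
    \<comment> \<open>Multiplication by 1 - c \<epsilon> removes the constant multiple of \<omega>
      from \<eta>, so the unit absorbs the remaining ambiguity.\<close>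
    let ?u = "Dual 1 (- c)"
    have "?u * Dual 1 c = 1" by (simp add: times_dual_number_def one_dual_number_def)
    then have "?u dvd 1" by (metis dvd_triv_left)
    moreover have "perturbed_pullback F G A j = map_dual_number mconst ?u * deformation_form \<omega> \<eta> j" for j
      unfolding perturbed_pullback_eq deformation_form_def map_dual_number_mconst_mult c \<omega>[symmetric]
      by (simp add: rhom_uminus[OF rhom_mconst])
    ultimately have "same_deformation (deformation_form \<omega> \<eta>) (perturbed_pullback F G A)"
      unfolding same_deformation_def by blast
    then show "\<exists>G. (\<forall>j. homogeneous (mdegree (F j)) (G j)) \<and>
        same_deformation (deformation_form \<omega> \<eta>) (perturbed_pullback F G A)"
      using G unfolding d_def by blast
  next
    assume "\<exists>G. (\<forall>j. homogeneous (mdegree (F j)) (G j)) \<and>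
        same_deformation (deformation_form \<omega> \<eta>) (perturbed_pullback F G A)"
    then obtain G u where G: "\<And>j. homogeneous (d j) (G j)" and u: "u dvd 1"
      "\<And>j. perturbed_pullback F G A j = map_dual_number mconst u * deformation_form \<omega> \<eta> j"
      unfolding same_deformation_def d_def by blast
    obtain w where "1 = u * w" using u(1) by (auto simp: dvd_def)
    then have "dual_fst u \<noteq> 0" by (auto simp: times_dual_number_def one_dual_number_def)
    moreover have "perturbation G j = mconst (dual_fst u) * \<eta> j + mconst (dual_snd u) * \<omega> j" for j
      using u(2)[of j] unfolding perturbed_pullback_eq deformation_form_def map_dual_number_mconst_mult by simp
    ultimately show "induced_by_unfolding l \<omega> \<eta>"
      unfolding \<omega> by (intro perturbation_imp_unfolding[OF deg weights G])
  qed
qed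

end
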